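(* Let $\alpha>0$ and let $D\subset\mathbb C$ be a bounded open set. For each integer $0\le k\le\lfloor 1/\alpha\rfloor$ there is a measurable map $S_k:\mathcal S_{D^c}\to\mathbb C$ such that almost surely $\sum_{z\in\mathcal Z_\alpha\cap D}z^k=S_k(\mathcal Z_\alpha\cap D^c)$.
   Context: $f_\alpha(z)=\sum_{j=0}^\infty \frac{\xi_j}{(j!)^{\alpha/2}}z^j$ with $\xi_j$ i.i.d. standard complex Gaussians, and $\mathcal Z_\alpha$ is its zero set. $\mathcal S_{D^c}$ denotes the space of locally finite point configurations in $D^c$ (with the Borel $\sigma$-algebra of the vague topology). *)

theory Defs
  imports "HOL-Probability.Probability"
begin

definition std_complex_gaussian_density :: "complex \<Rightarrow> ennreal" where
  "std_complex_gaussian_density z = ennreal (exp (- (norm z * norm z)) / pi)"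

definition GEF :: "real \<Rightarrow> (nat \<Rightarrow> 'w \<Rightarrow> complex) \<Rightarrow> 'w \<Rightarrow> complex \<Rightarrow> complex" where
  "GEF \<alpha> \<xi> \<omega> z = (\<Sum>j. \<xi> j \<omega> / complex_of_real ((fact j) powr (\<alpha> / 2)) * z ^ j)"

definition GEF_zeros :: "real \<Rightarrow> (nat \<Rightarrow> 'w \<Rightarrow> complex) \<Rightarrow> 'w \<Rightarrow> complex set" where
  "GEF_zeros \<alpha> \<xi> \<omega> = {z. GEF \<alpha> \<xi> \<omega> z = 0}"

definition loc_fin_configs :: "complex set \<Rightarrow> complex set set" where
  "loc_fin_configs A = {X. X \<subseteq> A \<and> (\<forall>B. bounded B \<longrightarrow> finite (X \<inter> B))}"

text \<open>The configuration space with the sigma-algebra generated by the counting maps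
  X \<mapsto> #(X \<inter> B), B bounded Borel (= Borel sigma-algebra of the vague topology).\<close>
definition config_space :: "complex set \<Rightarrow> complex set measure" where
  "config_space A = sigma (loc_fin_configs A)
     {{X \<in> loc_fin_configs A. card (X \<inter> B) = n} | B n. B \<in> sets borel \<and> bounded B}"

end

theory Submission
  imports Defs "HOL-Complex_Analysis.Complex_Analysis"
begin

text \<open>Let \<open>f\<close> be the random series. For a weight \<open>w\<close> on the radii \<open>[R0, R1]\<close>, where \<open>D\<close> lies in the disc of
  radius \<open>R0\<close>, Jensen's formula turns the average of \<open>ln |f(r e^{it})| e^{ikt}\<close> over \<open>w(r) dr dt\<close> into a
  linear statistic of the zeros. Two moment conditions on \<open>w\<close> make its test function equal to \<open>z^k\<close> for
  \<open>|z| \<le> R0\<close> and to \<open>0\<close> for \<open>|z| > R1\<close>. If the second moments of the centred statistics are summable along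
  a sequence of weights, the statistics tend to \<open>0\<close> almost surely, and the \<open>k\<close>-th moment of the zeros in
  \<open>D\<close> is the limit of a constant minus the contributions of the zeros outside \<open>D\<close>.

  The covariance of \<open>ln |f(z)|\<close> and \<open>ln |f(w)|\<close> is at most a constant times the squared modulus of the
  normalised covariance kernel. By orthogonality on circles, the angular integral of the latter is the
  overlap of the distributions \<open>j \<mapsto> r^{2j} / (j!)^\<alpha>\<close> (normalised) at the two radii. Weights of size
  \<open>r^{k-1} / ln (R1 / R0)\<close> then give a second moment of order \<open>1 / ln (R1 / R0)\<close>, and this is where
  \<open>k \<alpha> \<le> 1\<close> enters.\<close>

section \<open>Lebesgue measure on the complex plane\<close>

text \<open>Write \<open>p_j(r)\<close> for the coefficient distribution. The integral of
  \<open>s * p_j(s)\<close> is at most \<open>(j + 1) powr (\<alpha> - 1) / 2\<close>;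
  \<open>k * \<alpha> \<le> 1\<close> bounds this by
  \<open>(j + 1) powr (- ((k - 1) * \<alpha>)) / 2\<close>, whose average over \<open>p_j(r)\<close>
  is of order \<open>1 / r ^ (2 * (k - 1))\<close>. What remains is an integral of
  \<open>1 / r\<close>, so the weight is spread on a logarithmic scale: normalisation contributes
  \<open>1 / ln (R1 / R0)\<close> squared, against one factor \<open>ln (R1 / R0)\<close>. For
  \<open>k = 0\<close> the bound \<open>1\<close> on overlaps suffices, since there are weights of
  small total variation.

  The covariance bound has no term linear in the kernel: averaging the logarithm of a Gaussian with
  mean \<open>c\<close> over rotations costs only the square of \<open>cmod c\<close>.

  Jensen's formula counts zeros with multiplicity whereas a configuration is a set, so the zeros
  must be shown to be almost surely simple. The obstacle there is measurability, met by looking for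
  approximate double zeros in a countable dense set.\<close>

lemma lborel_complex_eq:
  "(lborel :: complex measure) = distr (lborel \<Otimes>\<^sub>M lborel) borel (\<lambda>(x, y). Complex x y)"
proof (rule lborel_eqI)
  have [measurable]: "(\<lambda>(x, y). Complex x y) \<in> borel_measurable (borel \<Otimes>\<^sub>M borel)"
    unfolding Complex_eq by measurable
  fix l u :: complex
  assume le: "\<And>b. b \<in> Basis \<Longrightarrow> l \<bullet> b \<le> u \<bullet> b"
  have "Re l \<le> Re u" "Im l \<le> Im u"
    using le[of 1] le[of \<i>] by (auto simp: Basis_complex_def)
  have "emeasure (distr (lborel \<Otimes>\<^sub>M lborel) borel (\<lambda>(x, y). Complex x y)) (box l u)
     = emeasure (lborel \<Otimes>\<^sub>M lborel) ({Re l<..<Re u} \<times> {Im l<..<Im u})"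
    by (subst emeasure_distr)
       (auto simp: space_pair_measure box_def Basis_complex_def intro!: arg_cong[where f="emeasure _"])
  also have "\<dots> = ennreal (Re u - Re l) * ennreal (Im u - Im l)"
    using \<open>Re l \<le> Re u\<close> \<open>Im l \<le> Im u\<close>
    by (subst lborel.emeasure_pair_measure_Times) auto
  also have "\<dots> = ennreal (\<Prod>b\<in>Basis. (u - l) \<bullet> b)"
    using \<open>Re l \<le> Re u\<close> \<open>Im l \<le> Im u\<close> by (simp add: Basis_complex_def ennreal_mult)
  finally show "emeasure (distr (lborel \<Otimes>\<^sub>M lborel) borel (\<lambda>(x, y). Complex x y)) (box l u)
     = (\<Prod>b\<in>Basis. (u - l) \<bullet> b)" .
qed simp

lemma nn_integral_lborel_complex:
  assumes [measurable]: "F \<in> borel_measurable borel"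
  shows "(\<integral>\<^sup>+z. F z \<partial>lborel) = (\<integral>\<^sup>+x. \<integral>\<^sup>+y. F (Complex x y) \<partial>lborel \<partial>lborel)"
proof -
  have [measurable]: "(\<lambda>(x, y). Complex x y) \<in> borel_measurable (borel \<Otimes>\<^sub>M borel)"
    unfolding Complex_eq by measurable
  have "(\<integral>\<^sup>+z. F z \<partial>lborel) = (\<integral>\<^sup>+p. F (case p of (x, y) \<Rightarrow> Complex x y) \<partial>(lborel \<Otimes>\<^sub>M lborel))"
    by (subst lborel_complex_eq, subst nn_integral_distr) auto
  also have "\<dots> = (\<integral>\<^sup>+x. \<integral>\<^sup>+y. F (Complex x y) \<partial>lborel \<partial>lborel)"
    by (subst lborel.nn_integral_fst[symmetric]) auto
  finally show ?thesis .
qed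

lemma nn_integral_lborel_scaleR:
  fixes F :: "'a::euclidean_space \<Rightarrow> ennreal"
  assumes [measurable]: "F \<in> borel_measurable borel" and c: "c \<noteq> 0"
  shows "(\<integral>\<^sup>+x. F x \<partial>lborel) = ennreal (\<bar>c\<bar> ^ DIM('a)) * (\<integral>\<^sup>+x. F (t + c *\<^sub>R x) \<partial>lborel)"
  by (subst lborel_affine[OF c, of t])
     (simp add: nn_integral_density nn_integral_distr nn_integral_cmult)

text \<open>The affine substitution rule is a hypothesis so that real and complex shears are treated at once. The
  proof is Gaussian elimination, which needs \<open>a \<noteq> 0\<close>.\<close>
lemma nn_integral_shear:
  fixes F :: "'a::{euclidean_space,real_normed_field} \<Rightarrow> 'a \<Rightarrow> ennreal" and a b c d :: 'a
  assumes aff: "\<And>F t s. F \<in> borel_measurable borel \<Longrightarrow> s \<noteq> 0 \<Longrightarrow>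
      (\<integral>\<^sup>+x. F x \<partial>lborel) = ennreal (norm s ^ n) * (\<integral>\<^sup>+x. F (t + s * x :: 'a) \<partial>lborel)"
    and F0[measurable]: "case_prod F \<in> borel_measurable (borel \<Otimes>\<^sub>M borel)"
    and a: "a \<noteq> 0" and det: "a * d - b * c = 1"
  shows "(\<integral>\<^sup>+x. \<integral>\<^sup>+y. F (a * x + b * y) (c * x + d * y) \<partial>lborel \<partial>lborel)
    = (\<integral>\<^sup>+x. \<integral>\<^sup>+y. F x y \<partial>lborel \<partial>lborel)"
proof -
  have F: "(\<lambda>x. F (f x) (g x)) \<in> borel_measurable N"
    if "f \<in> borel_measurable N" "g \<in> borel_measurable N" for f g N
    using measurable_compose[OF measurable_Pair[OF that] F0] by simp
  define K where "K = ennreal (norm (1 / a) ^ n)"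
  have K: "K * ennreal (norm a ^ n) = 1"
    using a by (simp add: K_def norm_divide power_divide flip: ennreal_mult)
  have "(\<integral>\<^sup>+x. \<integral>\<^sup>+y. F (a * x + b * y) (c * x + d * y) \<partial>lborel \<partial>lborel)
     = (\<integral>\<^sup>+y. \<integral>\<^sup>+x. F (a * x + b * y) (c * x + d * y) \<partial>lborel \<partial>lborel)"
    by (rule lborel_pair.Fubini') (auto simp: split_beta' intro!: F)
  \<comment> \<open>For fixed \<open>y\<close> substitute \<open>X = a * x + b * y\<close>; the
    determinant condition turns the second argument into \<open>c / a * X + 1 / a * y\<close>. The
    same is then done in \<open>y\<close> for fixed \<open>X\<close>, and the two Jacobians
    cancel.\<close>
  also have "\<dots> = (\<integral>\<^sup>+y. K * (\<integral>\<^sup>+X. F X (c / a * X + 1 / a * y) \<partial>lborel) \<partial>lborel)"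
  proof (rule nn_integral_cong)
    fix y :: 'a
    have eq: "a * (- (b / a) * y + 1 / a * X) + b * y = X"
      "c * (- (b / a) * y + 1 / a * X) + d * y = c / a * X + 1 / a * y" for X
    proof -
      show "a * (- (b / a) * y + 1 / a * X) + b * y = X" using a by (simp add: field_simps)
      have "a * (c * (- (b / a) * y + 1 / a * X) + d * y) = (a * d - b * c) * y + c * X"
        using a by (simp add: field_simps)
      then have "a * (c * (- (b / a) * y + 1 / a * X) + d * y) = a * (c / a * X + 1 / a * y)"
        unfolding det using a by (simp add: field_simps)
      then show "c * (- (b / a) * y + 1 / a * X) + d * y = c / a * X + 1 / a * y"
        using a by (simp only: mult_cancel_left) simp
    qed
    show "(\<integral>\<^sup>+x. F (a * x + b * y) (c * x + d * y) \<partial>lborel)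
       = K * (\<integral>\<^sup>+X. F X (c / a * X + 1 / a * y) \<partial>lborel)"
      using aff[of "\<lambda>x. F (a * x + b * y) (c * x + d * y)" "1 / a" "- (b / a) * y"] a
      unfolding K_def by (simp only: eq) (auto intro!: F)
  qed
  also have "\<dots> = K * (\<integral>\<^sup>+y. \<integral>\<^sup>+X. F X (c / a * X + 1 / a * y) \<partial>lborel \<partial>lborel)"
    by (intro nn_integral_cmult lborel.borel_measurable_nn_integral) (auto simp: split_beta' intro!: F)
  also have "\<dots> = K * (\<integral>\<^sup>+X. \<integral>\<^sup>+y. F X (c / a * X + 1 / a * y) \<partial>lborel \<partial>lborel)"
    by (subst lborel_pair.Fubini') (auto simp: split_beta' intro!: F)
  also have "\<dots> = K * (\<integral>\<^sup>+X. ennreal (norm a ^ n) * (\<integral>\<^sup>+y. F X y \<partial>lborel) \<partial>lborel)"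
  proof (intro arg_cong2[where f="(*)"] refl nn_integral_cong)
    fix X :: 'a
    have eq: "c / a * X + 1 / a * (- c * X + a * y) = y" for y
      using a by (simp add: field_simps)
    show "(\<integral>\<^sup>+y. F X (c / a * X + 1 / a * y) \<partial>lborel) = ennreal (norm a ^ n) * (\<integral>\<^sup>+y. F X y \<partial>lborel)"
      using aff[of "\<lambda>y. F X (c / a * X + 1 / a * y)" a "- c * X"] a
      by (simp only: eq) (auto intro!: F)
  qed
  also have "\<dots> = K * ennreal (norm a ^ n) * (\<integral>\<^sup>+X. \<integral>\<^sup>+y. F X y \<partial>lborel \<partial>lborel)"
    by (subst nn_integral_cmult) (auto simp: mult.assoc)
  finally show ?thesis by (simp only: K) simp
qed

text \<open>In real coordinates this is a shear whose matrix has diagonal entries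
  \<open>Re c\<close> and determinant \<open>(cmod c)\<^sup>2 = 1\<close>.\<close>

lemma nn_integral_rotate_complex:
  assumes F[measurable]: "F \<in> borel_measurable borel" and c: "cmod c = 1"
  shows "(\<integral>\<^sup>+z. F (c * z) \<partial>lborel) = (\<integral>\<^sup>+z. F z \<partial>lborel)"
proof -
  have *: "(\<integral>\<^sup>+z. F (c * z) \<partial>lborel) = (\<integral>\<^sup>+z. F z \<partial>lborel)"
    if "cmod c = 1" "Re c \<noteq> 0" and [measurable]: "F \<in> borel_measurable borel" for c
      and F :: "complex \<Rightarrow> ennreal"
  proof -
    have "c * Complex x y = Complex (Re c * x - Im c * y) (Im c * x + Re c * y)" for x y
      by (simp add: complex_eq_iff)
    moreover have "(\<lambda>(x, y). F (Complex x y)) \<in> borel_measurable (borel \<Otimes>\<^sub>M borel)"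
      unfolding Complex_eq by measurable
    moreover have "(Re c)\<^sup>2 + (Im c)\<^sup>2 = 1" using that(1) by (simp add: cmod_def)
    ultimately show ?thesis
      using nn_integral_shear[of 1 "\<lambda>x y. F (Complex x y)" "Re c" "Re c" "- Im c" "Im c"] that(2)
        nn_integral_lborel_scaleR[where 'a=real]
      by (simp add: nn_integral_lborel_complex power2_eq_square)
  qed
  show ?thesis
  proof (cases "Re c = 0")
    case True
    \<comment> \<open>Elimination fails for quarter turns; these are composed of two rotations by \<open>csqrt c\<close>.\<close>
    define d where "d = csqrt c"
    have d: "d * d = c" by (simp add: d_def flip: power2_eq_square)
    have "cmod d * cmod d = 1" using c by (simp add: d flip: norm_mult)
    then have d1: "cmod d = 1" by (metis norm_ge_zero real_sqrt_abs2 real_sqrt_one abs_of_nonneg)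
    have "Re d \<noteq> 0"
    proof
      assume "Re d = 0"
      then have "c = - (Im d)\<^sup>2" using d by (auto simp: complex_eq_iff power2_eq_square)
      then show False using True c by auto
    qed
    have "(\<integral>\<^sup>+z. F (c * z) \<partial>lborel) = (\<integral>\<^sup>+z. F (d * (d * z)) \<partial>lborel)" by (simp flip: d mult.assoc)
    also have "\<dots> = (\<integral>\<^sup>+z. F (d * z) \<partial>lborel)"
      by (rule *[where F="\<lambda>z. F (d * z)"]) (use d1 \<open>Re d \<noteq> 0\<close> in auto)
    also have "\<dots> = (\<integral>\<^sup>+z. F z \<partial>lborel)"
      by (rule *) (use d1 \<open>Re d \<noteq> 0\<close> in auto)
    finally show ?thesis .
  qed (use * c in auto)
qed

text \<open>Multiplication by \<open>c\<close> is the rotation by \<open>sgn c\<close> followed by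
  scaling with \<open>cmod c\<close>. The result supplies the substitution hypothesis of
  \<open>nn_integral_shear\<close> over the complex numbers, with \<open>n = 2\<close>.\<close>

lemma nn_integral_affine_complex:
  assumes F[measurable]: "F \<in> borel_measurable borel" and c: "c \<noteq> 0"
  shows "(\<integral>\<^sup>+z. F z \<partial>lborel) = ennreal ((cmod c)\<^sup>2) * (\<integral>\<^sup>+z. F (t + c * z) \<partial>lborel)"
proof -
  have "(\<integral>\<^sup>+z. F z \<partial>lborel) = ennreal ((cmod c)\<^sup>2) * (\<integral>\<^sup>+z. F (t + cmod c *\<^sub>R z) \<partial>lborel)"
    by (subst nn_integral_lborel_scaleR[of F "cmod c" t]) (use c in auto)
  also have "(\<integral>\<^sup>+z. F (t + cmod c *\<^sub>R z) \<partial>lborel) = (\<integral>\<^sup>+z. F (t + cmod c *\<^sub>R (sgn c * z)) \<partial>lborel)"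
    by (rule nn_integral_rotate_complex[symmetric, where F="\<lambda>z. F (t + cmod c *\<^sub>R z)"])
       (use c in \<open>auto simp: norm_sgn\<close>)
  also have "\<dots> = (\<integral>\<^sup>+z. F (t + c * z) \<partial>lborel)"
    using c by (auto simp: sgn_div_norm scaleR_conv_of_real field_simps)
  finally show ?thesis .
qed

section \<open>The standard complex Gaussian\<close>

definition cgauss :: "complex measure" where
  "cgauss = density lborel std_complex_gaussian_density"

lemma measurable_std_complex_gaussian_density[measurable]:
  "std_complex_gaussian_density \<in> borel_measurable borel"
  unfolding std_complex_gaussian_density_def by measurable

lemma sets_cgauss[simp, measurable_cong]: "sets cgauss = sets borel"
  by (simp add: cgauss_def)

lemma space_cgauss[simp]: "space cgauss = UNIV"
  by (simp add: cgauss_def)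

lemma nn_integral_cgauss:
  "F \<in> borel_measurable borel \<Longrightarrow>
    (\<integral>\<^sup>+x. F x \<partial>cgauss) = (\<integral>\<^sup>+x. std_complex_gaussian_density x * F x \<partial>lborel)"
  by (simp add: cgauss_def nn_integral_density)

lemma prob_space_cgauss: "prob_space cgauss"
proof
  \<comment> \<open>The real and imaginary parts have variance \<open>1 / 2\<close> each, because
    the second absolute moment is \<open>1\<close>.\<close>
  define g where "g = normal_density 0 (1 / sqrt 2)"
  have [measurable]: "g \<in> borel_measurable borel" by (simp add: g_def)
  have g: "(\<integral>\<^sup>+x. ennreal (g x) \<partial>lborel) = 1"
    unfolding g_def
    by (subst nn_integral_eq_integral) (auto intro: integrable_normal_density
      simp: integral_normal_density)
  have dens: "std_complex_gaussian_density (Complex x y) = ennreal (g x) * ennreal (g y)" for x y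
    by (simp add: std_complex_gaussian_density_def g_def normal_density_def cmod_def power_divide
        real_sqrt_divide power2_eq_square exp_add[symmetric] flip: ennreal_mult)
  have "emeasure cgauss UNIV = (\<integral>\<^sup>+z. std_complex_gaussian_density z \<partial>lborel)"
    by (simp add: cgauss_def emeasure_density)
  also have "\<dots> = (\<integral>\<^sup>+x. \<integral>\<^sup>+y. ennreal (g x) * ennreal (g y) \<partial>lborel \<partial>lborel)"
    by (subst nn_integral_lborel_complex) (auto simp: dens)
  also have "\<dots> = 1"
    by (simp add: nn_integral_cmult nn_integral_multc g)
  finally show "emeasure cgauss (space cgauss) = 1" by simp
qed

interpretation cgauss: prob_space cgauss
  by (rule prob_space_cgauss)

interpretation cgauss_pair: pair_prob_space cgauss cgauss ..

lemma nn_integral_cgauss_rotate: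
  assumes F[measurable]: "F \<in> borel_measurable borel" and c: "cmod c = 1"
  shows "(\<integral>\<^sup>+z. F (c * z) \<partial>cgauss) = (\<integral>\<^sup>+z. F z \<partial>cgauss)"
  using nn_integral_rotate_complex[of "\<lambda>z. std_complex_gaussian_density z * F z" c] c
  by (simp add: nn_integral_cgauss std_complex_gaussian_density_def norm_mult)

text \<open>The substitution is unitary with determinant \<open>1\<close>: it preserves Lebesgue
  measure by \<open>nn_integral_shear\<close>, and the joint density because that depends only on
  the sum of the squared moduli.\<close>

lemma nn_integral_cgauss_unitary:
  fixes F :: "complex \<Rightarrow> complex \<Rightarrow> ennreal" and a b :: complex
  assumes meas[measurable]: "case_prod F \<in> borel_measurable (borel \<Otimes>\<^sub>M borel)" and a: "a \<noteq> 0"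
    and 1: "(cmod a)\<^sup>2 + (cmod b)\<^sup>2 = 1"
  shows "(\<integral>\<^sup>+x. \<integral>\<^sup>+y. F (a * x + b * y) (- cnj b * x + cnj a * y) \<partial>cgauss \<partial>cgauss)
      = (\<integral>\<^sup>+x. \<integral>\<^sup>+y. F x y \<partial>cgauss \<partial>cgauss)"
proof -
  have F: "(\<lambda>x. F (f x) (g x)) \<in> borel_measurable N" if "f \<in> borel_measurable N" "g \<in> borel_measurable N"
    for f g N
    using measurable_compose[OF measurable_Pair[OF that] meas] by simp
  let ?d = std_complex_gaussian_density
  have d: "?d x * ?d y = ennreal (exp (- ((cmod x)\<^sup>2 + (cmod y)\<^sup>2)) / pi\<^sup>2)" for x y
    by (simp add: std_complex_gaussian_density_def power2_eq_square exp_add[symmetric]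
      flip: ennreal_mult)
  have "(cmod (a * x + b * y))\<^sup>2 + (cmod (- cnj b * x + cnj a * y))\<^sup>2
      = ((cmod a)\<^sup>2 + (cmod b)\<^sup>2) * ((cmod x)\<^sup>2 + (cmod y)\<^sup>2)" for x y
    by (simp only: cmod_power2) (simp add: power2_eq_square algebra_simps)
  then have inv: "?d (a * x + b * y) * ?d (- cnj b * x + cnj a * y) = ?d x * ?d y" for x y
    unfolding d 1 by simp
  have *: "(\<integral>\<^sup>+x. \<integral>\<^sup>+y. G x y \<partial>cgauss \<partial>cgauss) = (\<integral>\<^sup>+x. \<integral>\<^sup>+y. ?d x * ?d y * G x y \<partial>lborel \<partial>lborel)"
    if G[measurable]: "case_prod G \<in> borel_measurable (borel \<Otimes>\<^sub>M borel)" for G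
  proof -
    have [measurable]: "(\<lambda>x. \<integral>\<^sup>+y. G x y \<partial>cgauss) \<in> borel_measurable borel"
      by (rule cgauss.borel_measurable_nn_integral) simp
    have [measurable]: "G x \<in> borel_measurable borel" for x using G by simp
    show ?thesis
      by (auto simp: nn_integral_cgauss nn_integral_cmult[symmetric] mult.assoc intro!: nn_integral_cong)
  qed
  have "(\<integral>\<^sup>+x. \<integral>\<^sup>+y. F (a * x + b * y) (- cnj b * x + cnj a * y) \<partial>cgauss \<partial>cgauss)
      = (\<integral>\<^sup>+x. \<integral>\<^sup>+y. ?d (a * x + b * y) * ?d (- cnj b * x + cnj a * y)
        * F (a * x + b * y) (- cnj b * x + cnj a * y) \<partial>lborel \<partial>lborel)"
    unfolding inv by (rule *) (auto simp: split_beta' intro!: F)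
  also have "\<dots> = (\<integral>\<^sup>+x. \<integral>\<^sup>+y. ?d x * ?d y * F x y \<partial>lborel \<partial>lborel)"
  proof (rule nn_integral_shear[where n=2 and F="\<lambda>x y. ?d x * ?d y * F x y"])
    show "a * cnj a - b * - cnj b = 1"
    proof -
      have "a * cnj a + b * cnj b = 1"
        using 1 by (metis complex_norm_square of_real_1 of_real_add)
      then show ?thesis by simp
    qed
  qed (use a nn_integral_affine_complex in auto)
  also have "\<dots> = (\<integral>\<^sup>+x. \<integral>\<^sup>+y. F x y \<partial>cgauss \<partial>cgauss)"
    by (rule *[symmetric]) simp
  finally show ?thesis .
qed

text \<open>After division by its norm, \<open>(a, b)\<close> is the first row of a unitary matrix,
  so the combination is a multiple of one standard coordinate. If \<open>a = 0\<close> the roles of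
  the two variables are exchanged.\<close>

lemma nn_integral_cgauss_combine:
  fixes F :: "complex \<Rightarrow> ennreal" and a b :: complex
  assumes meas[measurable]: "F \<in> borel_measurable borel"
  shows "(\<integral>\<^sup>+x. \<integral>\<^sup>+y. F (a * x + b * y) \<partial>cgauss \<partial>cgauss)
      = (\<integral>\<^sup>+x. F (complex_of_real (sqrt ((cmod a)\<^sup>2 + (cmod b)\<^sup>2)) * x) \<partial>cgauss)"
proof -
  have *: "(\<integral>\<^sup>+x. \<integral>\<^sup>+y. F (a * x + b * y) \<partial>cgauss \<partial>cgauss)
      = (\<integral>\<^sup>+x. F (complex_of_real (sqrt ((cmod a)\<^sup>2 + (cmod b)\<^sup>2)) * x) \<partial>cgauss)"
    if a: "a \<noteq> 0" for a b
  proof -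
    define r where "r = sqrt ((cmod a)\<^sup>2 + (cmod b)\<^sup>2)"
    have r2: "r\<^sup>2 = (cmod a)\<^sup>2 + (cmod b)\<^sup>2" by (simp add: r_def)
    have r: "r > 0" unfolding r_def using a by (intro real_sqrt_gt_zero add_pos_nonneg) auto
    have "(\<integral>\<^sup>+x. \<integral>\<^sup>+y. F (a * x + b * y) \<partial>cgauss \<partial>cgauss)
        = (\<integral>\<^sup>+x. \<integral>\<^sup>+y. F (of_real r * (a / r * x + b / r * y)) \<partial>cgauss \<partial>cgauss)"
      using r by (simp add: distrib_left)
    also have "\<dots> = (\<integral>\<^sup>+x. \<integral>\<^sup>+y. F (of_real r * x) \<partial>cgauss \<partial>cgauss)"
      by (rule nn_integral_cgauss_unitary[where F="\<lambda>x y. F (of_real r * x)"])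
         (use a r r2 in \<open>auto simp: norm_divide power_divide simp flip: add_divide_distrib\<close>)
    finally show ?thesis by (simp add: r_def cgauss.emeasure_space_1[simplified])
  qed
  show ?thesis
  proof (cases "a = 0")
    case False
    then show ?thesis by (rule *)
  next
    case True
    show ?thesis
    proof (cases "b = 0")
      case True
      with \<open>a = 0\<close> show ?thesis by (simp add: cgauss.emeasure_space_1[simplified])
    next
      case False
      have "(\<integral>\<^sup>+x. \<integral>\<^sup>+y. F (a * x + b * y) \<partial>cgauss \<partial>cgauss)
          = (\<integral>\<^sup>+x. \<integral>\<^sup>+y. F (b * x + a * y) \<partial>cgauss \<partial>cgauss)"
        by (subst cgauss_pair.Fubini') (auto simp: add.commute)
      also have "\<dots> = (\<integral>\<^sup>+x. F (complex_of_real (sqrt ((cmod a)\<^sup>2 + (cmod b)\<^sup>2)) * x) \<partial>cgauss)"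
        by (subst *) (use False in \<open>auto simp: add.commute\<close>)
      finally show ?thesis .
    qed
  qed
qed

text \<open>A pair of Gaussians in triangular form stays so after adding multiples of an independent Gaussian \<open>t\<close>:
  rotate \<open>(x, t)\<close> until the first coordinate involves only one of the two variables.\<close>
lemma cgauss_pair_step:
  fixes F :: "complex \<times> complex \<Rightarrow> ennreal" and a c :: real and b u v :: complex
  assumes meas[measurable]: "F \<in> borel_measurable (borel \<Otimes>\<^sub>M borel)" and a: "a > 0" and c: "c \<ge> 0"
  defines "a' \<equiv> sqrt (a\<^sup>2 + (cmod u)\<^sup>2)"
  defines "b' \<equiv> (b * a + v * cnj u) / a'"
  defines "c' \<equiv> sqrt ((cmod ((v * a - b * u) / a'))\<^sup>2 + c\<^sup>2)"
  shows "(\<integral>\<^sup>+t. \<integral>\<^sup>+x. \<integral>\<^sup>+y. F (a * x + u * t, b * x + c * y + v * t) \<partial>cgauss \<partial>cgauss \<partial>cgauss)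
       = (\<integral>\<^sup>+x. \<integral>\<^sup>+y. F (a' * x, b' * x + c' * y) \<partial>cgauss \<partial>cgauss)"
proof -
  have F: "(\<lambda>x. F (f x, g x)) \<in> borel_measurable N" if "f \<in> borel_measurable N" "g \<in> borel_measurable N"
    for f g N
    using measurable_compose[OF measurable_Pair[OF that] meas] by simp
  have a'2: "a'\<^sup>2 = a\<^sup>2 + (cmod u)\<^sup>2" by (simp add: a'_def)
  have a': "a' > 0" unfolding a'_def using a by (intro real_sqrt_gt_zero add_pos_nonneg) auto
  define p where "p = a / a'"
  define q where "q = u / of_real a'"
  \<comment> \<open>\<open>d\<close> is the coefficient, in the second coordinate, of the rotated
    variable orthogonal to the first coordinate. Its contribution merges with that of
    \<open>y\<close> into the single coefficient \<open>c'\<close>.\<close>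
  define d where "d = (v * a - b * u) / a'"
  have p: "p \<noteq> 0" using a a' by (simp add: p_def)
  have pq: "(cmod (of_real p))\<^sup>2 + (cmod q)\<^sup>2 = 1"
    using a a' by (simp add: p_def q_def norm_divide power_divide a'2 add_nonneg_eq_0_iff
      flip: add_divide_distrib)
  have pq': "of_real p * of_real p + q * cnj q = 1"
    using pq by (metis complex_norm_square of_real_1 of_real_add complex_cnj_complex_of_real)
  have ap: "complex_of_real a = of_real a' * of_real p" and uq: "u = of_real a' * q"
    using a' by (simp_all add: p_def q_def)
  have b': "b' = b * p + v * cnj q" using a' by (simp add: b'_def p_def q_def field_simps)
  have d': "d = v * p - b * q" using a' by (simp add: d_def p_def q_def field_simps)
  have e1: "of_real a * x + u * t = of_real a' * (of_real p * x + q * t)" for x t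
    by (simp add: ap uq algebra_simps)
  have e2: "b * x + of_real c * y + v * t = b' * (of_real p * x + q * t)
      + (d * (- cnj q * x + cnj (of_real p) * t) + of_real c * y)" for x y t
  proof -
    have "b' * (of_real p * x + q * t) + d * (- cnj q * x + cnj (of_real p) * t)
        = (of_real p * of_real p + q * cnj q) * (b * x + v * t)"
      by (simp add: b' d' algebra_simps)
    then show ?thesis unfolding pq' by (simp add: algebra_simps)
  qed
  have "(\<integral>\<^sup>+t. \<integral>\<^sup>+x. \<integral>\<^sup>+y. F (a * x + u * t, b * x + c * y + v * t) \<partial>cgauss \<partial>cgauss \<partial>cgauss)
     = (\<integral>\<^sup>+x. \<integral>\<^sup>+t. \<integral>\<^sup>+y. F (a * x + u * t, b * x + c * y + v * t) \<partial>cgauss \<partial>cgauss \<partial>cgauss)"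
    by (rule cgauss_pair.Fubini') (auto simp: split_beta' intro!: F cgauss.borel_measurable_nn_integral)
  also have "\<dots> = (\<integral>\<^sup>+x. \<integral>\<^sup>+t. \<integral>\<^sup>+y. F (a' * x, b' * x + (d * t + of_real c * y)) \<partial>cgauss \<partial>cgauss \<partial>cgauss)"
    unfolding e1 e2
    by (rule nn_integral_cgauss_unitary
        [where F="\<lambda>x t. \<integral>\<^sup>+y. F (a' * x, b' * x + (d * t + of_real c * y)) \<partial>cgauss"])
       (use p pq in \<open>auto simp: split_beta' intro!: F cgauss.borel_measurable_nn_integral\<close>)
  also have "\<dots> = (\<integral>\<^sup>+x. \<integral>\<^sup>+y. F (a' * x, b' * x + c' * y) \<partial>cgauss \<partial>cgauss)"
  proof (rule nn_integral_cong)
    fix x :: complex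
    show "(\<integral>\<^sup>+t. \<integral>\<^sup>+y. F (a' * x, b' * x + (d * t + of_real c * y)) \<partial>cgauss \<partial>cgauss)
        = (\<integral>\<^sup>+y. F (a' * x, b' * x + c' * y) \<partial>cgauss)"
      by (subst nn_integral_cgauss_combine[where F="\<lambda>w. F (a' * x, b' * x + w)"])
         (auto intro!: F simp: c'_def d_def)
  qed
  finally show ?thesis .
qed

section \<open>Independent Gaussian coefficients\<close>

locale gef = prob_space M for M :: "'w measure" +
  fixes \<xi> :: "nat \<Rightarrow> 'w \<Rightarrow> complex" and \<alpha> :: real
  assumes indep: "indep_vars (\<lambda>_. borel) \<xi> UNIV"
    and gauss: "\<And>j. distributed M lborel (\<xi> j) std_complex_gaussian_density"
    and alpha: "\<alpha> > 0"
begin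

lemma measurable_xi[measurable]: "\<xi> j \<in> borel_measurable M"
  using indep by (auto simp: indep_vars_def)

lemma distr_xi: "distr M borel (\<xi> j) = cgauss"
  using distributed_distr_eq_density[OF gauss] by (simp add: cgauss_def cong: distr_cong)

lemma nn_integral_xi: "F \<in> borel_measurable borel \<Longrightarrow> (\<integral>\<^sup>+\<omega>. F (\<xi> j \<omega>) \<partial>M) = (\<integral>\<^sup>+x. F x \<partial>cgauss)"
  by (simp flip: distr_xi[of j] add: nn_integral_distr)

text \<open>Freezes a block \<open>A\<close> of coefficients, possibly infinite, and integrates one
  further coefficient separately. Partial sums use initial blocks; the simplicity of zeros uses all
  positive indices.\<close>

lemma nn_integral_indep_xi:
  assumes n: "n \<notin> A" and F[measurable]: "F \<in> borel_measurable (PiM A (\<lambda>_. borel) \<Otimes>\<^sub>M borel)"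
  shows "(\<integral>\<^sup>+\<omega>. F (\<lambda>i\<in>A. \<xi> i \<omega>, \<xi> n \<omega>) \<partial>M) = (\<integral>\<^sup>+\<omega>. \<integral>\<^sup>+t. F (\<lambda>i\<in>A. \<xi> i \<omega>, t) \<partial>cgauss \<partial>M)"
    "(\<integral>\<^sup>+\<omega>. F (\<lambda>i\<in>A. \<xi> i \<omega>, \<xi> n \<omega>) \<partial>M) = (\<integral>\<^sup>+t. \<integral>\<^sup>+\<omega>. F (\<lambda>i\<in>A. \<xi> i \<omega>, t) \<partial>M \<partial>cgauss)"
proof -
  let ?S = "PiM A (\<lambda>_. borel :: complex measure)" and ?T = "PiM {n} (\<lambda>_. borel :: complex measure)"
  let ?X = "\<lambda>\<omega>. \<lambda>i\<in>A. \<xi> i \<omega>" and ?Y = "\<lambda>\<omega>. \<lambda>i\<in>{n}. \<xi> i \<omega>"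
  have ind: "indep_var ?S ?X ?T ?Y"
    by (rule indep_var_restrict[OF indep]) (use n in auto)
  have X[measurable]: "?X \<in> measurable M ?S" and Y[measurable]: "?Y \<in> measurable M ?T"
    by measurable
  interpret X: prob_space "distr M ?S ?X" by (rule prob_space_distr) simp
  interpret Y: prob_space "distr M ?T ?Y" by (rule prob_space_distr) simp
  interpret XY: pair_prob_space "distr M ?S ?X" "distr M ?T ?Y" ..
  interpret XC: pair_prob_space "distr M ?S ?X" cgauss ..
  have F': "(\<lambda>p. F (fst p, snd p n)) \<in> borel_measurable (?S \<Otimes>\<^sub>M ?T)"
    by measurable
  have "(\<integral>\<^sup>+\<omega>. F (?X \<omega>, \<xi> n \<omega>) \<partial>M) = (\<integral>\<^sup>+p. F (fst p, snd p n) \<partial>distr M (?S \<Otimes>\<^sub>M ?T) (\<lambda>\<omega>. (?X \<omega>, ?Y \<omega>)))"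
    using F' by (subst nn_integral_distr) auto
  also have "\<dots> = (\<integral>\<^sup>+p. F (fst p, snd p n) \<partial>(distr M ?S ?X \<Otimes>\<^sub>M distr M ?T ?Y))"
    using ind by (simp add: indep_var_distribution_eq)
  also have "\<dots> = (\<integral>\<^sup>+s. \<integral>\<^sup>+t. F (s, t n) \<partial>distr M ?T ?Y \<partial>distr M ?S ?X)"
    using F' by (subst Y.nn_integral_fst[symmetric]) (auto cong: measurable_cong_sets)
  also have "\<dots> = (\<integral>\<^sup>+s. \<integral>\<^sup>+t. F (s, t) \<partial>cgauss \<partial>distr M ?S ?X)"
  proof (rule nn_integral_cong)
    fix s assume "s \<in> space (distr M ?S ?X)"
    then have s: "s \<in> space ?S" by simp
    have [measurable]: "(\<lambda>t. F (s, t)) \<in> borel_measurable borel"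
      using s by (rule measurable_Pair2[OF F])
    show "(\<integral>\<^sup>+t. F (s, t n) \<partial>distr M ?T ?Y) = (\<integral>\<^sup>+t. F (s, t) \<partial>cgauss)"
      by (subst nn_integral_distr) (auto simp: nn_integral_xi[where F="\<lambda>t. F (s, t)"])
  qed
  finally have *: "(\<integral>\<^sup>+\<omega>. F (?X \<omega>, \<xi> n \<omega>) \<partial>M) = (\<integral>\<^sup>+s. \<integral>\<^sup>+t. F (s, t) \<partial>cgauss \<partial>distr M ?S ?X)" .
  show "(\<integral>\<^sup>+\<omega>. F (?X \<omega>, \<xi> n \<omega>) \<partial>M) = (\<integral>\<^sup>+\<omega>. \<integral>\<^sup>+t. F (?X \<omega>, t) \<partial>cgauss \<partial>M)"
    unfolding * by (subst nn_integral_distr) (auto intro!: cgauss.borel_measurable_nn_integral)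
  show "(\<integral>\<^sup>+\<omega>. F (?X \<omega>, \<xi> n \<omega>) \<partial>M) = (\<integral>\<^sup>+t. \<integral>\<^sup>+\<omega>. F (?X \<omega>, t) \<partial>M \<partial>cgauss)"
    unfolding * by (subst XC.Fubini'[symmetric])
      (auto simp: nn_integral_distr split_beta' intro!: nn_integral_cong cong: measurable_cong_sets)
qed

text \<open>The numbers \<open>a\<close>, \<open>b\<close>, \<open>c\<close> form the Cholesky
  factor of the covariance matrix, updated one coefficient at a time by
  \<open>cgauss_pair_step\<close>. Since \<open>u 0 = 1\<close>, \<open>a\<close> is positive from
  the start, as that step requires.\<close>

lemma partial_sum_pair_law:
  fixes u v :: "nat \<Rightarrow> complex"
  assumes uv: "u 0 = 1" "v 0 = 1"
  shows "\<exists>a b c. a > 0 \<and> c \<ge> 0 \<and> a\<^sup>2 = (\<Sum>j\<le>N. (cmod (u j))\<^sup>2) \<and> a * b = (\<Sum>j\<le>N. v j * cnj (u j)) \<and>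
     (cmod b)\<^sup>2 + c\<^sup>2 = (\<Sum>j\<le>N. (cmod (v j))\<^sup>2) \<and>
     (\<forall>F\<in>borel_measurable (borel \<Otimes>\<^sub>M borel).
        (\<integral>\<^sup>+\<omega>. F (\<Sum>j\<le>N. u j * \<xi> j \<omega>, \<Sum>j\<le>N. v j * \<xi> j \<omega>) \<partial>M)
         = (\<integral>\<^sup>+x. \<integral>\<^sup>+y. F (of_real a * x, b * x + of_real c * y) \<partial>cgauss \<partial>cgauss))"
proof (induction N)
  case 0
  have "\<forall>F\<in>borel_measurable (borel \<Otimes>\<^sub>M borel). (\<integral>\<^sup>+\<omega>. F (\<xi> 0 \<omega>, \<xi> 0 \<omega>) \<partial>M)
      = (\<integral>\<^sup>+x. \<integral>\<^sup>+y. F (x, x) \<partial>cgauss \<partial>cgauss)"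
    by (auto simp: cgauss.emeasure_space_1[simplified] nn_integral_xi[where F="\<lambda>x. F (x, x)" for F])
  then show ?case
    by (intro exI[of _ 1] exI[of _ 0]) (simp add: uv)
next
  case (Suc N)
  then obtain a b c where abc: "a > 0" "c \<ge> 0" "a\<^sup>2 = (\<Sum>j\<le>N. (cmod (u j))\<^sup>2)"
    "a * b = (\<Sum>j\<le>N. v j * cnj (u j))"
     "(cmod b)\<^sup>2 + c\<^sup>2 = (\<Sum>j\<le>N. (cmod (v j))\<^sup>2)"
     and law: "\<And>F. F\<in>borel_measurable (borel \<Otimes>\<^sub>M borel) \<Longrightarrow>
        (\<integral>\<^sup>+\<omega>. F (\<Sum>j\<le>N. u j * \<xi> j \<omega>, \<Sum>j\<le>N. v j * \<xi> j \<omega>) \<partial>M)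
         = (\<integral>\<^sup>+x. \<integral>\<^sup>+y. F (of_real a * x, b * x + of_real c * y) \<partial>cgauss \<partial>cgauss)" by blast
  define u' v' where "u' = u (Suc N)" and "v' = v (Suc N)"
  define a' where "a' = sqrt (a\<^sup>2 + (cmod u')\<^sup>2)"
  define b' where "b' = (b * a + v' * cnj u') / a'"
  define c' where "c' = sqrt ((cmod ((v' * a - b * u') / a'))\<^sup>2 + c\<^sup>2)"
  have a'2: "a'\<^sup>2 = a\<^sup>2 + (cmod u')\<^sup>2" by (simp add: a'_def)
  have a': "a' > 0" unfolding a'_def using abc(1) by (intro real_sqrt_gt_zero add_pos_nonneg) auto
  \<comment> \<open>Lagrange's identity for the rows \<open>(a, u')\<close> and
    \<open>(b, v')\<close>: the variance of the second coordinate grows by exactly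
    \<open>(cmod v')\<^sup>2\<close>.\<close>
  have *: "a'\<^sup>2 * ((cmod b')\<^sup>2 + c'\<^sup>2) = a'\<^sup>2 * ((cmod b)\<^sup>2 + c\<^sup>2 + (cmod v')\<^sup>2)"
  proof -
    have "a'\<^sup>2 * ((cmod b')\<^sup>2 + c'\<^sup>2) = (cmod (b * a + v' * cnj u'))\<^sup>2 + (cmod (v' * a - b * u'))\<^sup>2
        + a'\<^sup>2 * c\<^sup>2"
      using a' by (simp add: b'_def c'_def norm_divide power_divide distrib_left)
    also have "(cmod (b * a + v' * cnj u'))\<^sup>2 + (cmod (v' * a - b * u'))\<^sup>2
        = (a\<^sup>2 + (cmod u')\<^sup>2) * ((cmod b)\<^sup>2 + (cmod v')\<^sup>2)"
      by (simp only: cmod_power2) (simp add: power2_eq_square algebra_simps)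
    finally show ?thesis by (simp add: a'2 algebra_simps)
  qed
  have "\<forall>F\<in>borel_measurable (borel \<Otimes>\<^sub>M borel).
        (\<integral>\<^sup>+\<omega>. F (\<Sum>j\<le>Suc N. u j * \<xi> j \<omega>, \<Sum>j\<le>Suc N. v j * \<xi> j \<omega>) \<partial>M)
         = (\<integral>\<^sup>+x. \<integral>\<^sup>+y. F (of_real a' * x, b' * x + of_real c' * y) \<partial>cgauss \<partial>cgauss)"
  proof
    fix F :: "complex \<times> complex \<Rightarrow> ennreal"
    assume F[measurable]: "F \<in> borel_measurable (borel \<Otimes>\<^sub>M borel)"
    define G where "G = (\<lambda>(p, t). F (fst p + u' * t, snd p + v' * t))"
    have G[measurable]: "G \<in> borel_measurable ((borel \<Otimes>\<^sub>M borel) \<Otimes>\<^sub>M borel)"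
      unfolding G_def by measurable
    have "(\<lambda>(f, t). G ((\<Sum>j\<le>N. u j * f j, \<Sum>j\<le>N. v j * f j), t))
        \<in> borel_measurable (PiM {..N} (\<lambda>_. borel) \<Otimes>\<^sub>M borel)"
      by measurable
    from nn_integral_indep_xi(2)[OF _ this, of "Suc N"]
    have "(\<integral>\<^sup>+\<omega>. F (\<Sum>j\<le>Suc N. u j * \<xi> j \<omega>, \<Sum>j\<le>Suc N. v j * \<xi> j \<omega>) \<partial>M)
        = (\<integral>\<^sup>+t. \<integral>\<^sup>+\<omega>. G ((\<Sum>j\<le>N. u j * \<xi> j \<omega>, \<Sum>j\<le>N. v j * \<xi> j \<omega>), t) \<partial>M \<partial>cgauss)"
      by (simp add: G_def u'_def v'_def)
    also have "\<dots> = (\<integral>\<^sup>+t. \<integral>\<^sup>+x. \<integral>\<^sup>+y. F (a * x + u' * t, b * x + c * y + v' * t) \<partial>cgauss \<partial>cgauss \<partial>cgauss)"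
    proof (rule nn_integral_cong)
      fix t
      have "(\<lambda>p. G (p, t)) \<in> borel_measurable (borel \<Otimes>\<^sub>M borel)" by measurable
      from law[OF this] show "(\<integral>\<^sup>+\<omega>. G ((\<Sum>j\<le>N. u j * \<xi> j \<omega>, \<Sum>j\<le>N. v j * \<xi> j \<omega>), t) \<partial>M)
        = (\<integral>\<^sup>+x. \<integral>\<^sup>+y. F (a * x + u' * t, b * x + c * y + v' * t) \<partial>cgauss \<partial>cgauss)"
        by (simp add: G_def)
    qed
    also have "\<dots> = (\<integral>\<^sup>+x. \<integral>\<^sup>+y. F (of_real a' * x, b' * x + of_real c' * y) \<partial>cgauss \<partial>cgauss)"
      unfolding a'_def b'_def c'_def by (rule cgauss_pair_step) (use abc in auto)
    finally show "(\<integral>\<^sup>+\<omega>. F (\<Sum>j\<le>Suc N. u j * \<xi> j \<omega>, \<Sum>j\<le>Suc N. v j * \<xi> j \<omega>) \<partial>M)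
         = (\<integral>\<^sup>+x. \<integral>\<^sup>+y. F (of_real a' * x, b' * x + of_real c' * y) \<partial>cgauss \<partial>cgauss)" .
  qed
  moreover have "(cmod b')\<^sup>2 + c'\<^sup>2 = (cmod b)\<^sup>2 + c\<^sup>2 + (cmod v')\<^sup>2"
    using * a' by simp
  moreover have "a' * b' = a * b + v' * cnj u'" using a' by (simp add: b'_def)
  moreover have "c' \<ge> 0" by (simp add: c'_def)
  ultimately show ?case using a' a'2 abc
    by (intro exI[of _ a'] exI[of _ b'] exI[of _ c']) (simp add: u'_def v'_def)
qed

end

section \<open>Moments of the Gaussian\<close>

text \<open>Dyadic decomposition: \<open>1 / cmod z\<close> is below \<open>2 ^ (n + 1)\<close>
  where \<open>(1/2) ^ (n + 1) < cmod z \<le> (1/2) ^ n\<close>. The disc of radius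
  \<open>(1/2) ^ n\<close> lies in a square of area \<open>4 * (1/4) ^ n\<close>, so the terms are
  \<open>8 * (1/2) ^ n\<close> and sum to \<open>16\<close>.\<close>

lemma nn_integral_inverse_norm_cball:
  "(\<integral>\<^sup>+z\<in>cball 0 1. ennreal (1 / cmod z) \<partial>lborel) \<le> 16"
proof -
  have ball: "emeasure lborel (cball (0::complex) r) \<le> ennreal (4 * r\<^sup>2)" if "r \<ge> 0" for r
  proof -
    have "cball (0::complex) r \<subseteq> cbox (Complex (-r) (-r)) (Complex r r)"
    proof
      fix z :: complex assume "z \<in> cball 0 r"
      then have "\<bar>Re z\<bar> \<le> r" "\<bar>Im z\<bar> \<le> r"
        using abs_Re_le_cmod[of z] abs_Im_le_cmod[of z] by auto
      then show "z \<in> cbox (Complex (-r) (-r)) (Complex r r)"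
        by (auto simp: in_cbox_complex_iff)
    qed
    then have "emeasure lborel (cball (0::complex) r)
        \<le> emeasure lborel (cbox (Complex (-r) (-r)) (Complex r r))"
      by (intro emeasure_mono) auto
    also have "\<dots> = ennreal (4 * r\<^sup>2)"
      using that by (subst emeasure_lborel_cbox) (auto simp: Basis_complex_def power2_eq_square)
    finally show ?thesis .
  qed
  have pt: "ennreal (1 / cmod z) * indicator (cball 0 1) z
      \<le> (\<Sum>n. ennreal (2 ^ Suc n) * indicator (cball 0 ((1/2)^n)) z)" for z
  proof (cases "z = 0 \<or> cmod z > 1")
    case False
    then have z: "0 < cmod z" "cmod z \<le> 1" by auto
    then obtain n0 where n0: "(1/2)^n0 < cmod z" using real_arch_pow_inv[of "cmod z" "1/2"] by auto
    define m where "m = (LEAST n. (1/2)^n < cmod z)"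
    have m: "(1/2)^m < cmod z" unfolding m_def by (rule LeastI, rule n0)
    have "m \<noteq> 0" using m z by (cases m) auto
    then obtain n where n: "m = Suc n" by (cases m) auto
    have "\<not> (1/2)^n < cmod z" using n not_less_Least[of n "\<lambda>n. (1/2)^n < cmod z"] by (simp add: m_def)
    then have "z \<in> cball 0 ((1/2)^n)" by simp
    have "1 / cmod z \<le> 2 ^ Suc n" using m z by (simp add: n field_simps)
    then have "ennreal (1 / cmod z) * indicator (cball 0 1) z
        \<le> ennreal (2 ^ Suc n) * indicator (cball 0 ((1/2)^n)) z"
      using \<open>z \<in> _\<close> z by (simp add: indicator_def ennreal_leI)
    also have "\<dots> \<le> (\<Sum>i. ennreal (2 ^ Suc i) * indicator (cball 0 ((1/2)^i)) z)"
      using sum_le_suminf[of "\<lambda>i. ennreal (2 ^ Suc i) * indicator (cball 0 ((1/2)^i)) z" "{n}"]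
      by (simp only: sum.insert finite.emptyI sum.empty empty_iff not_False_eq_True add_0_right
          summableI finite.insertI zero_le simp_thms True_implies_equals)
    finally show ?thesis .
  next
    case True
    then have "ennreal (1 / cmod z) * indicator (cball 0 1) z = 0" by auto
    then show ?thesis by (simp only: zero_le)
  qed
  have "(\<integral>\<^sup>+z\<in>cball 0 1. ennreal (1 / cmod z) \<partial>lborel)
      \<le> (\<integral>\<^sup>+z. (\<Sum>n. ennreal (2 ^ Suc n) * indicator (cball (0::complex) ((1/2)^n)) z) \<partial>lborel)"
    by (rule nn_integral_mono, rule pt)
  also have "\<dots> = (\<Sum>n. ennreal (2 ^ Suc n) * emeasure lborel (cball (0::complex) ((1/2)^n)))"
    by (subst nn_integral_suminf) (auto simp: nn_integral_cmult_indicator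
        intro!: borel_measurable_times_ennreal borel_measurable_indicator)
  also have "\<dots> \<le> (\<Sum>n. ennreal (8 * (1/2)^n))"
  proof (rule suminf_le)
    fix n
    have "ennreal (2 ^ Suc n) * emeasure lborel (cball (0::complex) ((1/2)^n))
        \<le> ennreal (2 ^ Suc n) * ennreal (4 * ((1/2)^n)\<^sup>2)"
      by (intro mult_left_mono ball) auto
    also have "\<dots> = ennreal (2 ^ Suc n * (4 * ((1/2)^n)\<^sup>2))"
      by (simp flip: ennreal_mult)
    also have "2 ^ Suc n * (4 * ((1/2)^n)\<^sup>2) = 8 * (1/2::real)^n"
      by (simp add: power_one_over power2_eq_square)
    finally show "ennreal (2 ^ Suc n) * emeasure lborel (cball (0::complex) ((1/2)^n))
        \<le> ennreal (8 * (1/2)^n)" .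
  qed auto
  also have "\<dots> = ennreal (\<Sum>n. 8 * (1/2)^n)"
    by (rule suminf_ennreal2) (auto intro!: summable_mult summable_geometric)
  also have "(\<Sum>n. 8 * (1/2::real)^n) = 16"
    by (subst suminf_mult) (auto simp: suminf_geometric)
  finally show ?thesis by simp
qed

lemma nn_integral_exp_half: "(\<integral>\<^sup>+z. ennreal (exp (- (cmod z)\<^sup>2 / 2) / pi) \<partial>lborel) = 2"
proof -
  have "(\<integral>\<^sup>+z. ennreal (exp (- (cmod z)\<^sup>2 / 2) / pi) \<partial>lborel)
     = ennreal ((cmod (of_real (sqrt 2)))\<^sup>2) *
       (\<integral>\<^sup>+z. ennreal (exp (- (cmod (0 + of_real (sqrt 2) * z))\<^sup>2 / 2) / pi) \<partial>lborel)"
    by (rule nn_integral_affine_complex) auto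
  also have "(\<integral>\<^sup>+z. ennreal (exp (- (cmod (0 + of_real (sqrt 2) * z))\<^sup>2 / 2) / pi) \<partial>lborel)
      = (\<integral>\<^sup>+z. 1 \<partial>cgauss)"
    by (subst nn_integral_cgauss) (auto simp: std_complex_gaussian_density_def norm_mult
      power_mult_distrib simp flip: power2_eq_square)
  also have "\<dots> = 1" by (simp add: cgauss.emeasure_space_1[simplified])
  finally show ?thesis by simp
qed

lemma std_complex_gaussian_density_le: "std_complex_gaussian_density z \<le> 1"
proof -
  have "exp (- (cmod z * cmod z)) / pi \<le> 1 / 1"
    using pi_gt3 by (intro frac_le) auto
  then show ?thesis unfolding std_complex_gaussian_density_def by (metis div_by_1 ennreal_1 ennreal_leI)
qed

text \<open>A common majorant for logarithms and powers: the fourth power serves at infinity, the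
  reciprocal at \<open>0\<close>. The value is \<open>8 * 2 + 1 + 16\<close>: the fourth power
  absorbed by half of the Gaussian exponent, the reciprocal outside the unit disc, and the
  reciprocal inside it.\<close>

lemma nn_integral_cgauss_moment:
  "(\<integral>\<^sup>+z. ennreal (cmod z ^ 4 + 1 / cmod z) \<partial>cgauss) \<le> 33"
proof -
  let ?d = std_complex_gaussian_density
  have pt: "?d z * ennreal (cmod z ^ 4 + 1 / cmod z) \<le> 8 * ennreal (exp (- (cmod z)\<^sup>2 / 2) / pi) + ?d z
      + ennreal (1 / cmod z) * indicator (cball 0 1) z" for z
  proof -
    have "1 + (cmod z)\<^sup>2 / 2 + ((cmod z)\<^sup>2 / 2)\<^sup>2 / 2 \<le> exp ((cmod z)\<^sup>2 / 2)"
      by (rule exp_lower_Taylor_quadratic) simp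
    moreover have "((cmod z)\<^sup>2 / 2)\<^sup>2 / 2 = cmod z ^ 4 / 8"
      by (simp add: power_divide power_mult[symmetric])
    ultimately have "cmod z ^ 4 \<le> 8 * exp ((cmod z)\<^sup>2 / 2)"
      using zero_le_power2[of "cmod z"] by linarith
    then have "exp (- (cmod z)\<^sup>2) * cmod z ^ 4 \<le> exp (- (cmod z)\<^sup>2) * (8 * exp ((cmod z)\<^sup>2 / 2))"
      by (intro mult_left_mono) auto
    also have "\<dots> = 8 * exp (- (cmod z)\<^sup>2 / 2)" by (simp flip: exp_add)
    finally have "exp (- (cmod z)\<^sup>2) / pi * cmod z ^ 4 \<le> 8 * (exp (- (cmod z)\<^sup>2 / 2) / pi)"
      by (simp add: field_simps)
    then have 1: "?d z * ennreal (cmod z ^ 4) \<le> 8 * ennreal (exp (- (cmod z)\<^sup>2 / 2) / pi)"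
      by (simp add: std_complex_gaussian_density_def power2_eq_square ennreal_leI
        flip: ennreal_mult ennreal_numeral)
    have 2: "?d z * ennreal (1 / cmod z) \<le> ?d z + ennreal (1 / cmod z) * indicator (cball 0 1) z"
    proof (cases "cmod z \<le> 1")
      case True
      then have "?d z * ennreal (1 / cmod z) \<le> 1 * ennreal (1 / cmod z)"
        by (intro mult_right_mono std_complex_gaussian_density_le) auto
      then show ?thesis using True by (simp add: add_increasing)
    next
      case False
      then have "1 / cmod z \<le> 1" by (simp add: divide_le_eq)
      from ennreal_leI[OF this] have "?d z * ennreal (1 / cmod z) \<le> ?d z * 1"
        by (intro mult_left_mono) auto
      then show ?thesis by (metis add_increasing2 mult.right_neutral zero_le)
    qed
    have "?d z * ennreal (cmod z ^ 4 + 1 / cmod z)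
        = ?d z * ennreal (cmod z ^ 4) + ?d z * ennreal (1 / cmod z)"
      by (simp add: distrib_left)
    also have "\<dots> \<le> 8 * ennreal (exp (- (cmod z)\<^sup>2 / 2) / pi)
        + (?d z + ennreal (1 / cmod z) * indicator (cball 0 1) z)"
      by (intro add_mono 1 2)
    finally show ?thesis by (simp add: add.assoc)
  qed
  have m: "(\<lambda>z. ennreal (1 / cmod z) * indicator (cball 0 1) z) \<in> borel_measurable borel"
    by (intro borel_measurable_times_ennreal borel_measurable_indicator) auto
  have "(\<integral>\<^sup>+z. ennreal (cmod z ^ 4 + 1 / cmod z) \<partial>cgauss)
      = (\<integral>\<^sup>+z. ?d z * ennreal (cmod z ^ 4 + 1 / cmod z) \<partial>lborel)"
    by (subst nn_integral_cgauss) auto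
  also have "\<dots> \<le> (\<integral>\<^sup>+z. 8 * ennreal (exp (- (cmod z)\<^sup>2 / 2) / pi) + ?d z + ennreal (1 / cmod z)
      * indicator (cball 0 1) z \<partial>lborel)"
    by (rule nn_integral_mono, rule pt)
  also have "\<dots> = 8 * (\<integral>\<^sup>+z. ennreal (exp (- (cmod z)\<^sup>2 / 2) / pi) \<partial>lborel) + (\<integral>\<^sup>+z. ?d z \<partial>lborel)
      + (\<integral>\<^sup>+z\<in>cball 0 1. ennreal (1 / cmod z) \<partial>lborel)"
    by (simp add: nn_integral_add nn_integral_cmult m)
  also have "(\<integral>\<^sup>+z. ?d z \<partial>lborel) = 1"
    using nn_integral_cgauss[of "\<lambda>_. 1"] by (simp add: cgauss.emeasure_space_1[simplified])
  also have "8 * (\<integral>\<^sup>+z. ennreal (exp (- (cmod z)\<^sup>2 / 2) / pi) \<partial>lborel) + 1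
      + (\<integral>\<^sup>+z\<in>cball 0 1. ennreal (1 / cmod z) \<partial>lborel) \<le> 8 * 2 + 1 + 16"
    unfolding nn_integral_exp_half by (intro add_mono nn_integral_inverse_norm_cball order_refl)
  finally show ?thesis by simp
qed

text \<open>From \<open>ln y \<le> 2 * sqrt y\<close>, applied to \<open>x\<close> if
  \<open>x \<ge> 1\<close> and to \<open>1 / x\<close> otherwise.\<close>

lemma ln_sq_le:
  fixes x :: real
  assumes "x \<ge> 0"
  shows "(ln x)\<^sup>2 \<le> 4 * (x + 1 / x)"
proof (cases "x = 0")
  case False
  with assms have x: "x > 0" by simp
  have le: "ln y \<le> 2 * sqrt y" if "y > 0" for y :: real
    using ln_le_minus_one[of "sqrt y"] that by (simp add: ln_sqrt)
  have "\<bar>ln x\<bar> \<le> 2 * sqrt x \<or> \<bar>ln x\<bar> \<le> 2 * sqrt (1 / x)"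
    using le[of x] le[of "1 / x"] x by (auto simp: ln_div abs_if)
  then have "\<bar>ln x\<bar>\<^sup>2 \<le> 4 * x \<or> \<bar>ln x\<bar>\<^sup>2 \<le> 4 * (1 / x)"
    using power_mono[of "\<bar>ln x\<bar>" "2 * sqrt x" 2] power_mono[of "\<bar>ln x\<bar>" "2 * sqrt (1 / x)" 2] x
    by (auto simp: power_mult_distrib)
  moreover have "0 < 1 / x" using x by simp
  ultimately have "\<bar>ln x\<bar>\<^sup>2 \<le> 4 * (x + 1 / x)" using x unfolding distrib_left by (elim disjE) linarith+
  then show ?thesis by simp
qed auto

lemma integrable_cgauss_bound:
  fixes g :: "complex \<Rightarrow> 'b::{banach, second_countable_topology}"
  assumes [measurable]: "g \<in> borel_measurable borel"
    and "\<And>z. norm (g z) \<le> C * (1 + cmod z ^ 4 + 1 / cmod z)"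
  shows "integrable cgauss g"
proof (rule Bochner_Integration.integrable_bound)
  have "integrable cgauss (\<lambda>z. cmod z ^ 4 + 1 / cmod z)"
    using le_less_trans[OF nn_integral_cgauss_moment, of \<infinity>]
    by (intro integrableI_bounded) (simp_all del: ennreal_plus)
  then show "integrable cgauss (\<lambda>z. C * (1 + (cmod z ^ 4 + 1 / cmod z)))"
    by auto
  show "AE z in cgauss. norm (g z) \<le> norm (C * (1 + (cmod z ^ 4 + 1 / cmod z)))"
    using assms(2) by (intro AE_I2) (metis abs_ge_self add.assoc order_trans real_norm_def)
qed simp

lemma le_one_plus_pow4: "(x::real) \<ge> 0 \<Longrightarrow> x \<le> 1 + x ^ 4"
  by (cases "x \<le> 1") (auto intro: add_increasing2 self_le_power order_trans[OF self_le_power[of x 4]])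

lemma integrable_cgauss_ln_sq: "integrable cgauss (\<lambda>z. (ln (cmod z))\<^sup>2)"
proof (rule integrable_cgauss_bound[where C=4])
  fix z :: complex
  show "norm ((ln (cmod z))\<^sup>2) \<le> 4 * (1 + cmod z ^ 4 + 1 / cmod z)"
    using ln_sq_le[of "cmod z"] le_one_plus_pow4[of "cmod z"] by simp
qed simp

lemma integrable_cgauss_ln: "integrable cgauss (\<lambda>z. ln (cmod z))"
  by (rule cgauss.square_integrable_imp_integrable) (auto intro: integrable_cgauss_ln_sq)

section \<open>Laws of almost sure limits\<close>

text \<open>Closed sets form a generator stable under intersections, and the indicator of a closed
  set is the pointwise limit of the continuous tents
  \<open>max 0 (1 - m * infdist x C)\<close>.\<close>

lemma prob_eqI_continuous:
  fixes \<mu> \<nu> :: "'b::metric_space measure"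
  assumes "prob_space \<mu>" "prob_space \<nu>" and s[measurable_cong]: "sets \<mu> = sets borel"
    "sets \<nu> = sets borel"
    and eq: "\<And>f :: 'b \<Rightarrow> real. continuous_on UNIV f \<Longrightarrow> (\<And>x. 0 \<le> f x \<and> f x \<le> 1)
        \<Longrightarrow> (\<integral>x. f x \<partial>\<mu>) = (\<integral>x. f x \<partial>\<nu>)"
  shows "\<mu> = \<nu>"
proof (rule measure_eqI_generator_eq)
  interpret \<mu>: prob_space \<mu> by fact
  interpret \<nu>: prob_space \<nu> by fact
  show "Int_stable (Collect closed :: 'b set set)" by (auto simp: Int_stable_def)
  show "sets \<mu> = sigma_sets UNIV (Collect closed)" "sets \<nu> = sigma_sets UNIV (Collect closed)"
    using s by (simp_all add: borel_eq_closed)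
  show "range (\<lambda>_::nat. UNIV :: 'b set) \<subseteq> Collect closed" "(\<Union>i::nat. UNIV) = (UNIV :: 'b set)" by auto
  show "emeasure \<mu> UNIV \<noteq> \<infinity>" using \<mu>.emeasure_finite by simp
  fix C :: "'b set" assume "C \<in> Collect closed"
  then have C: "closed C" by simp
  then have [measurable]: "C \<in> sets borel" by simp
  show "emeasure \<mu> C = emeasure \<nu> C"
  \<comment> \<open>By convention \<open>infdist x {}\<close> is \<open>0\<close>, so the tents do
    not approximate the indicator of the empty set.\<close>
  proof (cases "C = {}")
    case False
    define f where "f m x = max 0 (1 - real m * infdist x C)" for m x
    have f01: "0 \<le> f m x \<and> f m x \<le> 1" for m x by (auto simp: f_def infdist_nonneg)
    have cont: "continuous_on UNIV (f m)" for m unfolding f_def by (intro continuous_intros)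
    then have [measurable]: "f m \<in> borel_measurable borel" for m
      by (rule borel_measurable_continuous_onI)
    have lim: "(\<lambda>m. f m x) \<longlonglongrightarrow> indicator C x" for x
    proof (cases "x \<in> C")
      case True
      then show ?thesis by (simp add: f_def)
    next
      case False
      then have "infdist x C \<noteq> 0" using C \<open>C \<noteq> {}\<close> in_closed_iff_infdist_zero by blast
      then have p: "infdist x C > 0" using infdist_nonneg[of x C] by simp
      obtain m0 where m0: "1 / infdist x C < real m0" using reals_Archimedean2 by blast
      have "f m x = 0" if "m \<ge> m0" for m
      proof -
        have "1 < real m0 * infdist x C" using m0 p by (simp add: field_simps)
        also have "\<dots> \<le> real m * infdist x C" using that p by (intro mult_right_mono) auto
        finally show ?thesis by (simp add: f_def)
      qed
      then have "eventually (\<lambda>m. f m x = indicator C x) sequentially"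
        using False by (auto simp: eventually_sequentially)
      then show ?thesis by (rule tendsto_eventually)
    qed
    have l1: "(\<lambda>m. \<integral>x. f m x \<partial>\<mu>) \<longlonglongrightarrow> (\<integral>x. indicator C x \<partial>\<mu>)"
      by (rule integral_dominated_convergence[where w="\<lambda>_. 1"]) (use lim f01 in auto)
    have l2: "(\<lambda>m. \<integral>x. f m x \<partial>\<nu>) \<longlonglongrightarrow> (\<integral>x. indicator C x \<partial>\<nu>)"
      by (rule integral_dominated_convergence[where w="\<lambda>_. 1"]) (use lim f01 in auto)
    have "(\<integral>x. f m x \<partial>\<mu>) = (\<integral>x. f m x \<partial>\<nu>)" for m
      using eq[OF cont f01] .
    with l1 l2 have "measure \<mu> C = measure \<nu> C"
      using LIMSEQ_unique sets_eq_imp_space_eq[OF s(1)] sets_eq_imp_space_eq[OF s(2)] by fastforce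
    then show ?thesis by (simp add: \<mu>.emeasure_eq_measure \<nu>.emeasure_eq_measure)
  qed simp
qed auto

text \<open>The two sequences may live on different probability spaces. This transfers the law of
  the partial sums to the series, with an explicit Gaussian pair as the other side.\<close>

lemma distr_eq_limit:
  fixes X :: "nat \<Rightarrow> 'a \<Rightarrow> 'b::{metric_space,second_countable_topology}" and Y :: "nat \<Rightarrow> 'c \<Rightarrow> 'b"
  assumes P: "prob_space P" "prob_space Q"
    and [measurable]: "\<And>n. X n \<in> borel_measurable P" "\<And>n. Y n \<in> borel_measurable Q"
      "X' \<in> borel_measurable P" "Y' \<in> borel_measurable Q"
    and eq: "\<And>n. distr P borel (X n) = distr Q borel (Y n)"
    and lim: "AE x in P. (\<lambda>n. X n x) \<longlonglongrightarrow> X' x" "AE x in Q. (\<lambda>n. Y n x) \<longlonglongrightarrow> Y' x"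
  shows "distr P borel X' = distr Q borel Y'"
proof (rule prob_eqI_continuous)
  interpret P: prob_space P by fact
  interpret Q: prob_space Q by fact
  show "prob_space (distr P borel X')" by (rule P.prob_space_distr) simp
  show "prob_space (distr Q borel Y')" by (rule Q.prob_space_distr) simp
  fix f :: "'b \<Rightarrow> real" assume cont: "continuous_on UNIV f" and f01: "\<And>x. 0 \<le> f x \<and> f x \<le> 1"
  have [measurable]: "f \<in> borel_measurable borel" using cont by (rule borel_measurable_continuous_onI)
  have fc: "isCont f x" for x using cont by (simp add: continuous_on_eq_continuous_at)
  have "(\<lambda>n. \<integral>x. f (X n x) \<partial>P) \<longlonglongrightarrow> (\<integral>x. f (X' x) \<partial>P)"
    by (rule integral_dominated_convergence[where w="\<lambda>_. 1"])
       (use lim(1) f01 in \<open>auto elim!: eventually_mono intro: isCont_tendsto_compose[OF fc]\<close>)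
  moreover have "(\<lambda>n. \<integral>x. f (Y n x) \<partial>Q) \<longlonglongrightarrow> (\<integral>x. f (Y' x) \<partial>Q)"
    by (rule integral_dominated_convergence[where w="\<lambda>_. 1"])
       (use lim(2) f01 in \<open>auto elim!: eventually_mono intro: isCont_tendsto_compose[OF fc]\<close>)
  moreover have "(\<integral>x. f (X n x) \<partial>P) = (\<integral>x. f (Y n x) \<partial>Q)" for n
    using arg_cong[OF eq, of "\<lambda>N. \<integral>x. f x \<partial>N" n] by (simp add: integral_distr)
  ultimately show "(\<integral>x. f x \<partial>distr P borel X') = (\<integral>x. f x \<partial>distr Q borel Y')"
    by (simp add: integral_distr LIMSEQ_unique)
qed auto

section \<open>The Gaussian entire function\<close>

lemma summable_power_over_fact_powr:
  fixes \<beta> r :: real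
  assumes "\<beta> > 0"
  shows "summable (\<lambda>j. r ^ j / fact j powr \<beta>)"
proof (rule summable_ratio_test)
  \<comment> \<open>From \<open>N\<close> on, \<open>real (Suc n) powr \<beta>\<close> is at least
    \<open>2 * \<bar>r\<bar>\<close>, so the ratio of consecutive terms is at most
    \<open>1 / 2\<close>.\<close>
  define N where "N = nat \<lceil>(2 * \<bar>r\<bar>) powr (1 / \<beta>)\<rceil>"
  show "1 / 2 < (1::real)" by simp
  fix n assume "n \<ge> N"
  then have "(2 * \<bar>r\<bar>) powr (1 / \<beta>) \<le> real (Suc n)" unfolding N_def by linarith
  then have "((2 * \<bar>r\<bar>) powr (1 / \<beta>)) powr \<beta> \<le> real (Suc n) powr \<beta>"
    using assms by (intro powr_mono2) auto
  then have le: "2 * \<bar>r\<bar> \<le> real (Suc n) powr \<beta>"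
    using assms by (simp add: powr_powr split: if_splits)
  have p: "real (Suc n) powr \<beta> > 0" by simp
  have "norm (r ^ Suc n / fact (Suc n) powr \<beta>)
      = (\<bar>r\<bar> / real (Suc n) powr \<beta>) * norm (r ^ n / fact n powr \<beta>)"
    by (simp add: powr_mult norm_mult norm_divide power_abs abs_mult del: of_nat_Suc)
  also have "\<dots> \<le> 1 / 2 * norm (r ^ n / fact n powr \<beta>)"
    using le p by (intro mult_right_mono) (auto simp: field_simps)
  finally show "norm (r ^ Suc n / fact (Suc n) powr \<beta>) \<le> 1 / 2 * norm (r ^ n / fact n powr \<beta>)" .
qed

definition gef_coeff :: "real \<Rightarrow> nat \<Rightarrow> real" where
  "gef_coeff \<alpha> j = 1 / fact j powr (\<alpha> / 2)"

lemma gef_coeff_pos: "gef_coeff \<alpha> j > 0"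
  by (simp add: gef_coeff_def)

lemma gef_coeff_0 [simp]: "gef_coeff \<alpha> 0 = 1"
  by (simp add: gef_coeff_def)

lemma gef_coeff_sq: "(gef_coeff \<alpha> j)\<^sup>2 = 1 / fact j powr \<alpha>"
proof -
  have "fact j powr (\<alpha> / 2) * fact j powr (\<alpha> / 2) = (fact j :: real) powr \<alpha>"
    by (simp flip: powr_add)
  then show ?thesis by (simp add: gef_coeff_def power2_eq_square)
qed

lemma GEF_eq: "GEF \<alpha> \<xi> \<omega> z = (\<Sum>j. (of_real (gef_coeff \<alpha> j) * z ^ j) * \<xi> j \<omega>)"
  by (simp add: GEF_def gef_coeff_def field_simps)

context gef
begin

text \<open>The exceptional event must not depend on the radius. First moments handle each integer
  radius, and these dominate all others, so a countable union of null events suffices.\<close>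

lemma AE_summable_norm:
  "AE \<omega> in M. \<forall>R. summable (\<lambda>j. gef_coeff \<alpha> j * R ^ j * cmod (\<xi> j \<omega>))"
proof -
  have 1: "AE \<omega> in M. summable (\<lambda>j. gef_coeff \<alpha> j * real m ^ j * cmod (\<xi> j \<omega>))" for m :: nat
  proof -
    define C where "C = (\<integral>\<^sup>+z. ennreal (cmod z) \<partial>cgauss)"
    have "C \<le> (\<integral>\<^sup>+z. 1 + ennreal (cmod z ^ 4 + 1 / cmod z) \<partial>cgauss)"
      unfolding C_def
    proof (intro nn_integral_mono)
      fix z :: complex
      have "cmod z \<le> 1 + (cmod z ^ 4 + 1 / cmod z)"
        using le_one_plus_pow4[of "cmod z"] zero_le_divide_1_iff[of "cmod z"] norm_ge_zero[of z]
        by linarith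
      then have "ennreal (cmod z) \<le> ennreal (1 + (cmod z ^ 4 + 1 / cmod z))" by (rule ennreal_leI)
      then show "ennreal (cmod z) \<le> 1 + ennreal (cmod z ^ 4 + 1 / cmod z)"
        by simp
    qed
    also have "\<dots> = 1 + (\<integral>\<^sup>+z. ennreal (cmod z ^ 4 + 1 / cmod z) \<partial>cgauss)"
      by (subst nn_integral_add) (auto simp: cgauss.emeasure_space_1[simplified] simp del: ennreal_plus)
    also have "\<dots> \<le> 1 + 33"
      by (rule add_left_mono, rule nn_integral_cgauss_moment)
    finally have "C \<le> 34" by simp
    then have C: "C < \<infinity>" by (rule le_less_trans) simp
    have sm: "summable (\<lambda>j. gef_coeff \<alpha> j * real m ^ j)"
      using summable_power_over_fact_powr[of "\<alpha> / 2" "real m"] alpha by (simp add: gef_coeff_def)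
    have nn: "gef_coeff \<alpha> j * real m ^ j \<ge> 0" for j using gef_coeff_pos[of \<alpha> j] by simp
    have "(\<integral>\<^sup>+\<omega>. (\<Sum>j. ennreal (gef_coeff \<alpha> j * real m ^ j * cmod (\<xi> j \<omega>))) \<partial>M)
        = (\<Sum>j. \<integral>\<^sup>+\<omega>. ennreal (gef_coeff \<alpha> j * real m ^ j) * ennreal (cmod (\<xi> j \<omega>)) \<partial>M)"
      using nn by (subst nn_integral_suminf) (auto simp: ennreal_mult)
    also have "\<dots> = (\<Sum>j. ennreal (gef_coeff \<alpha> j * real m ^ j) * C)"
      by (simp add: nn_integral_cmult C_def nn_integral_xi[where F="\<lambda>x. ennreal (cmod x)"])
    also have "\<dots> = (\<Sum>j. ennreal (gef_coeff \<alpha> j * real m ^ j)) * C"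
      by (rule ennreal_suminf_multc)
    also have "\<dots> < \<infinity>"
      using C by (subst suminf_ennreal2[OF nn sm]) (auto simp: ennreal_mult_less_top)
    finally have "AE \<omega> in M. (\<Sum>j. ennreal (gef_coeff \<alpha> j * real m ^ j * cmod (\<xi> j \<omega>))) \<noteq> \<infinity>"
      by (intro nn_integral_PInf_AE) auto
    then show ?thesis
      by eventually_elim (rule summable_suminf_not_top, use nn in auto)
  qed
  then have "AE \<omega> in M. \<forall>m::nat. summable (\<lambda>j. gef_coeff \<alpha> j * real m ^ j * cmod (\<xi> j \<omega>))"
    by (simp add: AE_all_countable)
  then show ?thesis
  proof eventually_elim
    case (elim \<omega>)
    show ?case
    proof
      fix R :: real
      obtain m :: nat where m: "\<bar>R\<bar> \<le> real m" using real_arch_simple by blast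
      show "summable (\<lambda>j. gef_coeff \<alpha> j * R ^ j * cmod (\<xi> j \<omega>))"
      proof (rule summable_comparison_test'[OF elim[rule_format, of m], where N=0])
        fix j :: nat
        show "norm (gef_coeff \<alpha> j * R ^ j * cmod (\<xi> j \<omega>)) \<le> gef_coeff \<alpha> j * real m ^ j * cmod (\<xi> j \<omega>)"
          using m gef_coeff_pos[of \<alpha> j]
          by (auto simp: abs_mult power_abs intro!: mult_right_mono mult_left_mono power_mono)
      qed
    qed
  qed
qed

text \<open>The limit of \<open>partial_sum_pair_law\<close>: the triangular coefficients are
  continuous functions of the covariance sums and hence converge, so both sides converge almost
  surely.\<close>

lemma series_pair_law:
  fixes u v :: "nat \<Rightarrow> complex"
  assumes uv: "u 0 = 1" "v 0 = 1"
    and sm: "summable (\<lambda>j. (cmod (u j))\<^sup>2)" "summable (\<lambda>j. (cmod (v j))\<^sup>2)"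
      "summable (\<lambda>j. v j * cnj (u j))"
    and sums: "AE \<omega> in M. (\<lambda>j. u j * \<xi> j \<omega>) sums U \<omega>" "AE \<omega> in M. (\<lambda>j. v j * \<xi> j \<omega>) sums V \<omega>"
    and [measurable]: "U \<in> borel_measurable M" "V \<in> borel_measurable M"
  shows "\<exists>a b c. a > 0 \<and> c \<ge> 0 \<and> a\<^sup>2 = (\<Sum>j. (cmod (u j))\<^sup>2) \<and> a * b = (\<Sum>j. v j * cnj (u j)) \<and>
     (cmod b)\<^sup>2 + c\<^sup>2 = (\<Sum>j. (cmod (v j))\<^sup>2) \<and>
     distr M (borel \<Otimes>\<^sub>M borel) (\<lambda>\<omega>. (U \<omega>, V \<omega>))
       = distr (cgauss \<Otimes>\<^sub>M cgauss) (borel \<Otimes>\<^sub>M borel) (\<lambda>(x, y). (of_real a * x, b * x + of_real c * y))"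
proof -
  let ?G = "\<lambda>a b c p. (of_real a * fst p, b * fst p + of_real c * snd p)"
  let ?S = "\<lambda>N \<omega>. (\<Sum>j\<le>N. u j * \<xi> j \<omega>, \<Sum>j\<le>N. v j * \<xi> j \<omega>)"
  define P where "P N a b c \<longleftrightarrow> a > 0 \<and> c \<ge> 0 \<and> a\<^sup>2 = (\<Sum>j\<le>N. (cmod (u j))\<^sup>2)
      \<and> of_real a * b = (\<Sum>j\<le>N. v j * cnj (u j)) \<and>
     (cmod b)\<^sup>2 + c\<^sup>2 = (\<Sum>j\<le>N. (cmod (v j))\<^sup>2) \<and>
     (\<forall>F\<in>borel_measurable (borel \<Otimes>\<^sub>M borel).
        (\<integral>\<^sup>+\<omega>. F (?S N \<omega>) \<partial>M)
         = (\<integral>\<^sup>+x. \<integral>\<^sup>+y. F (of_real a * x, b * x + of_real c * y) \<partial>cgauss \<partial>cgauss))" for N a b c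
  have "\<forall>N. \<exists>a b c. P N a b c"
    unfolding P_def using partial_sum_pair_law[of u v, OF uv] by blast
  then obtain A B C where "\<And>N. P N (A N) (B N) (C N)" by metis
  then have AC: "\<And>N. A N > 0" "\<And>N. C N \<ge> 0" "\<And>N. (A N)\<^sup>2 = (\<Sum>j\<le>N. (cmod (u j))\<^sup>2)"
    "\<And>N. A N * B N = (\<Sum>j\<le>N. v j * cnj (u j))"
     "\<And>N. (cmod (B N))\<^sup>2 + (C N)\<^sup>2 = (\<Sum>j\<le>N. (cmod (v j))\<^sup>2)"
     and law: "\<And>N F. F\<in>borel_measurable (borel \<Otimes>\<^sub>M borel) \<Longrightarrow>
        (\<integral>\<^sup>+\<omega>. F (?S N \<omega>) \<partial>M)
         = (\<integral>\<^sup>+x. \<integral>\<^sup>+y. F (of_real (A N) * x, B N * x + of_real (C N) * y) \<partial>cgauss \<partial>cgauss)"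
    unfolding P_def by blast+
  define a where "a = sqrt (\<Sum>j. (cmod (u j))\<^sup>2)"
  define b where "b = (\<Sum>j. v j * cnj (u j)) / of_real a"
  define c where "c = sqrt ((\<Sum>j. (cmod (v j))\<^sup>2) - (cmod b)\<^sup>2)"
  have L: "(\<lambda>N. \<Sum>j\<le>N. f j) \<longlonglongrightarrow> (\<Sum>j. f j)" if "summable f" for f :: "nat \<Rightarrow> 'b::real_normed_vector"
    using summable_LIMSEQ'[OF that] .
  have u1: "(\<Sum>j. (cmod (u j))\<^sup>2) \<ge> 1"
    using sum_le_suminf[OF sm(1), of "{0}"] uv by simp
  then have a: "a > 0" "a\<^sup>2 = (\<Sum>j. (cmod (u j))\<^sup>2)" by (simp_all add: a_def)
  have A: "A N = sqrt (\<Sum>j\<le>N. (cmod (u j))\<^sup>2)" for N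
    using AC(1,3)[of N] by (metis less_imp_le real_sqrt_unique)
  have Alim: "A \<longlonglongrightarrow> a" unfolding A a_def by (intro tendsto_intros L sm)
  have B: "B N = (\<Sum>j\<le>N. v j * cnj (u j)) / of_real (A N)" for N
    using AC(4)[of N] AC(1)[of N] by (simp add: field_simps)
  have Blim: "B \<longlonglongrightarrow> b" unfolding B b_def by (intro tendsto_intros L sm Alim) (use a in auto)
  have C: "C N = sqrt ((\<Sum>j\<le>N. (cmod (v j))\<^sup>2) - (cmod (B N))\<^sup>2)" for N
    using AC(2,5)[of N] by (metis add_diff_cancel_left' real_sqrt_unique)
  have Clim: "C \<longlonglongrightarrow> c" unfolding C c_def by (intro tendsto_intros L sm Blim)
  have c0: "c \<ge> 0" by (rule LIMSEQ_le_const[OF Clim]) (use AC(2) in auto)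
  have "(\<lambda>N. (cmod (B N))\<^sup>2 + (C N)\<^sup>2) \<longlonglongrightarrow> (cmod b)\<^sup>2 + c\<^sup>2"
    by (intro tendsto_intros Blim Clim)
  moreover have "(\<lambda>N. (cmod (B N))\<^sup>2 + (C N)\<^sup>2) \<longlonglongrightarrow> (\<Sum>j. (cmod (v j))\<^sup>2)"
    unfolding AC(5) by (rule L[OF sm(2)])
  ultimately have c: "(cmod b)\<^sup>2 + c\<^sup>2 = (\<Sum>j. (cmod (v j))\<^sup>2)" by (rule LIMSEQ_unique)
  have "distr M borel (\<lambda>\<omega>. (U \<omega>, V \<omega>)) = distr (cgauss \<Otimes>\<^sub>M cgauss) borel (?G a b c)"
  proof (rule distr_eq_limit)
    show "prob_space M" by unfold_locales
    show "prob_space (cgauss \<Otimes>\<^sub>M cgauss)" by (rule cgauss_pair.prob_space_axioms)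
    show "(?S N) \<in> borel_measurable M" for N
      unfolding borel_prod[symmetric] by measurable
    show "(?G (A N) (B N) (C N)) \<in> borel_measurable (cgauss \<Otimes>\<^sub>M cgauss)" for N
      unfolding borel_prod[symmetric] by measurable
    show "(\<lambda>\<omega>. (U \<omega>, V \<omega>)) \<in> borel_measurable M" unfolding borel_prod[symmetric] by measurable
    show "(?G a b c) \<in> borel_measurable (cgauss \<Otimes>\<^sub>M cgauss)"
      unfolding borel_prod[symmetric] by measurable
    show "AE \<omega> in M. (\<lambda>N. ?S N \<omega>) \<longlonglongrightarrow> (U \<omega>, V \<omega>)"
      using sums by eventually_elim (auto intro!: tendsto_Pair simp: sums_def_le)
    show "AE p in cgauss \<Otimes>\<^sub>M cgauss. (\<lambda>N. ?G (A N) (B N) (C N) p) \<longlonglongrightarrow> ?G a b c p"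
      by (intro AE_I2 tendsto_intros Alim Blim Clim)
    fix N
    show "distr M borel (?S N)
       = distr (cgauss \<Otimes>\<^sub>M cgauss) borel (?G (A N) (B N) (C N))"
      (is "?L = ?R")
    proof (rule measure_eqI)
      fix S :: "(complex \<times> complex) set" assume S0: "S \<in> sets ?L"
      then have S[measurable]: "S \<in> sets (borel \<Otimes>\<^sub>M borel)" unfolding borel_prod by simp
      have S1: "S \<in> sets ?R" using S0 by simp
      have "emeasure ?L S = (\<integral>\<^sup>+p. indicator S p \<partial>?L)" by (rule nn_integral_indicator[OF S0, symmetric])
      also have "\<dots> = (\<integral>\<^sup>+\<omega>. indicator S (?S N \<omega>) \<partial>M)"
        unfolding borel_prod[symmetric] by (subst nn_integral_distr) auto
      also have "\<dots>
          = (\<integral>\<^sup>+x. \<integral>\<^sup>+y. indicator S (of_real (A N) * x, B N * x + of_real (C N) * y) \<partial>cgauss \<partial>cgauss)"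
        by (rule law) measurable
      also have "\<dots> = (\<integral>\<^sup>+p. indicator S (?G (A N) (B N) (C N) p) \<partial>(cgauss \<Otimes>\<^sub>M cgauss))"
        by (subst cgauss.nn_integral_fst[symmetric]) auto
      also have "\<dots> = (\<integral>\<^sup>+p. indicator S p \<partial>?R)"
        unfolding borel_prod[symmetric] by (subst nn_integral_distr) auto
      also have "\<dots> = emeasure ?R S" by (rule nn_integral_indicator[OF S1])
      finally show "emeasure ?L S = emeasure ?R S" .
    qed simp
  qed
  then have "distr M (borel \<Otimes>\<^sub>M borel) (\<lambda>\<omega>. (U \<omega>, V \<omega>))
      = distr (cgauss \<Otimes>\<^sub>M cgauss) (borel \<Otimes>\<^sub>M borel) (\<lambda>(x, y). (of_real a * x, b * x + of_real c * y))"
    by (simp add: borel_prod split_beta')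
  moreover have "a * b = (\<Sum>j. v j * cnj (u j))" using a by (simp add: b_def)
  ultimately show ?thesis using a c c0 by blast
qed

end

section \<open>Fourier coefficients on circles\<close>

definition circle_measure :: "real measure" where
  "circle_measure = density lborel (\<lambda>t. ennreal (indicator {0..2 * pi} t / (2 * pi)))"

lemma sets_circle_measure[simp, measurable_cong]: "sets circle_measure = sets borel"
  by (simp add: circle_measure_def)

lemma space_circle_measure[simp]: "space circle_measure = UNIV"
  by (simp add: circle_measure_def)

lemma prob_space_circle_measure: "prob_space circle_measure"
proof
  have "emeasure circle_measure (space circle_measure)
      = (\<integral>\<^sup>+t. ennreal (1 / (2 * pi)) * indicator {0..2 * pi} t \<partial>lborel)"
    by (simp add: circle_measure_def emeasure_density)
      (auto intro!: nn_integral_cong simp: indicator_def)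
  also have "\<dots> = ennreal (1 / (2 * pi)) * ennreal (2 * pi)"
    by (subst nn_integral_cmult_indicator) auto
  also have "\<dots> = 1" by (simp flip: ennreal_mult)
  finally show "emeasure circle_measure (space circle_measure) = 1" .
qed

interpretation circle_measure: prob_space circle_measure
  by (rule prob_space_circle_measure)

lemma has_bochner_integral_circle_measure:
  fixes G :: "real \<Rightarrow> 'b::euclidean_space"
  assumes cont: "continuous_on UNIV G" and int: "(G has_integral I) {0..2 * pi}"
  shows "has_bochner_integral circle_measure G (I /\<^sub>R (2 * pi))"
proof -
  have [measurable]: "G \<in> borel_measurable borel" using cont by (rule borel_measurable_continuous_onI)
  have si: "set_integrable lborel {0..2 * pi} G"
    using borel_integrable_compact[of "{0..2*pi}" G] continuous_on_subset[OF cont, of "{0..2*pi}"]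
    by (simp add: set_integrable_def)
  have "(LINT t:{0..2 * pi}|lborel. G t) = I"
    using set_borel_integral_eq_integral(2)[OF si] int by (simp add: integral_unique)
  with si have *: "has_bochner_integral lborel (\<lambda>t. indicator {0..2*pi} t *\<^sub>R G t) I"
    by (simp add: has_bochner_integral_iff set_integrable_def set_lebesgue_integral_def)
  show ?thesis unfolding circle_measure_def
  proof (rule has_bochner_integral_density)
    have "(indicator {0..2 * pi} t / (2 * pi)) *\<^sub>R G t
        = inverse (2 * pi) *\<^sub>R (indicator {0..2 * pi} t *\<^sub>R G t)" for t
      by (simp only: scaleR_scaleR divide_inverse mult.commute)
    then show "has_bochner_integral lborel (\<lambda>t. (indicator {0..2 * pi} t / (2 * pi)) *\<^sub>R G t)
        (I /\<^sub>R (2 * pi))"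
      using has_bochner_integral_scaleR_right[OF *, of "inverse (2 * pi)"] by (simp only:)
  qed auto
qed

lemma has_integral_circle_higher_deriv:
  fixes h :: "complex \<Rightarrow> complex" and r :: real
  assumes h: "h holomorphic_on ball 0 R" and r: "0 < r" "r < R"
  shows "((\<lambda>t. h (r * cis t) * cis (- real k * t))
      has_integral (2 * pi * r ^ k / fact k * (deriv ^^ k) h 0)) {0..2 * pi}"
proof -
  have "((\<lambda>u. h u / (u - 0) ^ Suc k) has_contour_integral (2 * pi * \<i> / fact k * (deriv ^^ k) h 0))
      (circlepath 0 r)"
    by (rule Cauchy_has_contour_integral_higher_derivative_circlepath)
       (use h r in \<open>auto intro!: holomorphic_on_imp_continuous_on elim: holomorphic_on_subset\<close>)
  then have "((\<lambda>t. h (0 + r * cis t) / (0 + r * cis t - 0) ^ Suc k * r * \<i> * cis t)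
      has_integral (2 * pi * \<i> / fact k * (deriv ^^ k) h 0)) {0..2 * pi}"
    unfolding circlepath_def by (subst (asm) has_contour_integral_part_circlepath_iff) auto
  from has_integral_mult_right[OF this, of "r ^ k / \<i>"]
  have "((\<lambda>t. r ^ k / \<i> * (h (0 + r * cis t) / (0 + r * cis t - 0) ^ Suc k * r * \<i> * cis t))
      has_integral (r ^ k / \<i> * (2 * pi * \<i> / fact k * (deriv ^^ k) h 0))) {0..2 * pi}" .
  moreover have "r ^ k / \<i> * (h (0 + r * cis t) / (0 + r * cis t - 0) ^ Suc k * r * \<i> * cis t)
      = h (r * cis t) * cis (- real k * t)" for t
  proof -
    have "cis (- real k * t) = inverse (cis t ^ k)"
      by (simp only: Complex.DeMoivre cis_inverse mult_minus_left)
    moreover have "cis t \<noteq> 0" "cis t ^ k \<noteq> 0" by auto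
    ultimately show ?thesis using r by (simp add: field_simps power_mult_distrib)
  qed
  ultimately show ?thesis by (simp add: field_simps)
qed

text \<open>Up to a constant this is the contour integral of \<open>h u * u ^ (k - 1)\<close>, which
  is holomorphic because \<open>k > 0\<close>.\<close>

lemma has_integral_circle_positive:
  fixes h :: "complex \<Rightarrow> complex" and r :: real
  assumes h: "h holomorphic_on ball 0 R" and r: "0 < r" "r < R" and k: "k > 0"
  shows "((\<lambda>t. h (r * cis t) * cis (real k * t)) has_integral 0) {0..2 * pi}"
proof -
  have "((\<lambda>u. h u * u ^ (k - 1)) has_contour_integral 0) (circlepath 0 r)"
    by (rule Cauchy_theorem_disc_simple[where a=0 and e=R])
      (use h r in \<open>auto intro!: holomorphic_intros\<close>)
  then have "((\<lambda>t. h (0 + r * cis t) * (0 + r * cis t) ^ (k - 1) * r * \<i> * cis t)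
      has_integral 0) {0..2 * pi}"
    unfolding circlepath_def by (subst (asm) has_contour_integral_part_circlepath_iff) auto
  from has_integral_mult_right[OF this, of "1 / (\<i> * r ^ k)"]
  have "((\<lambda>t. 1 / (\<i> * r ^ k) * (h (0 + r * cis t) * (0 + r * cis t) ^ (k - 1) * r * \<i> * cis t))
      has_integral 0) {0..2 * pi}" by simp
  moreover have "1 / (\<i> * r ^ k) * (h (0 + r * cis t) * (0 + r * cis t) ^ (k - 1) * r * \<i> * cis t)
      = h (r * cis t) * cis (real k * t)" for t
  proof -
    have "(r * cis t) ^ (k - 1) * (r * cis t) = r ^ k * cis t ^ k"
      using power_minus_mult[OF k, of "r * cis t"] by (simp add: power_mult_distrib)
    then have "(r * cis t) ^ (k - 1) * r * cis t = r ^ k * cis (real k * t)"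
      by (simp add: Complex.DeMoivre mult.assoc)
    then show ?thesis using r by (simp add: field_simps)
  qed
  ultimately show ?thesis by simp
qed

text \<open>The sign in \<open>cis (real k * t)\<close> is chosen so that a zero \<open>a\<close> contributes a multiple of \<open>a ^ k\<close> rather than
  of its conjugate.\<close>
definition circle_coeff :: "nat \<Rightarrow> (complex \<Rightarrow> real) \<Rightarrow> real \<Rightarrow> complex \<Rightarrow> bool" where
  "circle_coeff k u r c \<longleftrightarrow>
     has_bochner_integral circle_measure (\<lambda>t. of_real (u (of_real r * cis t)) * cis (real k * t)) c"

lemma circle_coeff_add: "circle_coeff k u r c \<Longrightarrow> circle_coeff k v r d
    \<Longrightarrow> circle_coeff k (\<lambda>z. u z + v z) r (c + d)"
  unfolding circle_coeff_def by (drule (1) has_bochner_integral_add) (simp add: distrib_right)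

lemma circle_coeff_sum:
  "(\<And>a. a \<in> A \<Longrightarrow> circle_coeff k (u a) r (c a)) \<Longrightarrow> circle_coeff k (\<lambda>z. \<Sum>a\<in>A. u a z) r (\<Sum>a\<in>A. c a)"
  unfolding circle_coeff_def of_real_sum sum_distrib_right by (rule has_bochner_integral_sum)

lemma circle_coeff_cong:
  "circle_coeff k u r c \<Longrightarrow> r > 0 \<Longrightarrow> (\<And>z. cmod z = r \<Longrightarrow> u z = v z) \<Longrightarrow> circle_coeff k v r c"
  unfolding circle_coeff_def by (simp add: norm_mult)

text \<open>\<open>Re h\<close> is half the sum of \<open>h\<close> and its conjugate. For
  \<open>k > 0\<close> only the conjugate contains a frequency that pairs with
  \<open>cis (real k * t)\<close>, hence \<open>cnj\<close> and the factor \<open>2\<close>; for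
  \<open>k = 0\<close> both halves contribute.\<close>

definition re_coeff :: "nat \<Rightarrow> (complex \<Rightarrow> complex) \<Rightarrow> complex" where
  "re_coeff k h = (if k = 0 then of_real (Re (h 0)) else cnj ((deriv ^^ k) h 0) / (2 * fact k))"

lemma circle_coeff_Re:
  fixes r :: real
  assumes h: "h holomorphic_on ball 0 R" and r: "0 < r" "r < R"
  shows "circle_coeff k (\<lambda>z. Re (h z)) r (re_coeff k h * r ^ k)"
proof -
  have eq: "of_real (Re w) * cis s = (w * cis s + cnj (w * cis (- s))) / 2" for w :: complex and s
    by (simp add: complex_eq_iff algebra_simps)
  have "((\<lambda>t. h (r * cis t) * cis (- real k * t))
      has_integral (2 * pi * r ^ k / fact k * (deriv ^^ k) h 0)) {0..2 * pi}"
    by (rule has_integral_circle_higher_deriv[OF h r])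
  from has_integral_linear[OF this bounded_linear_cnj]
  have 1: "((\<lambda>t. cnj (h (r * cis t) * cis (- (real k * t))))
      has_integral cnj (2 * pi * r ^ k / fact k * (deriv ^^ k) h 0)) {0..2 * pi}"
    by (simp only: o_def mult_minus_left)
  define c where "c = (if k = 0 then 2 * pi * h 0 else 0)"
  have 2: "((\<lambda>t. h (r * cis t) * cis (real k * t)) has_integral c) {0..2 * pi}"
    using has_integral_circle_positive[OF h r, of k] has_integral_circle_higher_deriv[OF h r, of 0]
    by (cases "k = 0") (auto simp: c_def)
  have 3: "((\<lambda>t. of_real (Re (h (r * cis t))) * cis (real k * t))
      has_integral ((c + cnj (2 * pi * r ^ k / fact k * (deriv ^^ k) h 0)) / 2)) {0..2 * pi}"
    unfolding eq by (intro has_integral_divide has_integral_add 1 2)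
  have "continuous_on UNIV (\<lambda>t. h (r * cis t))"
    by (rule continuous_on_compose2[OF holomorphic_on_imp_continuous_on[OF h]])
       (use r in \<open>auto intro!: continuous_intros simp: norm_mult\<close>)
  then have cont: "continuous_on UNIV (\<lambda>t. of_real (Re (h (r * cis t))) * cis (real k * t))"
    by (intro continuous_intros)
  have "((c + cnj (2 * pi * r ^ k / fact k * (deriv ^^ k) h 0)) / 2) /\<^sub>R (2 * pi) = re_coeff k h * r ^ k"
    by (cases "k = 0") (simp_all add: c_def re_coeff_def scaleR_conv_of_real, simp
      add: complex_eq_iff power2_eq_square)
  with has_bochner_integral_circle_measure[OF cont 3] show ?thesis
    unfolding circle_coeff_def by simp
qed

section \<open>Logarithms of linear factors on circles\<close>

lemma one_minus_notin_nonpos_Reals: "cmod w < 1 \<Longrightarrow> 1 - w \<notin> \<real>\<^sub>\<le>\<^sub>0"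
  using complex_Re_le_cmod[of w] by (auto simp: complex_nonpos_Reals_iff)

lemma higher_deriv_Ln_one_minus:
  assumes "cmod (c * z) < 1"
  shows "(deriv ^^ Suc n) (\<lambda>z. Ln (1 - c * z)) z = - fact n * c ^ Suc n * inverse (1 - c * z) ^ Suc n"
  using assms
proof (induction n arbitrary: z)
  case 0
  have "((\<lambda>z. Ln (1 - c * z)) has_field_derivative - fact 0 * c ^ Suc 0 * inverse (1 - c * z) ^ Suc 0)
      (at z)"
    by (auto intro!: derivative_eq_intros one_minus_notin_nonpos_Reals "0.prems"
      simp: divide_inverse mult.commute)
  then show ?case by (simp add: DERIV_imp_deriv)
next
  case (Suc n)
  have "open {z. cmod (c * z) < 1}" by (intro open_Collect_less continuous_intros)
  then have ev: "eventually (\<lambda>w. cmod (c * w) < 1) (nhds z)"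
    using Suc.prems eventually_nhds_in_open[of "{z. cmod (c * z) < 1}" z] by simp
  have nz: "1 - c * z \<noteq> 0" using Suc.prems by auto
  have "(deriv ^^ Suc (Suc n)) (\<lambda>z. Ln (1 - c * z)) z
      = deriv (\<lambda>w. - fact n * c ^ Suc n * inverse (1 - c * w) ^ Suc n) z"
    unfolding funpow.simps(2)[of "Suc n"] comp_def
    by (rule deriv_cong_ev[OF eventually_mono[OF ev]]) (use Suc.IH in auto)
  also have "\<dots> = - fact (Suc n) * c ^ Suc (Suc n) * inverse (1 - c * z) ^ Suc (Suc n)"
  proof (rule DERIV_imp_deriv)
    have "((\<lambda>w. inverse (1 - c * w)) has_field_derivative c * (inverse (1 - c * z))\<^sup>2) (at z)"
      using nz by (auto intro!: derivative_eq_intros simp: power2_eq_square)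
    from DERIV_cmult[OF DERIV_power[OF this, of "Suc n"], of "- fact n * c ^ Suc n"]
    show "((\<lambda>w. - fact n * c ^ Suc n * inverse (1 - c * w) ^ Suc n)
        has_field_derivative - fact (Suc n) * c ^ Suc (Suc n) * inverse (1 - c * z) ^ Suc
          (Suc n)) (at z)"
      by (simp add: algebra_simps power2_eq_square)
  qed
  finally show ?case .
qed

lemma circle_coeff_ln_one_minus:
  assumes r: "0 < r" and c: "cmod c * r < 1"
  shows "circle_coeff k (\<lambda>z. ln (cmod (1 - c * z))) r (if k = 0 then 0
      else - ((cnj c) ^ k * r ^ k / (2 * of_nat k)))"
proof -
  \<comment> \<open>The branch of the logarithm must be holomorphic on a disc strictly larger than
    the circle, hence a radius between \<open>r\<close> and \<open>1 / cmod c\<close>.\<close>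
  obtain R where R: "r < R" "cmod c * R < 1"
  proof (cases "c = 0")
    case False
    show ?thesis
      by (rule that[of "(r + 1 / cmod c) / 2"]) (use False c in \<open>auto simp: field_simps\<close>)
  qed (use that[of "r + 1"] in auto)
  have lt: "cmod (c * z) < 1" if "z \<in> ball 0 R" for z
  proof -
    have "cmod (c * z) \<le> cmod c * R" using that by (auto simp: norm_mult intro!: mult_left_mono)
    then show ?thesis using R by simp
  qed
  have nn: "1 - c * z \<notin> \<real>\<^sub>\<le>\<^sub>0" if "z \<in> ball 0 R" for z
    by (intro one_minus_notin_nonpos_Reals lt that)
  have hol: "(\<lambda>z. Ln (1 - c * z)) holomorphic_on ball 0 R"
    by (intro holomorphic_intros nn)
  let ?e = "if k = 0 then 0 else - ((cnj c) ^ k * r ^ k / (2 * of_nat k)) :: complex"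
  have eq: "re_coeff k (\<lambda>z. Ln (1 - c * z)) * r ^ k = ?e"
  proof (cases k)
    case (Suc n)
    then show ?thesis using higher_deriv_Ln_one_minus[of c 0 n]
      by (simp add: re_coeff_def del: funpow.simps of_nat_Suc)
  qed (simp add: re_coeff_def)
  have "circle_coeff k (\<lambda>z. Re (Ln (1 - c * z))) r (re_coeff k (\<lambda>z. Ln (1 - c * z)) * r ^ k)"
    by (rule circle_coeff_Re[OF hol r R(1)])
  then show ?thesis unfolding eq
  proof (rule circle_coeff_cong)
    fix z :: complex assume "cmod z = r"
    then have "1 - c * z \<noteq> 0" using lt[of z] R(1) by auto
    then show "Re (Ln (1 - c * z)) = ln (cmod (1 - c * z))" by simp
  qed (use r in auto)
qed

text \<open>\<open>a ^ k * log_kernel k r (cmod a)\<close> is the coefficient of \<open>ln (cmod (z - a))\<close> on the circle of radius \<open>r\<close>.\<close>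
definition log_kernel :: "nat \<Rightarrow> real \<Rightarrow> real \<Rightarrow> real" where
  "log_kernel k r \<rho> = (if k = 0 then ln (max r \<rho>) else - (r ^ k / (max r \<rho> ^ (2 * k))) / (2 * real k))"

lemma circle_coeff_const: "circle_coeff 0 (\<lambda>z. c) r c" "k > 0 \<Longrightarrow> r > 0 \<Longrightarrow> circle_coeff k (\<lambda>z. c) r 0"
proof -
  show "circle_coeff 0 (\<lambda>z. c) r c"
    unfolding circle_coeff_def
    by (simp add: has_bochner_integral_iff circle_measure.prob_space[simplified])
  show "circle_coeff k (\<lambda>z. c) r 0" if "k > 0" "r > 0"
    using circle_coeff_Re[of "\<lambda>_. of_real c" "r + 1" r k] that
    by (simp add: re_coeff_def higher_deriv_const del: funpow.simps)
qed

text \<open>In both cases the modulus of \<open>z - a\<close> on the circle is a constant times the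
  modulus of a factor \<open>1 - c * z\<close> without zeros in the closed disc. For
  \<open>a\<close> outside, the constant is \<open>cmod a\<close>; for \<open>a\<close> inside,
  reflection in the circle gives the constant \<open>r\<close>.\<close>

lemma circle_coeff_ln_linear:
  assumes r: "0 < r" and a: "cmod a \<noteq> r"
  shows "circle_coeff k (\<lambda>z. ln (cmod (z - a))) r (a ^ k * log_kernel k r (cmod a))"
proof (cases "cmod a < r")
  case True
  \<comment> \<open>For \<open>a \<noteq> 0\<close> this is the reciprocal of the point
    \<open>r\<^sup>2 / cnj a\<close>, the reflection of \<open>a\<close> in the circle.\<close>
  define c where "c = cnj a / r\<^sup>2"
  let ?e = "if k = 0 then 0 else - ((cnj c) ^ k * r ^ k / (2 * of_nat k)) :: complex"
  have "cmod c = cmod a / r\<^sup>2" using r by (simp add: c_def norm_divide norm_power)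
  then have c: "cmod c * r < 1" using r True by (simp add: power2_eq_square)
  have eq: "ln r + ln (cmod (1 - c * z)) = ln (cmod (z - a))" if z: "cmod z = r" for z
  proof -
    have zz: "z * cnj z = r\<^sup>2" using z by (metis complex_norm_square)
    have z0: "z \<noteq> 0" using z r by auto
    have "1 - cnj c * cnj z = (z - a) * cnj z / r\<^sup>2"
      using r by (simp add: c_def field_simps zz flip: of_real_power)
    then have "cmod (1 - c * z) = cmod ((z - a) * cnj z / r\<^sup>2)"
      by (metis complex_cnj_diff complex_cnj_mult complex_cnj_one complex_mod_cnj)
    then have *: "cmod (1 - c * z) = cmod (z - a) / r"
      using z r by (simp add: norm_divide norm_mult power2_eq_square)
    have "z - a \<noteq> 0" using z True by auto
    then show ?thesis unfolding * using r by (simp add: ln_div)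
  qed
  have "circle_coeff k (\<lambda>z. ln r + ln (cmod (1 - c * z))) r ((if k = 0 then ln r else 0) + ?e)"
    by (rule circle_coeff_add[OF _ circle_coeff_ln_one_minus[OF r c]]) (use circle_coeff_const r in auto)
  then have "circle_coeff k (\<lambda>z. ln (cmod (z - a))) r ((if k = 0 then ln r else 0) + ?e)"
    by (rule circle_coeff_cong) (use eq r in auto)
  moreover have "complex_of_real (if k = 0 then ln r else 0) + ?e = a ^ k * log_kernel k r (cmod a)"
  proof (cases "k = 0")
    case False
    have "(cnj c) ^ k = a ^ k / (r ^ k * r ^ k)"
      by (simp add: c_def power_divide power2_eq_square power_mult_distrib)
    moreover have "r ^ (2 * k) = r ^ k * r ^ k" by (simp add: mult_2 power_add)
    ultimately show ?thesis using False True r by (simp add: log_kernel_def max_def)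
  qed (use True in \<open>simp add: log_kernel_def max_def\<close>)
  ultimately show ?thesis by (simp only:)
next
  case False
  with a have lt: "r < cmod a" by simp
  then have a0: "a \<noteq> 0" using r by auto
  define c where "c = 1 / a"
  let ?e = "if k = 0 then 0 else - ((cnj c) ^ k * r ^ k / (2 * of_nat k)) :: complex"
  have c: "cmod c * r < 1" using lt a0 by (simp add: c_def norm_divide field_simps)
  have eq: "ln (cmod a) + ln (cmod (1 - c * z)) = ln (cmod (z - a))" if z: "cmod z = r" for z
  proof -
    have "1 - c * z = - (z - a) / a" using a0 by (simp add: c_def field_simps)
    then have *: "cmod (1 - c * z) = cmod (z - a) / cmod a" by (simp add: norm_divide norm_minus_commute)
    have "z - a \<noteq> 0" using z lt by auto
    then show ?thesis unfolding * using a0 by (simp add: ln_div)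
  qed
  have "circle_coeff k (\<lambda>z. ln (cmod a) + ln (cmod (1 - c * z))) r
      ((if k = 0 then ln (cmod a) else 0) + ?e)"
    by (rule circle_coeff_add[OF _ circle_coeff_ln_one_minus[OF r c]]) (use circle_coeff_const r in auto)
  then have "circle_coeff k (\<lambda>z. ln (cmod (z - a))) r ((if k = 0 then ln (cmod a) else 0) + ?e)"
    by (rule circle_coeff_cong) (use eq r in auto)
  moreover have "complex_of_real (if k = 0 then ln (cmod a) else 0) + ?e
      = a ^ k * log_kernel k r (cmod a)"
  proof (cases "k = 0")
    case False
    have "(of_real (cmod a))\<^sup>2 = a * cnj a" by (metis complex_norm_square of_real_power)
    then have "cnj c = a / (cmod a)\<^sup>2" using a0 by (simp add: c_def field_simps)
    then have "(cnj c) ^ k = a ^ k / (cmod a) ^ (2 * k)" by (simp add: power_divide power_mult)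
    then show ?thesis using False lt by (simp add: log_kernel_def max_def field_simps)
  qed (use lt in \<open>simp add: log_kernel_def max_def\<close>)
  ultimately show ?thesis by (simp only:)
qed

text \<open>Each zero is divided out once. The quotient does not vanish there because its value is
  the derivative of \<open>f\<close>, and by the product rule the remaining zeros stay
  simple.\<close>

lemma holomorphic_factor_simple_zeros:
  fixes f :: "complex \<Rightarrow> complex"
  assumes "finite A" "open S" "f holomorphic_on S" "A = {z\<in>S. f z = 0}" "\<And>a. a \<in> A \<Longrightarrow> deriv f a \<noteq> 0"
  shows "\<exists>g. g holomorphic_on S \<and> (\<forall>z\<in>S. g z \<noteq> 0 \<and> f z = (\<Prod>a\<in>A. z - a) * g z)"
  using assms
proof (induction A arbitrary: f rule: finite_induct)
  case (insert a A)
  have aS: "a \<in> S" "f a = 0" using insert.prems by auto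
  define g where "g = (\<lambda>z. if z = a then deriv f a else (f z - f a) / (z - a))"
  have g: "g holomorphic_on S" unfolding g_def
    by (rule pole_lemma_open) (use insert.prems in auto)
  have fg: "f z = (z - a) * g z" for z using aS by (auto simp: g_def)
  have da: "deriv f a \<noteq> 0" using insert.prems by auto
  then have ga: "g a \<noteq> 0" by (simp add: g_def)
  have Az: "A = {z\<in>S. g z = 0}"
  proof (rule set_eqI)
    fix z
    have "z \<in> insert a A \<longleftrightarrow> z \<in> S \<and> (z - a) * g z = 0" unfolding insert.prems(3) by (simp add: fg)
    then show "z \<in> A \<longleftrightarrow> z \<in> {z\<in>S. g z = 0}" using insert.hyps ga aS by (cases "z = a") auto
  qed
  have "deriv g b \<noteq> 0" if b: "b \<in> A" for b
  proof
    assume 0: "deriv g b = 0"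
    have "b \<in> S" "g b = 0" using b Az by auto
    have gd: "(g has_field_derivative 0) (at b)"
      using holomorphic_derivI[OF g \<open>open S\<close> \<open>b \<in> S\<close>] 0 by simp
    have "((\<lambda>z. (z - a) * g z) has_field_derivative 0) (at b)"
      using \<open>g b = 0\<close> by (auto intro!: derivative_eq_intros gd)
    moreover have "(\<lambda>z. (z - a) * g z) = f" using fg by auto
    ultimately have "deriv f b = 0" by (simp add: DERIV_imp_deriv)
    then show False using insert.prems(4)[of b] b by simp
  qed
  from insert.IH[OF insert.prems(1) g Az this]
  obtain g' where g': "g' holomorphic_on S" "\<forall>z\<in>S. g' z \<noteq> 0 \<and> g z = (\<Prod>a\<in>A. z - a) * g' z" by blast
  show ?case
    using g' fg insert.hyps by (intro exI[of _ g']) (auto simp: mult.assoc)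
qed auto

text \<open>Jensen's formula with a frequency. The zero-free factor is an exponential
  \<open>exp (h z)\<close>, which contributes \<open>C * r ^ k\<close>. That \<open>C\<close> is the
  same for all radii is essential: it lets one moment condition on the weight remove this unknown
  term.\<close>

lemma circle_coeff_ln_holomorphic:
  fixes f :: "complex \<Rightarrow> complex" and A :: "complex set"
  assumes f: "f holomorphic_on ball 0 R" and A: "A = {z\<in>ball 0 R. f z = 0}" "finite A"
    and simple: "\<And>a. a \<in> A \<Longrightarrow> deriv f a \<noteq> 0"
  obtains C :: complex where "\<And>r. 0 < r \<Longrightarrow> r < R \<Longrightarrow> r \<notin> cmod ` A \<Longrightarrow>
     circle_coeff k (\<lambda>z. ln (cmod (f z))) r (C * r ^ k + (\<Sum>a\<in>A. a ^ k * log_kernel k r (cmod a)))"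
proof -
  obtain g where g: "g holomorphic_on ball 0 R" "\<And>z. z \<in> ball 0 R \<Longrightarrow> g z \<noteq> 0 \<and> f z = (\<Prod>a\<in>A. z - a) * g z"
    using holomorphic_factor_simple_zeros[OF A(2) open_ball f A(1) simple] by blast
  obtain h where h: "h holomorphic_on ball 0 R" "\<And>z. z \<in> ball 0 R \<Longrightarrow> g z = exp (h z)"
    using contractible_imp_holomorphic_log[OF g(1)] g(2) by (metis convex_ball convex_imp_contractible)
  show ?thesis
  proof (rule that[of "re_coeff k h"])
    fix r assume r: "0 < r" "r < R" "r \<notin> cmod ` A"
    have "circle_coeff k (\<lambda>z. Re (h z) + (\<Sum>a\<in>A. ln (cmod (z - a)))) r
        (re_coeff k h * r ^ k + (\<Sum>a\<in>A. a ^ k * log_kernel k r (cmod a)))"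
      by (rule circle_coeff_add[OF circle_coeff_Re[OF h(1) r(1,2)]
        circle_coeff_sum[OF circle_coeff_ln_linear]]) (use r in auto)
    then show "circle_coeff k (\<lambda>z. ln (cmod (f z))) r
        (re_coeff k h * r ^ k + (\<Sum>a\<in>A. a ^ k * log_kernel k r (cmod a)))"
    proof (rule circle_coeff_cong)
      fix z :: complex assume z: "cmod z = r"
      then have "z \<in> ball 0 R" using r by simp
      have "z - a \<noteq> 0" if "a \<in> A" for a using that z r(3) by auto
      then have "ln (\<Prod>a\<in>A. cmod (z - a)) = (\<Sum>a\<in>A. ln (cmod (z - a)))" "(\<Prod>a\<in>A. cmod (z - a)) > 0"
        using A(2) by (auto simp: ln_prod intro!: prod_pos)
      then show "Re (h z) + (\<Sum>a\<in>A. ln (cmod (z - a))) = ln (cmod (f z))"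
        using g(2)[OF \<open>z \<in> ball 0 R\<close>] h(2)[OF \<open>z \<in> ball 0 R\<close>]
        by (simp add: norm_mult prod_norm[symmetric] ln_mult)
    qed fact
  qed
qed

section \<open>The coefficient distribution and its overlaps\<close>

text \<open>The argument \<open>x\<close> is a squared modulus: the \<open>j\<close>-th term of the
  random series has variance \<open>gef_weight \<alpha> j (r\<^sup>2)\<close> on the circle of
  radius \<open>r\<close>, so \<open>gef_prob\<close> is its share of the total variance.\<close>

definition gef_weight :: "real \<Rightarrow> nat \<Rightarrow> real \<Rightarrow> real" where
  "gef_weight \<alpha> j x = x ^ j / fact j powr \<alpha>"

definition gef_norm :: "real \<Rightarrow> real \<Rightarrow> real" where
  "gef_norm \<alpha> x = (\<Sum>j. gef_weight \<alpha> j x)"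

definition gef_prob :: "real \<Rightarrow> nat \<Rightarrow> real \<Rightarrow> real" where
  "gef_prob \<alpha> j r = gef_weight \<alpha> j (r\<^sup>2) / gef_norm \<alpha> (r\<^sup>2)"

lemma measurable_gef_weight[measurable]: "gef_weight \<alpha> j \<in> borel_measurable borel"
  unfolding gef_weight_def by measurable

lemma measurable_gef_norm[measurable]: "gef_norm \<alpha> \<in> borel_measurable borel"
  unfolding gef_norm_def by measurable

lemma measurable_gef_prob[measurable]: "gef_prob \<alpha> j \<in> borel_measurable borel"
  unfolding gef_prob_def by measurable

lemma gef_weight_nonneg: "x \<ge> 0 \<Longrightarrow> gef_weight \<alpha> j x \<ge> 0"
  by (simp add: gef_weight_def)

context
  fixes \<alpha> :: real
  assumes alpha: "\<alpha> > 0"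
begin

lemma summable_gef_weight: "summable (\<lambda>j. gef_weight \<alpha> j x)"
  unfolding gef_weight_def by (rule summable_power_over_fact_powr[OF alpha])

lemma gef_norm_ge_1: "x \<ge> 0 \<Longrightarrow> gef_norm \<alpha> x \<ge> 1"
  using sum_le_suminf[OF summable_gef_weight, of "{0}" x]
  by (simp add: gef_norm_def gef_weight_nonneg) (simp add: gef_weight_def)

lemma gef_norm_pos: "x \<ge> 0 \<Longrightarrow> gef_norm \<alpha> x > 0"
  using gef_norm_ge_1[of x] by simp

lemma gef_prob_nonneg: "gef_prob \<alpha> j r \<ge> 0"
  using gef_norm_pos[of "r\<^sup>2"] by (simp add: gef_prob_def gef_weight_nonneg)

lemma gef_prob_sums: "(\<lambda>j. gef_prob \<alpha> j r) sums 1"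
proof -
  have "(\<lambda>j. gef_weight \<alpha> j (r\<^sup>2) / gef_norm \<alpha> (r\<^sup>2)) sums (gef_norm \<alpha> (r\<^sup>2) / gef_norm \<alpha> (r\<^sup>2))"
    unfolding gef_norm_def by (intro sums_divide summable_sums summable_gef_weight)
  then show ?thesis using gef_norm_pos[of "r\<^sup>2"] by (simp add: gef_prob_def)
qed

lemma gef_prob_le_1: "gef_prob \<alpha> j r \<le> 1"
  using sum_le_suminf[OF sums_summable[OF gef_prob_sums], of "{j}" r] gef_prob_nonneg
  by (simp add: sums_unique[OF gef_prob_sums, symmetric])

lemma gef_weight_Suc: "real (Suc j) powr \<alpha> * gef_weight \<alpha> (Suc j) x = x * gef_weight \<alpha> j x"
  by (simp add: gef_weight_def powr_mult del: of_nat_Suc)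

lemma gef_norm_deriv:
  "(gef_norm \<alpha> has_real_derivative (\<Sum>j. diffs (\<lambda>j. 1 / fact j powr \<alpha>) j * x ^ j)) (at x)"
  "(\<lambda>j. real j * gef_weight \<alpha> j x) sums (x * (\<Sum>j. diffs (\<lambda>j. 1 / fact j powr \<alpha>) j * x ^ j))"
proof -
  let ?c = "\<lambda>j. 1 / fact j powr \<alpha> :: real"
  have eq: "gef_weight \<alpha> j y = ?c j * y ^ j" for j y by (simp add: gef_weight_def)
  have sm: "summable (\<lambda>j. ?c j * y ^ j)" for y using summable_gef_weight[of y] unfolding eq .
  show "(gef_norm \<alpha> has_real_derivative (\<Sum>j. diffs ?c j * x ^ j)) (at x)"
    unfolding gef_norm_def[abs_def] eq by (rule termdiffs_strong_converges_everywhere[OF sm])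
  have "summable (\<lambda>j. diffs ?c j * x ^ j)"
    by (rule termdiff_converges_all[OF sm])
  from sums_mult[OF diffs_equiv[OF this], of x]
  show "(\<lambda>j. real j * gef_weight \<alpha> j x) sums (x * (\<Sum>j. diffs ?c j * x ^ j))"
  proof (rule sums_cong[THEN iffD1, rotated])
    show "x * (of_nat n * ?c n * x ^ (n - Suc 0)) = real n * gef_weight \<alpha> n x" for n
      by (cases n) (auto simp: eq)
  qed
qed

text \<open>The derivative of the distribution function at \<open>n\<close> compares \<open>\<Sum> j a_j\<close> over \<open>j \<le> n\<close> and \<open>j > n\<close>. By
  \<open>gef_weight_Suc\<close>, \<open>j a_j = j powr (1 - \<alpha>) * x a_{j-1}\<close>, and the factor \<open>j powr (1 - \<alpha>)\<close> is monotone for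
  \<open>\<alpha> \<le> 1\<close>, so both sums shift with constant \<open>(n + 1) powr (1 - \<alpha>)\<close>.\<close>
lemma gef_prob_le_deriv:
  fixes n :: nat and x :: real
  assumes x: "x > 0" and alpha1: "\<alpha> \<le> 1"
  defines "A \<equiv> \<lambda>x. \<Sum>j\<le>n. gef_weight \<alpha> j x"
  shows "\<exists>D. ((\<lambda>x. A x / gef_norm \<alpha> x) has_real_derivative D) (at x) \<and>
     gef_weight \<alpha> n x / gef_norm \<alpha> x \<le> - (real (Suc n) powr (\<alpha> - 1) * D)"
proof -
  let ?a = "\<lambda>j. gef_weight \<alpha> j x"
  define Z where "Z = gef_norm \<alpha> x"
  define Z' where "Z' = (\<Sum>j. diffs (\<lambda>j. 1 / fact j powr \<alpha>) j * x ^ j)"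
  define w where "w = real (Suc n) powr (\<alpha> - 1)"
  define A1 where "A1 = (\<Sum>j\<le>n. real j * ?a j)"
  define B where "B = Z - A x"
  define B1 where "B1 = x * Z' - A1"
  have Z: "Z > 0" using gef_norm_pos[of x] x by (simp add: Z_def)
  have a0: "?a j \<ge> 0" for j using x by (simp add: gef_weight_nonneg)
  have dA: "(A has_real_derivative (A1 / x)) (at x)"
  proof -
    have "((\<lambda>x. \<Sum>j\<le>n. x ^ j / fact j powr \<alpha>)
        has_real_derivative (\<Sum>j\<le>n. (real j * x ^ (j - 1)) / fact j powr \<alpha>)) (at x)"
      by (auto intro!: derivative_eq_intros)
    moreover have "(\<Sum>j\<le>n. (real j * x ^ (j - 1)) / fact j powr \<alpha>) = A1 / x"
      unfolding A1_def sum_divide_distrib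
    proof (rule sum.cong)
      fix j show "real j * x ^ (j - 1) / fact j powr \<alpha> = real j * ?a j / x"
        using x by (cases j) (auto simp: gef_weight_def)
    qed simp
    ultimately show ?thesis by (simp add: A_def gef_weight_def)
  qed
  have dZ: "(gef_norm \<alpha> has_real_derivative Z') (at x)" unfolding Z'_def by (rule gef_norm_deriv)
  define D where "D = (A1 / x * Z - A x * Z') / Z\<^sup>2"
  have D: "((\<lambda>x. A x / gef_norm \<alpha> x) has_real_derivative D) (at x)"
    using DERIV_divide[OF dA dZ] Z unfolding D_def Z_def by (simp add: power2_eq_square)
  have sB: "(\<lambda>j. ?a (j + Suc n)) sums B"
    using summable_sums[OF summable_ignore_initial_segment[OF summable_gef_weight[of x], of "Suc n"]]
      suminf_split_initial_segment[OF summable_gef_weight[of x], of "Suc n"]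
    by (simp add: B_def Z_def gef_norm_def A_def lessThan_Suc_atMost)
  have sB1: "(\<lambda>j. real (j + Suc n) * ?a (j + Suc n)) sums B1"
    using sums_iff_shift[of "\<lambda>j. real j * ?a j" "Suc n" B1] gef_norm_deriv(2)[of x]
    by (simp add: B1_def A1_def Z'_def lessThan_Suc_atMost)
  have sB0: "(\<lambda>j. ?a (j + n)) sums (B + ?a n)"
    using sums_iff_shift[of "\<lambda>j. ?a (j + n)" "Suc 0" B] sB by simp
  have "x * (B + ?a n) \<le> w * B1"
  proof (rule sums_le[OF _ sums_mult[OF sB0] sums_mult[OF sB1]])
    fix j
    have "x * ?a (j + n) = real (Suc (j + n)) powr \<alpha> * ?a (Suc (j + n))" by (simp only: gef_weight_Suc)
    also have "real (Suc (j + n)) powr \<alpha> = real (Suc (j + n)) powr (\<alpha> - 1) * real (Suc (j + n))"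
      by (simp add: powr_diff del: of_nat_Suc)
    also have "\<dots> * ?a (Suc (j + n)) \<le> w * real (Suc (j + n)) * ?a (Suc (j + n))"
      unfolding w_def using alpha1 by (intro mult_right_mono powr_mono2' a0) auto
    finally show "x * ?a (j + n) \<le> w * (real (j + Suc n) * ?a (j + Suc n))" by (simp add: mult.assoc)
  qed
  moreover have "w * A1 \<le> x * (A x - ?a n)"
  proof -
    have "w * A1 = (\<Sum>j\<le>n. w * (real j * ?a j))" by (simp add: A1_def sum_distrib_left)
    also have "\<dots> \<le> (\<Sum>j\<le>n. if j = 0 then 0 else x * ?a (j - 1))"
    proof (rule sum_mono)
      fix j assume "j \<in> {..n}"
      show "w * (real j * ?a j) \<le> (if j = 0 then 0 else x * ?a (j - 1))"
      proof (cases j)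
        case (Suc i)
        have "w * (real j * ?a j) \<le> real j powr (\<alpha> - 1) * (real j * ?a j)"
          unfolding w_def using alpha1 Suc \<open>j \<in> {..n}\<close>
          by (intro mult_right_mono powr_mono2' mult_nonneg_nonneg a0) auto
        also have "\<dots> = real j powr \<alpha> * ?a j" using Suc by (simp add: powr_diff del: of_nat_Suc)
        also have "\<dots> = x * ?a i" using Suc gef_weight_Suc by simp
        finally show ?thesis using Suc by simp
      qed simp
    qed
    also have "\<dots> = (\<Sum>j<n. x * ?a j)"
      by (subst sum.atMost_shift) (simp add: atLeast0LessThan)
    also have "\<dots> = x * (A x - ?a n)"
      by (simp add: A_def sum_distrib_left lessThan_Suc_atMost[symmetric])
    finally show ?thesis .
  qed
  moreover have "A x \<ge> 0" unfolding A_def by (intro sum_nonneg a0)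
  moreover have "B \<ge> 0" by (rule sums_le[OF _ sums_zero sB]) (use a0 in auto)
  \<comment> \<open>Weighting the tail estimate by \<open>A x\<close> and the head estimate by
    \<open>B\<close> makes the products \<open>A x * B\<close> cancel. What is left is
    \<open>x * ?a n * Z\<close> on one side and the numerator of the derivative \<open>D\<close> on
    the other.\<close>
  ultimately have "A x * (x * (B + ?a n)) - B * (x * (A x - ?a n)) \<le> A x * (w * B1) - B * (w * A1)"
    by (intro diff_mono mult_left_mono)
  moreover have "A x * (x * (B + ?a n)) - B * (x * (A x - ?a n)) = x * ?a n * Z"
    by (simp add: B_def algebra_simps)
  moreover have "A x * (w * B1) - B * (w * A1) = - w * (x * D * Z\<^sup>2)"
    unfolding B1_def B_def D_def using Z x by (simp add: field_simps)
  ultimately have "x * ?a n * Z \<le> - w * (x * D * Z\<^sup>2)" by simp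
  also have "- w * (x * D * Z\<^sup>2) = (- w * D * Z) * (x * Z)" by (simp add: power2_eq_square)
  finally have "?a n * (x * Z) \<le> (- w * D * Z) * (x * Z)" by (simp add: mult_ac)
  then have "?a n \<le> - w * D * Z" using Z x
    by (subst (asm) mult_le_cancel_right) (auto simp: mult_less_0_iff)
  then have "?a n / Z \<le> - (w * D)" using Z by (simp add: divide_le_eq)
  with D show ?thesis unfolding w_def Z_def by blast
qed

text \<open>With \<open>x = s\<^sup>2\<close>, the integrand is dominated by the derivative of
  \<open>- w / 2\<close> times the distribution function \<open>F\<close>. Since \<open>F\<close>
  takes values in \<open>[0, 1]\<close>, the integral is at most \<open>w / 2\<close>, uniformly in
  the interval.\<close>

lemma nn_integral_gef_prob:
  assumes R: "0 < R0" "R0 \<le> R1" and alpha1: "\<alpha> \<le> 1"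
  shows "(\<integral>\<^sup>+s. ennreal (s * gef_prob \<alpha> n s) * indicator {R0..R1} s \<partial>lborel)
      \<le> ennreal (real (Suc n) powr (\<alpha> - 1) / 2)"
proof -
  define w where "w = real (Suc n) powr (\<alpha> - 1)"
  have w: "w \<ge> 0" by (simp add: w_def)
  define F where "F x = (\<Sum>j\<le>n. gef_weight \<alpha> j x) / gef_norm \<alpha> x" for x
  have [measurable]: "F \<in> borel_measurable borel" unfolding F_def by measurable
  have ex: "\<exists>D. (F has_real_derivative D) (at x) \<and> gef_weight \<alpha> n x / gef_norm \<alpha> x \<le> - (w * D)"
    if "x > 0" for x
    using gef_prob_le_deriv[OF that alpha1, of n] by (simp add: F_def[abs_def] w_def)
  define D where "D x = deriv F x" for x
  have D: "(F has_real_derivative D x) (at x)" "gef_weight \<alpha> n x / gef_norm \<alpha> x \<le> - (w * D x)" if "x > 0"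
    for x
    using ex[OF that] by (auto simp: D_def dest: DERIV_imp_deriv)
  define g where "g s = - w / 2 * (D (s\<^sup>2) * (2 * s))" for s
  have der: "((\<lambda>s. - w / 2 * F (s\<^sup>2)) has_real_derivative g s) (at s)" if "s > 0" for s
    unfolding g_def using that
    by (intro DERIV_cmult DERIV_chain2[where f=F and g="\<lambda>s. s\<^sup>2"] D) (auto intro!: derivative_eq_intros)
  have le: "s * gef_prob \<alpha> n s \<le> g s" if "s > 0" for s
  proof -
    have "s * gef_prob \<alpha> n s \<le> s * (- (w * D (s\<^sup>2)))"
      unfolding gef_prob_def using that by (intro mult_left_mono D) auto
    then show ?thesis by (simp add: g_def mult_ac)
  qed
  have F01: "0 \<le> F x" "F x \<le> 1" if "x \<ge> 0" for x
  proof -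
    show "0 \<le> F x" unfolding F_def using that gef_norm_pos[of x]
      by (intro divide_nonneg_nonneg sum_nonneg gef_weight_nonneg) auto
    have "(\<Sum>j\<le>n. gef_weight \<alpha> j x) \<le> gef_norm \<alpha> x"
      unfolding gef_norm_def
      by (rule sum_le_suminf[OF summable_gef_weight]) (use that gef_weight_nonneg in auto)
    then show "F x \<le> 1" unfolding F_def using gef_norm_pos[of x] that by simp
  qed
  \<comment> \<open>Only differentiability of \<open>F\<close> is known, so \<open>g\<close> is obtained as a limit of difference quotients.\<close>
  have gmeas: "(\<lambda>s. g s * indicator {R0..R1} s) \<in> borel_measurable borel"
  proof (rule borel_measurable_LIMSEQ_real)
    fix s :: real
    show "(\<lambda>i. (((- w / 2 * F ((s + inverse (real (Suc i)))\<^sup>2)) - (- w / 2 * F (s\<^sup>2)))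
        / inverse (real (Suc i))) * indicator {R0..R1} s) \<longlonglongrightarrow> g s * indicator {R0..R1} s"
    proof (cases "s \<in> {R0..R1}")
      case True
      then have "s > 0" using R by auto
      have "((\<lambda>h. ((- w / 2 * F ((s + h)\<^sup>2)) - (- w / 2 * F (s\<^sup>2))) / h) \<longlongrightarrow> g s) (at 0)"
        using der[OF \<open>s > 0\<close>] by (simp add: DERIV_def)
      moreover have "filterlim (\<lambda>i. inverse (real (Suc i))) (at 0) sequentially"
        using LIMSEQ_inverse_real_of_nat by (simp add: filterlim_at)
      ultimately show ?thesis
        by (intro tendsto_mult tendsto_const) (rule filterlim_compose)
    qed simp
  qed measurable
  have "(\<integral>\<^sup>+s. ennreal (s * gef_prob \<alpha> n s) * indicator {R0..R1} s \<partial>lborel)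
     \<le> (\<integral>\<^sup>+s. ennreal (g s * indicator {R0..R1} s) * indicator {R0..R1} s \<partial>lborel)"
    using R by (intro nn_integral_mono) (auto simp: indicator_def intro!: ennreal_leI le)
  also have "\<dots> = ennreal (- w / 2 * F (R1\<^sup>2) - (- w / 2 * F (R0\<^sup>2)))"
  proof (rule nn_integral_FTC_Icc[OF _ _ _ R(2)])
    fix s assume s: "s \<in> {R0..R1}"
    then have "s > 0" using R by simp
    show "((\<lambda>s. - w / 2 * F (s\<^sup>2)) has_real_derivative g s * indicator {R0..R1} s) (at s)"
      using der[OF \<open>s > 0\<close>] s by auto
    show "0 \<le> g s * indicator {R0..R1} s"
      using order_trans[OF _ le[OF \<open>s > 0\<close>]] gef_prob_nonneg[of n s] \<open>s > 0\<close>
      by (auto simp: indicator_def)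
  qed (use gmeas in auto)
  also have "\<dots> \<le> ennreal (w / 2)"
  proof (rule ennreal_leI)
    have "w * F (R0\<^sup>2) \<le> w * 1" "0 \<le> w * F (R1\<^sup>2)" using F01 w
      by (auto intro!: mult_left_mono simp del: mult_1_right)
    then show "- w / 2 * F (R1\<^sup>2) - - w / 2 * F (R0\<^sup>2) \<le> w / 2" by simp
  qed
  finally show ?thesis by (simp add: w_def)
qed

text \<open>Each of the \<open>m\<close> extra factors satisfies
  \<open>j + i \<le> i * (j + 1)\<close>.\<close>

lemma fact_add_le: "(fact (j + m) :: real) \<le> fact m * fact j * real (Suc j) ^ m"
proof (induction m)
  case (Suc m)
  have "(fact (j + Suc m) :: real) = real (Suc (j + m)) * fact (j + m)" by simp
  also have "\<dots> \<le> (real (Suc m) * real (Suc j)) * (fact m * fact j * real (Suc j) ^ m)"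
    by (intro mult_mono Suc) (auto simp: algebra_simps)
  finally show ?case by (simp add: mult_ac del: of_nat_Suc)
qed simp

text \<open>By \<open>fact_add_le\<close>, the factor \<open>(j + 1) powr (- (m * \<alpha>))\<close>
  turns the \<open>j\<close>-th probability into at most a constant times the
  \<open>(j + m)\<close>-th, divided by \<open>r ^ (2 * m)\<close>; the shifted probabilities sum to
  at most \<open>1\<close>.\<close>

lemma suminf_gef_prob_moment:
  assumes r: "r > 0"
  shows "(\<Sum>j. ennreal (gef_prob \<alpha> j r * real (Suc j) powr (- (real m * \<alpha>))))
      \<le> ennreal (fact m powr \<alpha> / r ^ (2 * m))"
proof -
  define x where "x = r\<^sup>2"
  have x: "x > 0" using r by (simp add: x_def)
  have xm: "r ^ (2 * m) = x ^ m" by (simp add: x_def power_mult)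
  have Z: "gef_norm \<alpha> x > 0" using gef_norm_pos[of x] x by simp
  have le: "gef_prob \<alpha> j r * real (Suc j) powr (- (real m * \<alpha>))
      \<le> fact m powr \<alpha> / x ^ m * (gef_weight \<alpha> (j + m) x / gef_norm \<alpha> x)" for j
  proof -
    have "fact (j + m) powr \<alpha> \<le> (fact m * fact j * real (Suc j) ^ m) powr \<alpha>"
      using alpha by (intro powr_mono2 fact_add_le) auto
    also have "\<dots> = fact m powr \<alpha> * fact j powr \<alpha> * real (Suc j) powr (real m * \<alpha>)"
      by (simp add: powr_mult powr_powr del: of_nat_Suc flip: powr_realpow)
    finally have *: "fact (j + m) powr \<alpha> \<le> fact m powr \<alpha> * fact j powr \<alpha>
        * real (Suc j) powr (real m * \<alpha>)" .
    have "gef_weight \<alpha> j x * real (Suc j) powr (- (real m * \<alpha>))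
        = x ^ j / (fact j powr \<alpha> * real (Suc j) powr (real m * \<alpha>))"
      by (simp add: gef_weight_def powr_minus divide_inverse)
    also have "\<dots> \<le> x ^ j * (fact m powr \<alpha> / fact (j + m) powr \<alpha>)"
      using * x by (simp add: field_simps)
    also have "\<dots> = fact m powr \<alpha> / x ^ m * gef_weight \<alpha> (j + m) x"
      using x by (simp add: gef_weight_def power_add)
    finally have "gef_weight \<alpha> j x * real (Suc j) powr (- (real m * \<alpha>)) / gef_norm \<alpha> x
        \<le> fact m powr \<alpha> / x ^ m * gef_weight \<alpha> (j + m) x / gef_norm \<alpha> x"
      using Z by (intro divide_right_mono) auto
    then show ?thesis by (simp add: gef_prob_def x_def)
  qed
  have "(\<Sum>j. ennreal (gef_prob \<alpha> j r * real (Suc j) powr (- (real m * \<alpha>))))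
      \<le> (\<Sum>j. ennreal (fact m powr \<alpha> / x ^ m * (gef_weight \<alpha> (j + m) x / gef_norm \<alpha> x)))"
    by (intro suminf_le ennreal_leI le) auto
  also have "\<dots> = ennreal (\<Sum>j. fact m powr \<alpha> / x ^ m * (gef_weight \<alpha> (j + m) x / gef_norm \<alpha> x))"
    using x Z by (intro suminf_ennreal2 summable_mult summable_divide summable_ignore_initial_segment
      summable_gef_weight)
      (auto intro!: mult_nonneg_nonneg divide_nonneg_nonneg gef_weight_nonneg)
  also have "(\<Sum>j. fact m powr \<alpha> / x ^ m * (gef_weight \<alpha> (j + m) x / gef_norm \<alpha> x))
      = fact m powr \<alpha> / x ^ m * ((\<Sum>j. gef_weight \<alpha> (j + m) x) / gef_norm \<alpha> x)"
    by (subst suminf_mult suminf_divide; (intro summable_divide summable_ignore_initial_segment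
      summable_gef_weight)?)+ simp
  also have "\<dots> \<le> fact m powr \<alpha> / x ^ m * 1"
  proof (rule mult_left_mono)
    have "(\<Sum>j. gef_weight \<alpha> (j + m) x) \<le> gef_norm \<alpha> x"
      using suminf_split_initial_segment[OF summable_gef_weight[of x], of m] x
      by (simp add: gef_norm_def sum_nonneg gef_weight_nonneg)
    then show "(\<Sum>j. gef_weight \<alpha> (j + m) x) / gef_norm \<alpha> x \<le> 1" using Z by simp
  qed (use x in simp)
  finally show ?thesis unfolding xm by (simp add: ennreal_leI)
qed

definition gef_overlap :: "real \<Rightarrow> real \<Rightarrow> ennreal" where
  "gef_overlap r s = (\<Sum>j. ennreal (gef_prob \<alpha> j r * gef_prob \<alpha> j s))"

lemma measurable_gef_overlap[measurable]:
  assumes [measurable]: "f \<in> borel_measurable N" "g \<in> borel_measurable N"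
  shows "(\<lambda>x. gef_overlap (f x) (g x)) \<in> borel_measurable N"
  unfolding gef_overlap_def by measurable

lemma gef_overlap_commute: "gef_overlap r s = gef_overlap s r"
  by (simp add: gef_overlap_def mult.commute)

lemma gef_overlap_le_1: "gef_overlap r s \<le> 1"
proof -
  have "gef_overlap r s \<le> (\<Sum>j. ennreal (gef_prob \<alpha> j r))"
    unfolding gef_overlap_def
    by (intro suminf_le ennreal_leI mult_right_le_one_le gef_prob_nonneg gef_prob_le_1) auto
  also have "\<dots> = ennreal 1"
    using gef_prob_sums[of r] gef_prob_nonneg by (subst suminf_ennreal2) (auto simp: sums_iff)
  finally show ?thesis by simp
qed

text \<open>For fixed \<open>r\<close> the \<open>s\<close>-integral is done term by term with
  \<open>nn_integral_gef_prob\<close>, and the resulting negative moment is of order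
  \<open>1 / r ^ (2 * (k - 1))\<close>. This cancels the power of \<open>r\<close> in front up to
  \<open>1 / r\<close>, whose integral is the logarithm.\<close>

lemma nn_integral_gef_overlap:
  assumes R: "0 < R0" "R0 \<le> R1" and k: "k \<ge> 1" "real k * \<alpha> \<le> 1"
  shows "(\<integral>\<^sup>+r. \<integral>\<^sup>+s. ennreal (r ^ (k - 1) * s ^ (k - 1)) * gef_overlap r s * indicator {R0..R1} r
      * indicator {R0..R1} s \<partial>lborel \<partial>lborel)
     \<le> ennreal (fact (k - 1) powr \<alpha> / 2 * ln (R1 / R0))"
proof -
  define m where "m = k - 1"
  have km: "k = Suc m" using k by (simp add: m_def)
  have alpha1: "\<alpha> \<le> 1"
  proof -
    have "1 * \<alpha> \<le> real k * \<alpha>" using k alpha by (intro mult_right_mono) auto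
    then show ?thesis using k by linarith
  qed
  let ?I = "\<lambda>r. indicator {R0..R1} r :: ennreal"
  let ?G = "\<lambda>r s. ennreal (r ^ (2 * m) / r * s / 2) * gef_overlap r s * ?I r * ?I s"
  have inner: "(\<integral>\<^sup>+s. ennreal s * gef_overlap r s * ?I s \<partial>lborel)
      \<le> ennreal (fact m powr \<alpha> / r ^ (2 * m) / 2)" if r: "r > 0" for r
  proof -
    have "(\<integral>\<^sup>+s. ennreal s * gef_overlap r s * ?I s \<partial>lborel)
        = (\<integral>\<^sup>+s. (\<Sum>j. ennreal (gef_prob \<alpha> j r) * (ennreal (s * gef_prob \<alpha> j s) * ?I s)) \<partial>lborel)"
      unfolding gef_overlap_def using R
      by (intro nn_integral_cong) (auto simp: indicator_def gef_prob_nonneg ennreal_mult mult_ac simp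
        flip: ennreal_suminf_cmult)
    also have "\<dots> = (\<Sum>j. ennreal (gef_prob \<alpha> j r) * (\<integral>\<^sup>+s. ennreal (s * gef_prob \<alpha> j s) * ?I s \<partial>lborel))"
      by (subst nn_integral_suminf) (auto simp: nn_integral_cmult)
    also have "\<dots> \<le> (\<Sum>j. ennreal (1 / 2) * ennreal (gef_prob \<alpha> j r * real (Suc j) powr (- (real m * \<alpha>))))"
    proof (intro suminf_le)
      fix j
      have "ennreal (gef_prob \<alpha> j r) * (\<integral>\<^sup>+s. ennreal (s * gef_prob \<alpha> j s) * ?I s \<partial>lborel)
          \<le> ennreal (gef_prob \<alpha> j r) * ennreal (real (Suc j) powr (\<alpha> - 1) / 2)"
        by (intro mult_left_mono nn_integral_gef_prob R alpha1) auto
      also have "\<dots> = ennreal (gef_prob \<alpha> j r * (real (Suc j) powr (\<alpha> - 1) / 2))"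
        by (subst ennreal_mult[symmetric]) (auto simp: gef_prob_nonneg)
      also have "\<dots> \<le> ennreal (gef_prob \<alpha> j r * (real (Suc j) powr (- (real m * \<alpha>)) / 2))"
      proof (intro ennreal_leI mult_left_mono divide_right_mono powr_mono gef_prob_nonneg)
        \<comment> \<open>Equivalent to \<open>k * \<alpha> \<le> 1\<close>: the gain in
          \<open>j\<close> from integrating \<open>s\<close> is just enough to pay for the moment of
          order \<open>m = k - 1\<close>.\<close>
        show "\<alpha> - 1 \<le> - (real m * \<alpha>)" using k by (simp add: km algebra_simps)
      qed auto
      also have "\<dots> = ennreal (1 / 2) * ennreal (gef_prob \<alpha> j r * real (Suc j) powr (- (real m * \<alpha>)))"
        by (subst ennreal_mult[symmetric]) (auto simp: gef_prob_nonneg)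
      finally show "ennreal (gef_prob \<alpha> j r) * (\<integral>\<^sup>+s. ennreal (s * gef_prob \<alpha> j s) * ?I s \<partial>lborel)
          \<le> ennreal (1 / 2) * ennreal (gef_prob \<alpha> j r * real (Suc j) powr (- (real m * \<alpha>)))" .
    qed auto
    also have "\<dots> = ennreal (1 / 2) * (\<Sum>j. ennreal (gef_prob \<alpha> j r * real (Suc j) powr (- (real m * \<alpha>))))"
      by (rule ennreal_suminf_cmult)
    also have "\<dots> \<le> ennreal (1 / 2) * ennreal (fact m powr \<alpha> / r ^ (2 * m))"
      by (intro mult_left_mono suminf_gef_prob_moment r) auto
    also have "\<dots> = ennreal (fact m powr \<alpha> / r ^ (2 * m) / 2)"
      by (subst ennreal_mult[symmetric]) (use r in auto)
    finally show ?thesis .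
  qed
  have half: "(\<integral>\<^sup>+r. \<integral>\<^sup>+s. ?G r s \<partial>lborel \<partial>lborel) \<le> ennreal (fact m powr \<alpha> / 4 * ln (R1 / R0))"
  proof -
    have "(\<integral>\<^sup>+r. \<integral>\<^sup>+s. ?G r s \<partial>lborel \<partial>lborel)
        \<le> (\<integral>\<^sup>+r. ennreal (fact m powr \<alpha> / 4 * (1 / r)) * ?I r \<partial>lborel)"
    proof (intro nn_integral_mono)
      fix r :: real
      show "(\<integral>\<^sup>+s. ?G r s \<partial>lborel) \<le> ennreal (fact m powr \<alpha> / 4 * (1 / r)) * ?I r"
      proof (cases "r \<in> {R0..R1}")
        case True
        then have r: "r > 0" using R by auto
        have e: "ennreal (r ^ (2 * m) / r * s / 2) = ennreal (r ^ (2 * m) / r / 2) * ennreal s"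
          if "s \<ge> 0" for s
          by (subst ennreal_mult[symmetric]) (use r that in auto)
        have "(\<integral>\<^sup>+s. ?G r s \<partial>lborel)
            = (\<integral>\<^sup>+s. ennreal (r ^ (2 * m) / r / 2) * (ennreal s * gef_overlap r s * ?I s) \<partial>lborel)"
        proof (rule nn_integral_cong)
          fix s
          show "?G r s = ennreal (r ^ (2 * m) / r / 2) * (ennreal s * gef_overlap r s * ?I s)"
            using e[of s] True R by (auto simp: indicator_def mult_ac)
        qed
        also have "\<dots> = ennreal (r ^ (2 * m) / r / 2) * (\<integral>\<^sup>+s. ennreal s * gef_overlap r s * ?I s \<partial>lborel)"
          by (rule nn_integral_cmult) measurable
        also have "\<dots> \<le> ennreal (r ^ (2 * m) / r / 2) * ennreal (fact m powr \<alpha> / r ^ (2 * m) / 2)"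
          by (intro mult_left_mono inner r) auto
        also have "\<dots> = ennreal (fact m powr \<alpha> / 4 * (1 / r)) * ?I r"
          by (subst ennreal_mult[symmetric]) (use True r in auto)
        finally show ?thesis .
      qed simp
    qed
    also have "\<dots> = (\<integral>\<^sup>+r. ennreal (fact m powr \<alpha> / 4 * (1 / r) * indicator {R0..R1} r) * ?I r \<partial>lborel)"
      by (intro nn_integral_cong) (auto simp: indicator_def)
    also have "\<dots> = ennreal (fact m powr \<alpha> / 4 * ln R1 - fact m powr \<alpha> / 4 * ln R0)"
      by (rule nn_integral_FTC_Icc[OF _ _ _ R(2)])
         (use R in \<open>auto intro!: derivative_eq_intros\<close>)
    also have "fact m powr \<alpha> / 4 * ln R1 - fact m powr \<alpha> / 4 * ln R0 = fact m powr \<alpha> / 4 * ln (R1 / R0)"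
      using R by (simp add: ln_div algebra_simps)
    finally show ?thesis .
  qed
  \<comment> \<open>AM-GM replaces \<open>r ^ m * s ^ m\<close> by a form in which one variable occurs only as \<open>s ds\<close>, the measure of
    \<open>nn_integral_gef_prob\<close>.\<close>
  have amgm: "r ^ m * s ^ m \<le> r ^ (2 * m) / r * s / 2 + s ^ (2 * m) / s * r / 2" if "r > 0" "s > 0"
    for r s :: real
  proof -
    have "2 * (r ^ m * s) * (s ^ m * r) \<le> (r ^ m * s)\<^sup>2 + (s ^ m * r)\<^sup>2" by (rule sum_squares_bound)
    moreover have "2 * (r ^ m * s) * (s ^ m * r) = 2 * (r ^ m * s ^ m) * (r * s)" by (simp add: mult_ac)
    moreover have "r ^ (2 * m) / r * s * (r * s) = (r ^ m * s)\<^sup>2"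
      "s ^ (2 * m) / s * r * (r * s) = (s ^ m * r)\<^sup>2"
      using that by
        (simp_all add: power_even_eq power_mult_distrib power2_eq_square[of s] power2_eq_square[of r])
    ultimately have "2 * (r ^ m * s ^ m) * (r * s)
        \<le> (r ^ (2 * m) / r * s + s ^ (2 * m) / s * r) * (r * s)"
      by (simp only: distrib_right)
    then have "2 * (r ^ m * s ^ m) \<le> r ^ (2 * m) / r * s + s ^ (2 * m) / s * r"
      using that by (subst (asm) mult_le_cancel_right) (auto simp: mult_less_0_iff)
    then show ?thesis by simp
  qed
  have "(\<integral>\<^sup>+r. \<integral>\<^sup>+s. ennreal (r ^ m * s ^ m) * gef_overlap r s * ?I r * ?I s \<partial>lborel \<partial>lborel)
      \<le> (\<integral>\<^sup>+r. \<integral>\<^sup>+s. ?G r s + ?G s r \<partial>lborel \<partial>lborel)"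
  proof (intro nn_integral_mono)
    fix r s :: real
    show "ennreal (r ^ m * s ^ m) * gef_overlap r s * ?I r * ?I s \<le> ?G r s + ?G s r"
    proof (cases "r \<in> {R0..R1} \<and> s \<in> {R0..R1}")
      case True
      then have rs: "r > 0" "s > 0" using R by auto
      have "ennreal (r ^ m * s ^ m) * gef_overlap r s
          \<le> ennreal (r ^ (2 * m) / r * s / 2 + s ^ (2 * m) / s * r / 2) * gef_overlap r s"
        by (intro mult_right_mono ennreal_leI amgm rs) auto
      also have "\<dots> = ennreal (r ^ (2 * m) / r * s / 2) * gef_overlap r s
          + ennreal (s ^ (2 * m) / s * r / 2) * gef_overlap s r"
        using rs by (subst ennreal_plus) (auto simp: distrib_right gef_overlap_commute)
      finally show ?thesis using True by simp
    qed (auto simp: indicator_def)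
  qed
  also have "\<dots> = (\<integral>\<^sup>+r. \<integral>\<^sup>+s. ?G r s \<partial>lborel \<partial>lborel) + (\<integral>\<^sup>+r. \<integral>\<^sup>+s. ?G s r \<partial>lborel \<partial>lborel)"
    by (subst nn_integral_add[symmetric])
       (auto intro!: nn_integral_cong nn_integral_add lborel.borel_measurable_nn_integral
         simp: split_beta')
  also have "(\<integral>\<^sup>+r. \<integral>\<^sup>+s. ?G s r \<partial>lborel \<partial>lborel) = (\<integral>\<^sup>+r. \<integral>\<^sup>+s. ?G r s \<partial>lborel \<partial>lborel)"
    by (rule lborel_pair.Fubini') (simp add: split_beta')
  also have "(\<integral>\<^sup>+r. \<integral>\<^sup>+s. ?G r s \<partial>lborel \<partial>lborel) + (\<integral>\<^sup>+r. \<integral>\<^sup>+s. ?G r s \<partial>lborel \<partial>lborel)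
      \<le> ennreal (fact m powr \<alpha> / 4 * ln (R1 / R0)) + ennreal (fact m powr \<alpha> / 4 * ln (R1 / R0))"
    by (intro add_mono half)
  also have "\<dots> = ennreal (fact m powr \<alpha> / 2 * ln (R1 / R0))"
    using R by (subst ennreal_plus[symmetric]) (auto intro!: mult_nonneg_nonneg simp: ln_ge_zero)
  finally show ?thesis unfolding m_def .
qed

end

section \<open>Covariance of Gaussian logarithms\<close>

lemma measurable_cis[measurable]: "cis \<in> borel_measurable borel"
  by (intro borel_measurable_continuous_onI continuous_intros)

lemma distr_cgauss_rotate: "cmod c = 1 \<Longrightarrow> distr cgauss borel ((*) c) = cgauss"
proof (rule measure_eqI)
  fix A assume c: "cmod c = 1" and "A \<in> sets (distr cgauss borel ((*) c))"
  then have A[measurable]: "A \<in> sets borel" by simp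
  have "emeasure (distr cgauss borel ((*) c)) A = (\<integral>\<^sup>+x. indicator A x \<partial>distr cgauss borel ((*) c))"
    by simp
  also have "\<dots> = (\<integral>\<^sup>+x. indicator A (c * x) \<partial>cgauss)"
    by (subst nn_integral_distr) auto
  also have "\<dots> = (\<integral>\<^sup>+x. indicator A x \<partial>cgauss)"
    by (rule nn_integral_cgauss_rotate[OF _ c]) measurable
  finally show "emeasure (distr cgauss borel ((*) c)) A = emeasure cgauss A" by simp
qed simp

lemma distr_cgauss_pair:
  assumes 1: "(cmod \<theta>)\<^sup>2 + s\<^sup>2 = 1"
  shows "distr (cgauss \<Otimes>\<^sub>M cgauss) borel (\<lambda>(x, y). \<theta> * x + of_real s * y) = cgauss"
proof (rule measure_eqI)
  fix A assume "A \<in> sets (distr (cgauss \<Otimes>\<^sub>M cgauss) borel (\<lambda>(x, y). \<theta> * x + of_real s * y))"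
  then have A[measurable]: "A \<in> sets borel" by simp
  have "emeasure (distr (cgauss \<Otimes>\<^sub>M cgauss) borel (\<lambda>(x, y). \<theta> * x + of_real s * y)) A
      = (\<integral>\<^sup>+x. indicator A x \<partial>distr (cgauss \<Otimes>\<^sub>M cgauss) borel (\<lambda>(x, y). \<theta> * x + of_real s * y))"
    by simp
  also have "\<dots> = (\<integral>\<^sup>+x. \<integral>\<^sup>+y. indicator A (\<theta> * x + of_real s * y) \<partial>cgauss \<partial>cgauss)"
    by (subst nn_integral_distr) (auto simp: cgauss.nn_integral_fst[symmetric])
  also have "\<dots> = (\<integral>\<^sup>+x. indicator A x \<partial>cgauss)"
    by (subst nn_integral_cgauss_combine) (auto simp: 1)
  finally show "emeasure (distr (cgauss \<Otimes>\<^sub>M cgauss) borel (\<lambda>(x, y). \<theta> * x + of_real s * y)) A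
      = emeasure cgauss A" by simp
qed simp

text \<open>Discards the origin and the circle on which \<open>circle_integral_ln_affine\<close>
  gives no value.\<close>

lemma AE_cgauss_norm_neq: "AE y in cgauss. cmod y \<noteq> r"
proof -
  have "sphere (0::complex) r \<in> null_sets lborel"
    using negligible_sphere[of "0::complex" r]
    by (auto simp: negligible_iff_null_sets null_sets_completion_iff)
  then have "AE y in lborel. y \<notin> sphere (0::complex) r" by (rule AE_not_in)
  then show ?thesis unfolding cgauss_def
    by (subst AE_density) (auto elim!: eventually_mono)
qed

definition cgauss_log_mean :: real where
  "cgauss_log_mean = (\<integral>x. ln (cmod x) \<partial>cgauss)"

definition cgauss_log :: "complex \<Rightarrow> real" where
  "cgauss_log x = ln (cmod x) - cgauss_log_mean"

lemma measurable_cgauss_log[measurable]: "cgauss_log \<in> borel_measurable borel"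
  unfolding cgauss_log_def by measurable

lemma nn_integral_cgauss_cball:
  assumes "\<kappa> > 0"
  shows "(\<integral>\<^sup>+y. ennreal (\<kappa> / cmod y) * indicator (cball 0 \<kappa>) y \<partial>cgauss) \<le> ennreal (16 * \<kappa>\<^sup>2)"
proof -
  have m: "(\<lambda>y. ennreal (\<kappa> / cmod y) * indicator (cball 0 \<kappa>) y) \<in> borel_measurable borel"
    by (intro borel_measurable_times_ennreal borel_measurable_indicator) auto
  have "(\<integral>\<^sup>+y. ennreal (\<kappa> / cmod y) * indicator (cball 0 \<kappa>) y \<partial>cgauss)
      \<le> (\<integral>\<^sup>+y. 1 * (ennreal (\<kappa> / cmod y) * indicator (cball 0 \<kappa>) y) \<partial>lborel)"
    unfolding nn_integral_cgauss[OF m]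
    by (intro nn_integral_mono mult_right_mono std_complex_gaussian_density_le) auto
  also have "\<dots> = (\<integral>\<^sup>+y. ennreal (\<kappa> / cmod y) * indicator (cball 0 \<kappa>) y \<partial>lborel)" by simp
  also have "\<dots> = ennreal ((cmod (of_real \<kappa>))\<^sup>2)
      * (\<integral>\<^sup>+z. ennreal (\<kappa> / cmod (0 + of_real \<kappa> * z)) * indicator (cball 0 \<kappa>) (0 + of_real \<kappa> * z)
        \<partial>lborel)"
    by (rule nn_integral_affine_complex[OF m]) (use assms in auto)
  also have "(\<integral>\<^sup>+z. ennreal (\<kappa> / cmod (0 + of_real \<kappa> * z))
      * indicator (cball 0 \<kappa>) (0 + of_real \<kappa> * z) \<partial>lborel)
      = (\<integral>\<^sup>+z\<in>cball 0 1. ennreal (1 / cmod z) \<partial>lborel)"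
    using assms by (intro nn_integral_cong) (auto simp: norm_mult indicator_def)
  also have "ennreal ((cmod (of_real \<kappa>))\<^sup>2) * (\<integral>\<^sup>+z\<in>cball 0 1. ennreal (1 / cmod z) \<partial>lborel)
      \<le> ennreal ((cmod (of_real \<kappa>))\<^sup>2) * 16"
    by (intro mult_left_mono nn_integral_inverse_norm_cball) auto
  also have "\<dots> = ennreal (16 * \<kappa>\<^sup>2)"
    using ennreal_mult[of "\<kappa>\<^sup>2" 16] by (simp add: mult.commute)
  finally show ?thesis .
qed

lemma circle_integral_ln_affine:
  assumes s: "s > 0" and y: "y \<noteq> 0" "s * cmod y \<noteq> cmod c"
  shows "(\<integral>t. ln (cmod (c + of_real s * (cis t * y))) \<partial>circle_measure) = ln (max (s * cmod y) (cmod c))"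
proof -
  \<comment> \<open>Multiplying by the unimodular number \<open>cnj (sgn y)\<close> turns the moving
    point into one on the circle of radius \<open>s * cmod y\<close> about \<open>0\<close>, and
    \<open>- c\<close> into \<open>a\<close>.\<close>
  define a where "a = - c * cnj (sgn y)"
  have sg: "cmod (sgn y) = 1" using y by (simp add: norm_sgn)
  have a: "cmod a = cmod c" using sg by (simp add: a_def norm_mult)
  have r: "0 < s * cmod y" using s y by simp
  have eq: "cmod (of_real (s * cmod y) * cis t - a) = cmod (c + of_real s * (cis t * y))" for t
  proof -
    have "cmod (c + of_real s * (cis t * y)) = cmod ((c + of_real s * (cis t * y)) * cnj (sgn y))"
      using sg by (simp add: norm_mult)
    also have "y * cnj y = of_real (cmod y) * of_real (cmod y)"
      using complex_norm_square[of y] by (simp add: power2_eq_square)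
    then have "y * cnj (sgn y) = of_real (cmod y)"
      using y by (simp add: sgn_div_norm scaleR_conv_of_real field_simps)
    then have "(c + of_real s * (cis t * y)) * cnj (sgn y) = of_real (s * cmod y) * cis t - a"
      by (simp add: a_def algebra_simps)
    finally show ?thesis by simp
  qed
  have "circle_coeff 0 (\<lambda>z. ln (cmod (z - a))) (s * cmod y) (a ^ 0 * log_kernel 0 (s * cmod y) (cmod a))"
    by (rule circle_coeff_ln_linear) (use r a y in auto)
  then have "has_bochner_integral circle_measure
      (\<lambda>t. complex_of_real (ln (cmod (c + of_real s * (cis t * y)))))
        (of_real (ln (max (s * cmod y) (cmod c))))"
    by (simp only: circle_coeff_def eq) (simp add: log_kernel_def a)
  then have "has_bochner_integral circle_measure
      (\<lambda>t. Re (complex_of_real (ln (cmod (c + of_real s * (cis t * y))))))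
        (Re (of_real (ln (max (s * cmod y) (cmod c)))))"
    by (rule has_bochner_integral_Re)
  then show ?thesis by (simp add: has_bochner_integral_iff)
qed

text \<open>Averaging over rotations of \<open>y\<close> first, Jensen's formula replaces the integrand by
  \<open>ln (max (s * cmod y) (cmod c))\<close>, which differs from \<open>ln (s * cmod y)\<close> only on a disc of radius \<open>cmod c / s\<close>.\<close>
lemma cgauss_integral_ln_affine:
  assumes s: "s > 0" and int: "integrable cgauss (\<lambda>y. ln (cmod (c + of_real s * y)))"
  shows "\<bar>(\<integral>y. ln (cmod (c + of_real s * y)) \<partial>cgauss) - (ln s + cgauss_log_mean)\<bar> \<le> 16 * (cmod c)\<^sup>2 / s\<^sup>2"
proof -
  interpret P: pair_prob_space circle_measure cgauss ..
  define g where "g = (\<lambda>y. ln (cmod (c + of_real s * y)))"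
  have [measurable]: "g \<in> borel_measurable borel" unfolding g_def by measurable
  have ig: "integrable cgauss g" using int by (simp add: g_def)
  have rot: "integrable cgauss (\<lambda>y. h (cis t * y))" "(\<integral>y. h (cis t * y) \<partial>cgauss) = (\<integral>y. h y \<partial>cgauss)"
    if "integrable cgauss h" and [measurable]: "h \<in> borel_measurable borel" for h :: "complex \<Rightarrow> real"
      and t
  proof -
    have d: "distr cgauss borel ((*) (cis t)) = cgauss" by (rule distr_cgauss_rotate) simp
    show "integrable cgauss (\<lambda>y. h (cis t * y))"
      using that(1) by (subst (asm) d[symmetric], subst (asm) integrable_distr_eq) auto
    show "(\<integral>y. h (cis t * y) \<partial>cgauss) = (\<integral>y. h y \<partial>cgauss)"
      by (subst (2) d[symmetric], subst integral_distr) auto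
  qed
  have iP: "integrable (circle_measure \<Otimes>\<^sub>M cgauss) (\<lambda>(t, y). g (cis t * y))"
  proof (rule P.Fubini_integrable)
    have "(\<integral>y. norm (g (cis t * y)) \<partial>cgauss) = (\<integral>y. norm (g y) \<partial>cgauss)" for t
      by (rule rot(2)[of "\<lambda>y. norm (g y)"]) (use ig in auto)
    then show "integrable circle_measure (\<lambda>t. \<integral>y. norm (case (t, y) of (t, y) \<Rightarrow> g (cis t * y)) \<partial>cgauss)"
      by simp
    show "AE t in circle_measure. integrable cgauss (\<lambda>y. case (t, y) of (t, y) \<Rightarrow> g (cis t * y))"
      using rot(1)[OF ig] by simp
  qed measurable
  have "(\<integral>y. g y \<partial>cgauss) = (\<integral>t. \<integral>y. g (cis t * y) \<partial>cgauss \<partial>circle_measure)"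
    using rot(2)[OF ig] by (simp add: circle_measure.prob_space[simplified])
  also have "\<dots> = (\<integral>y. \<integral>t. g (cis t * y) \<partial>circle_measure \<partial>cgauss)"
    by (rule P.Fubini_integral[OF iP, symmetric])
  finally have 1: "(\<integral>y. g y \<partial>cgauss) = (\<integral>y. \<integral>t. g (cis t * y) \<partial>circle_measure \<partial>cgauss)" .
  have AE: "AE y in cgauss. (\<integral>t. g (cis t * y) \<partial>circle_measure) = ln (max (s * cmod y) (cmod c)) \<and> y \<noteq> 0"
    using AE_cgauss_norm_neq[of "cmod c / s"] AE_cgauss_norm_neq[of 0]
  proof eventually_elim
    case (elim y)
    then have "s * cmod y \<noteq> cmod c" using s by (auto simp: field_simps)
    then show ?case unfolding g_def using elim circle_integral_ln_affine[OF s, of y c] by auto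
  qed
  have "integrable cgauss (\<lambda>y. \<integral>t. g (cis t * y) \<partial>circle_measure)"
    by (rule P.integrable_snd[OF iP])
  then have i2: "integrable cgauss (\<lambda>y. ln (max (s * cmod y) (cmod c)))"
    using AE by (subst (asm) integrable_cong_AE) (auto elim!: eventually_mono)
  have 2: "(\<integral>y. g y \<partial>cgauss) = (\<integral>y. ln (max (s * cmod y) (cmod c)) \<partial>cgauss)"
    unfolding 1 using AE by (intro integral_cong_AE) (auto elim!: eventually_mono)
  define f where "f = (\<lambda>y. ln (max (s * cmod y) (cmod c)) - (ln s + ln (cmod y)))"
  have [measurable]: "f \<in> borel_measurable borel" unfolding f_def by measurable
  have fi: "integrable cgauss f" unfolding f_def
    by (intro Bochner_Integration.integrable_diff i2 Bochner_Integration.integrable_add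
      integrable_cgauss_ln) auto
  have h: "(\<integral>y. g y \<partial>cgauss) - (ln s + cgauss_log_mean) = (\<integral>y. f y \<partial>cgauss)"
    unfolding 2 f_def cgauss_log_mean_def
    by (subst Bochner_Integration.integral_diff[OF i2], force intro!: integrable_cgauss_ln,
        subst Bochner_Integration.integral_add) (auto intro!: integrable_cgauss_ln
          simp: cgauss.prob_space[simplified])
  have f0: "0 \<le> f y" if "y \<noteq> 0" for y
  proof -
    have "ln s + ln (cmod y) = ln (s * cmod y)" using s that by (simp add: ln_mult)
    also have "\<dots> \<le> ln (max (s * cmod y) (cmod c))" using s that
      by (subst ln_le_cancel_iff) (auto simp: less_max_iff_disj)
    finally show ?thesis by (simp add: f_def)
  qed
  have AE0: "AE y in cgauss. y \<noteq> 0" using AE_cgauss_norm_neq[of 0] by eventually_elim auto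
  have nonneg: "0 \<le> (\<integral>y. f y \<partial>cgauss)"
    by (rule integral_nonneg_AE) (use AE0 f0 in \<open>auto elim!: eventually_mono\<close>)
  have upper: "(\<integral>y. f y \<partial>cgauss) \<le> 16 * (cmod c)\<^sup>2 / s\<^sup>2"
  proof (cases "c = 0")
    case True
    have "AE y in cgauss. f y = 0"
      using AE0
    proof eventually_elim
      case (elim y)
      then have "0 < s * cmod y" using s by simp
      then show ?case using s elim by (simp add: f_def True ln_mult max_absorb1 less_imp_le)
    qed
    then have "(\<integral>y. f y \<partial>cgauss) = 0" by (rule integral_eq_zero_AE)
    then show ?thesis by simp
  next
    case False
    define \<kappa> where "\<kappa> = cmod c / s"
    have \<kappa>: "\<kappa> > 0" using False s by (simp add: \<kappa>_def)
    \<comment> \<open>The crude bound \<open>ln t \<le> t\<close> still gives an integral of order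
      \<open>\<kappa>\<^sup>2\<close>, and this quadratic dependence on \<open>c\<close> becomes the
      squared correlation.\<close>
    have fle: "ennreal (f y) \<le> ennreal (\<kappa> / cmod y) * indicator (cball 0 \<kappa>) y" if "y \<noteq> 0" for y
    proof (cases "cmod y \<le> \<kappa>")
      case True
      then have "s * cmod y \<le> cmod c" using s by (simp add: \<kappa>_def field_simps)
      then have "f y = ln (\<kappa> / cmod y)"
        using s False that by (simp add: f_def max_def \<kappa>_def ln_div ln_mult)
      also have "\<dots> \<le> \<kappa> / cmod y" using \<kappa> that by (intro ln_bound) auto
      finally show ?thesis using True by (simp add: ennreal_leI)
    next
      case F: False
      then have "s * cmod y > cmod c" using s by (simp add: \<kappa>_def field_simps)
      then have "f y = 0" using s that by (simp add: f_def max_def ln_mult)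
      then show ?thesis by simp
    qed
    have "ennreal (\<integral>y. f y \<partial>cgauss) = (\<integral>\<^sup>+y. ennreal (f y) \<partial>cgauss)"
      by (rule nn_integral_eq_integral[symmetric, OF fi]) (use AE0 f0 in \<open>auto elim!: eventually_mono\<close>)
    also have "\<dots> \<le> (\<integral>\<^sup>+y. ennreal (\<kappa> / cmod y) * indicator (cball 0 \<kappa>) y \<partial>cgauss)"
      by (rule nn_integral_mono_AE) (use AE0 fle in \<open>auto elim!: eventually_mono\<close>)
    also have "\<dots> \<le> ennreal (16 * \<kappa>\<^sup>2)" by (rule nn_integral_cgauss_cball[OF \<kappa>])
    finally show ?thesis by (subst (asm) ennreal_le_iff) (auto simp: \<kappa>_def power_divide)
  qed
  show ?thesis using nonneg upper h by (simp add: g_def)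
qed

lemma abs_mult_le_squares: "\<bar>a * b\<bar> \<le> a\<^sup>2 / 2 + b\<^sup>2 / 2" for a b :: real
  using sum_squares_bound[of "\<bar>a\<bar>" "\<bar>b\<bar>"] by (simp add: abs_mult)

text \<open>If \<open>\<theta>\<close> is small, integrating out the second variable leaves \<open>ln s\<close>, which is orthogonal to the centred
  logarithm, up to an error of order \<open>(cmod \<theta>)\<^sup>2\<close>.\<close>
lemma cgauss_log_covariance:
  obtains C where "C \<ge> 0"
    "\<And>\<theta> s. s \<ge> 0 \<Longrightarrow> (cmod \<theta>)\<^sup>2 + s\<^sup>2 = 1 \<Longrightarrow>
       integrable (cgauss \<Otimes>\<^sub>M cgauss)
         (\<lambda>p. cgauss_log (fst p) * cgauss_log (\<theta> * fst p + of_real s * snd p)) \<and>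
       (\<integral>p. \<bar>cgauss_log (fst p) * cgauss_log (\<theta> * fst p + of_real s * snd p)\<bar> \<partial>(cgauss \<Otimes>\<^sub>M cgauss)) \<le> C \<and>
       \<bar>\<integral>p. cgauss_log (fst p) * cgauss_log (\<theta> * fst p + of_real s * snd p) \<partial>(cgauss \<Otimes>\<^sub>M cgauss)\<bar>
         \<le> C * (cmod \<theta>)\<^sup>2"
proof -
  note l_def = cgauss_log_def
  let ?l = cgauss_log and ?P = "cgauss \<Otimes>\<^sub>M cgauss"
  let ?h = "\<lambda>\<theta> s p. ?l (fst p) * ?l (\<theta> * fst p + of_real s * snd p)"
  have il: "integrable cgauss ?l" unfolding l_def
    by (intro Bochner_Integration.integrable_diff integrable_cgauss_ln) auto
  have l0: "(\<integral>x. ?l x \<partial>cgauss) = 0"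
    unfolding l_def by (subst Bochner_Integration.integral_diff)
      (auto intro: integrable_cgauss_ln simp: cgauss_log_mean_def cgauss.prob_space[simplified])
  have il2: "integrable cgauss (\<lambda>x. (?l x)\<^sup>2)"
    unfolding l_def power2_diff
    by (intro Bochner_Integration.integrable_diff Bochner_Integration.integrable_add
      integrable_cgauss_ln_sq
        integrable_mult_left integrable_mult_right integrable_cgauss_ln) auto
  have i4: "integrable cgauss (\<lambda>x. (cmod x) ^ 4)"
    by (rule integrable_cgauss_bound[where C=1]) auto
  define v where "v = (\<integral>x. (?l x)\<^sup>2 \<partial>cgauss)"
  define w where "w = (\<integral>x. \<bar>?l x\<bar> * (cmod x)\<^sup>2 \<partial>cgauss)"
  have iw: "integrable cgauss (\<lambda>x. \<bar>?l x\<bar> * (cmod x)\<^sup>2)"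
  proof (rule Bochner_Integration.integrable_bound)
    show "integrable cgauss (\<lambda>x. (?l x)\<^sup>2 / 2 + (cmod x) ^ 4 / 2)" using il2 i4 by auto
    show "AE x in cgauss. norm (\<bar>?l x\<bar> * (cmod x)\<^sup>2) \<le> norm ((?l x)\<^sup>2 / 2 + (cmod x) ^ 4 / 2)"
    proof (intro AE_I2)
      fix x show "norm (\<bar>?l x\<bar> * (cmod x)\<^sup>2) \<le> norm ((?l x)\<^sup>2 / 2 + (cmod x) ^ 4 / 2)"
        using abs_mult_le_squares[of "?l x" "(cmod x)\<^sup>2"] by (simp add: abs_mult power_mult[symmetric])
    qed
  qed measurable
  have v: "v \<ge> 0" and w: "w \<ge> 0" unfolding v_def w_def by (auto intro!: integral_nonneg_AE)
  have main: "integrable (?P) (?h \<theta> s) \<and>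
      (\<integral>p. \<bar>?h \<theta> s p\<bar> \<partial>(?P)) \<le> 2 * v + 32 * w \<and>
      \<bar>\<integral>p. ?h \<theta> s p \<partial>(?P)\<bar>
        \<le> (2 * v + 32 * w) * (cmod \<theta>)\<^sup>2"
    if s: "s \<ge> 0" and 1: "(cmod \<theta>)\<^sup>2 + s\<^sup>2 = 1" for \<theta> s
  proof -
    let ?V = "\<lambda>(x, y). \<theta> * x + of_real s * y"
    have V[measurable]: "?V \<in> measurable ?P borel" by measurable
    have dX: "distr ?P borel fst = cgauss"
      using cgauss.distr_pair_fst[of cgauss] cgauss_pair.distr_pair_fst by (simp cong: distr_cong)
    have dV: "distr ?P borel ?V = cgauss" by (rule distr_cgauss_pair[OF 1])
    have tX: "integrable ?P (\<lambda>p. h (fst p))" "(\<integral>p. h (fst p) \<partial>?P) = (\<integral>x. h x \<partial>cgauss)"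
      if "integrable cgauss h" and [measurable]: "h \<in> borel_measurable borel" for h :: "complex \<Rightarrow> real"
      using that(1) by (subst (asm) dX[symmetric], subst (asm) integrable_distr_eq, simp_all)
        (subst (2) dX[symmetric], subst integral_distr, simp_all)
    have tV: "integrable ?P (\<lambda>p. h (?V p))" "(\<integral>p. h (?V p) \<partial>?P) = (\<integral>x. h x \<partial>cgauss)"
      if "integrable cgauss h" and [measurable]: "h \<in> borel_measurable borel" for h :: "complex \<Rightarrow> real"
      using that(1) by (subst (asm) dV[symmetric], subst (asm) integrable_distr_eq, simp_all)
        (subst (2) dV[symmetric], subst integral_distr, simp_all)
    have ib: "integrable ?P (\<lambda>p. (?l (fst p))\<^sup>2 / 2 + (?l (?V p))\<^sup>2 / 2)"
      using tX(1)[OF il2] tV(1)[OF il2] by auto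
    have int: "integrable ?P (\<lambda>p. ?l (fst p) * ?l (?V p))"
    proof (rule Bochner_Integration.integrable_bound[OF ib])
      show "AE p in ?P. norm (?l (fst p) * ?l (?V p)) \<le> norm ((?l (fst p))\<^sup>2 / 2 + (?l (?V p))\<^sup>2 / 2)"
      proof (intro AE_I2)
        fix p show "norm (?l (fst p) * ?l (?V p)) \<le> norm ((?l (fst p))\<^sup>2 / 2 + (?l (?V p))\<^sup>2 / 2)"
          using abs_mult_le_squares[of "?l (fst p)" "?l (?V p)"] by simp
      qed
    qed measurable
    have abs: "(\<integral>p. \<bar>?l (fst p) * ?l (?V p)\<bar> \<partial>?P) \<le> v"
    proof -
      have "(\<integral>p. \<bar>?l (fst p) * ?l (?V p)\<bar> \<partial>?P) \<le> (\<integral>p. (?l (fst p))\<^sup>2 / 2 + (?l (?V p))\<^sup>2 / 2 \<partial>?P)"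
        by (rule integral_mono[OF _ ib abs_mult_le_squares]) (use int in auto)
      also have "\<dots> = v"
        using tX[OF il2] tV[OF il2] by (subst Bochner_Integration.integral_add) (auto simp: v_def)
      finally show ?thesis .
    qed
    have "\<bar>\<integral>p. ?l (fst p) * ?l (?V p) \<partial>?P\<bar> \<le> (2 * v + 32 * w) * (cmod \<theta>)\<^sup>2"
    \<comment> \<open>The origin of the constant: for large \<open>\<theta>\<close> the trivial
      bound \<open>v\<close> is at most \<open>2 * v * (cmod \<theta>)\<^sup>2\<close>; for small
      \<open>\<theta>\<close>, \<open>s\<^sup>2 \<ge> 1 / 2\<close> turns the factor
      \<open>16 / s\<^sup>2\<close> into \<open>32\<close>.\<close>
    proof (cases "(cmod \<theta>)\<^sup>2 \<ge> 1 / 2")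
      case True
      have "\<bar>\<integral>p. ?l (fst p) * ?l (?V p) \<partial>?P\<bar> \<le> v"
        using order_trans[OF integral_abs_bound abs] .
      also have "\<dots> \<le> 2 * v * (cmod \<theta>)\<^sup>2" using mult_left_mono[OF True v] by simp
      also have "\<dots> \<le> (2 * v + 32 * w) * (cmod \<theta>)\<^sup>2" using w by (intro mult_right_mono) auto
      finally show ?thesis .
    next
      case False
      then have s2: "s\<^sup>2 \<ge> 1 / 2" using 1 by simp
      then have s0: "s > 0" using s by (cases "s = 0") auto
      have AEi: "AE x in cgauss. integrable cgauss (\<lambda>y. ln (cmod (\<theta> * x + of_real s * y)))"
      proof -
        have "integrable ?P (\<lambda>p. ln (cmod (?V p)))" by (rule tV(1)[OF integrable_cgauss_ln]) measurable
        then have "AE x in cgauss. integrable cgauss (\<lambda>y. ln (cmod (?V (x, y))))"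
          by (rule cgauss_pair.AE_integrable_fst')
        then show ?thesis by simp
      qed
      define J where "J x = (\<integral>y. ?l (\<theta> * x + of_real s * y) \<partial>cgauss)" for x
      have [measurable]: "J \<in> borel_measurable borel" unfolding J_def by measurable
      have J: "AE x in cgauss. \<bar>J x - ln s\<bar> \<le> 32 * (cmod \<theta>)\<^sup>2 * (cmod x)\<^sup>2"
        using AEi
      proof eventually_elim
        case (elim x)
        have "J x = (\<integral>y. ln (cmod (\<theta> * x + of_real s * y)) \<partial>cgauss) - cgauss_log_mean"
          unfolding J_def l_def using elim
          by (subst Bochner_Integration.integral_diff) (auto simp: cgauss.prob_space[simplified])
        then have "\<bar>J x - ln s\<bar> \<le> 16 * (cmod (\<theta> * x))\<^sup>2 / s\<^sup>2"
          using cgauss_integral_ln_affine[OF s0 elim] by (simp add: algebra_simps)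
        also have "\<dots> \<le> 16 * (cmod (\<theta> * x))\<^sup>2 / (1 / 2)"
          using s2 by (intro divide_left_mono) auto
        finally show ?case by (simp add: norm_mult power_mult_distrib)
      qed
      have iJ: "integrable cgauss (\<lambda>x. ?l x * J x)"
        using cgauss_pair.integrable_fst'[OF int] by (simp add: J_def)
      have "(\<integral>p. ?l (fst p) * ?l (?V p) \<partial>?P) = (\<integral>x. ?l x * J x \<partial>cgauss)"
        using cgauss_pair.integral_fst'[OF int] by (simp add: J_def)
      also have "\<dots> = (\<integral>x. ?l x * J x \<partial>cgauss) - (\<integral>x. ?l x * ln s \<partial>cgauss)"
        using l0 by simp
      also have "\<dots> = (\<integral>x. ?l x * (J x - ln s) \<partial>cgauss)"
        using iJ il by (simp add: right_diff_distrib)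
      also have "\<bar>\<dots>\<bar> \<le> (\<integral>x. \<bar>?l x * (J x - ln s)\<bar> \<partial>cgauss)" by (rule integral_abs_bound)
      also have "\<dots> \<le> (\<integral>x. 32 * (cmod \<theta>)\<^sup>2 * (\<bar>?l x\<bar> * (cmod x)\<^sup>2) \<partial>cgauss)"
      proof (rule integral_mono_AE)
        have "integrable cgauss (\<lambda>x. ?l x * J x - ?l x * ln s)" using iJ il by auto
        then show "integrable cgauss (\<lambda>x. \<bar>?l x * (J x - ln s)\<bar>)" by (simp add: right_diff_distrib)
        show "integrable cgauss (\<lambda>x. 32 * (cmod \<theta>)\<^sup>2 * (\<bar>?l x\<bar> * (cmod x)\<^sup>2))" using iw by auto
        show "AE x in cgauss. \<bar>?l x * (J x - ln s)\<bar> \<le> 32 * (cmod \<theta>)\<^sup>2 * (\<bar>?l x\<bar> * (cmod x)\<^sup>2)"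
          using J
        proof eventually_elim
          case (elim x)
          have "\<bar>?l x * (J x - ln s)\<bar> \<le> \<bar>?l x\<bar> * (32 * (cmod \<theta>)\<^sup>2 * (cmod x)\<^sup>2)"
            unfolding abs_mult by (intro mult_left_mono elim) auto
          then show ?case by (simp add: mult_ac)
        qed
      qed
      also have "\<dots> = 32 * w * (cmod \<theta>)\<^sup>2" by (simp add: w_def)
      also have "\<dots> \<le> (2 * v + 32 * w) * (cmod \<theta>)\<^sup>2" using v by (intro mult_right_mono) auto
      finally show ?thesis .
    qed
    moreover have "v \<le> 2 * v + 32 * w" using v w by simp
    ultimately show ?thesis using int order_trans[OF abs] by (simp add: split_beta')
  qed
  show ?thesis
    by (rule that[of "2 * v + 32 * w"]) (use main v w in auto)
qed

section \<open>Orthogonality and Bessel's inequality on the circle\<close>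

lemma integral_circle_cis:
  assumes "n > 0"
  shows "(\<integral>t. cis (- (real n * t)) \<partial>circle_measure) = 0" "(\<integral>t. cis (real n * t) \<partial>circle_measure) = 0"
proof -
  have "has_bochner_integral circle_measure (\<lambda>t. cis (real n * t)) 0"
    using circle_coeff_const(2)[of n 1 1] assms by (simp add: circle_coeff_def)
  then show *: "(\<integral>t. cis (real n * t) \<partial>circle_measure) = 0" by (simp add: has_bochner_integral_iff)
  have "(\<integral>t. cnj (cis (real n * t)) \<partial>circle_measure) = cnj (\<integral>t. cis (real n * t) \<partial>circle_measure)"
    by simp
  then show "(\<integral>t. cis (- (real n * t)) \<partial>circle_measure) = 0" using * by (simp add: cis_cnj)
qed

text \<open>Orthogonality gives equality for partial sums. Only an upper bound is required in the
  limit, so Fatou's lemma is enough.\<close>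

lemma circle_bessel:
  fixes d :: "nat \<Rightarrow> complex"
  assumes d: "summable (\<lambda>j. cmod (d j))" and d2: "summable (\<lambda>j. (cmod (d j))\<^sup>2)"
  shows "(\<integral>\<^sup>+t. ennreal ((cmod (\<Sum>j. d j * cis (real j * t)))\<^sup>2) \<partial>circle_measure)
      \<le> ennreal (\<Sum>j. (cmod (d j))\<^sup>2)"
proof -
  define S where "S N t = (\<Sum>j<N. d j * cis (real j * t))" for N t
  have [measurable]: "S N \<in> borel_measurable borel" for N unfolding S_def by measurable
  have bd: "cmod (S N t) \<le> (\<Sum>j<N. cmod (d j))" for N t
    unfolding S_def by (rule order_trans[OF norm_sum]) (simp add: norm_mult)
  have iS: "integrable circle_measure (\<lambda>t. g t * S N t)"
    if "g \<in> borel_measurable borel" "\<And>t. cmod (g t) \<le> B" for g B N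
  proof (rule circle_measure.integrable_const_bound[where B="B * (\<Sum>j<N. cmod (d j))"])
    show "AE t in circle_measure. norm (g t * S N t) \<le> B * (\<Sum>j<N. cmod (d j))"
      unfolding norm_mult
      by (intro AE_I2 mult_mono that bd) (use order_trans[OF norm_ge_zero that(2)[of 0]] in auto)
  qed (use that in measurable)
  have icis: "integrable circle_measure (\<lambda>t. c * cis (a * t))" for c a
    by (rule circle_measure.integrable_const_bound[where B="cmod c"]) (auto simp: norm_mult)
  have orth: "(\<integral>t. cis (- (real N * t)) * S N t \<partial>circle_measure) = 0" for N
  proof -
    have "(\<integral>t. cis (- (real N * t)) * S N t \<partial>circle_measure)
        = (\<integral>t. (\<Sum>j<N. d j * cis (- (real (N - j) * t))) \<partial>circle_measure)"
    proof (rule Bochner_Integration.integral_cong)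
      fix t
      have "cis (- (real N * t)) * (d j * cis (real j * t)) = d j * cis (- (real (N - j) * t))"
        if "j < N" for j
        using that by (simp add: cis_mult mult.left_commute of_nat_diff algebra_simps)
      then show "cis (- (real N * t)) * S N t = (\<Sum>j<N. d j * cis (- (real (N - j) * t)))"
        unfolding S_def sum_distrib_left by (intro sum.cong) auto
    qed simp
    also have "\<dots> = (\<Sum>j<N. \<integral>t. d j * cis (- (real (N - j) * t)) \<partial>circle_measure)"
    proof (rule Bochner_Integration.integral_sum)
      fix j show "integrable circle_measure (\<lambda>t. d j * cis (- (real (N - j) * t)))"
        using icis[of "d j" "- real (N - j)"] by (simp only: mult_minus_left)
    qed
    also have "\<dots> = 0"
      by (intro sum.neutral ballI) (simp add: integral_circle_cis(1) del: of_nat_diff)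
    finally show ?thesis .
  qed
  have i2: "integrable circle_measure (\<lambda>t. (cmod (S N t))\<^sup>2)" for N
    by (rule circle_measure.integrable_const_bound[where B="(\<Sum>j<N. cmod (d j))\<^sup>2"])
      (auto intro!: power_mono bd)
  have sq: "(\<integral>t. (cmod (S N t))\<^sup>2 \<partial>circle_measure) = (\<Sum>j<N. (cmod (d j))\<^sup>2)" for N
  proof (induction N)
    case (Suc N)
    define R where "R t = Re (cnj (d N) * (cis (- (real N * t)) * S N t))" for t
    have eq: "(cmod (S (Suc N) t))\<^sup>2 = (cmod (S N t))\<^sup>2 + ((cmod (d N))\<^sup>2 + 2 * R t)" for t
    proof -
      have "(cmod (a + b))\<^sup>2 = (cmod a)\<^sup>2 + (cmod b)\<^sup>2 + 2 * Re (a * cnj b)" for a b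
        by (simp only: cmod_power2) (simp add: power2_eq_square algebra_simps)
      from this[of "S N t" "d N * cis (real N * t)"] show ?thesis
        by (simp only: S_def R_def sum.lessThan_Suc norm_mult norm_cis mult_1_right mult_1_left
          complex_cnj_mult cis_cnj add.assoc mult_ac)
    qed
    have i3: "integrable circle_measure (\<lambda>t. cis (- (real N * t)) * S N t)"
      by (rule iS[where B=1]) auto
    have "(\<integral>t. R t \<partial>circle_measure)
        = Re (\<integral>t. cnj (d N) * (cis (- (real N * t)) * S N t) \<partial>circle_measure)"
      unfolding R_def by (rule integral_Re) (use i3 in auto)
    also have "\<dots> = 0" by (simp add: orth)
    finally have "(\<integral>t. R t \<partial>circle_measure) = 0" .
    moreover have "integrable circle_measure R"
      unfolding R_def by (rule integrable_Re) (use i3 in auto)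
    ultimately show ?case unfolding eq
      using i2[of N] Suc.IH by (simp add: circle_measure.prob_space[simplified])
  qed (simp add: S_def)
  have lim: "(\<lambda>N. S N t) \<longlonglongrightarrow> (\<Sum>j. d j * cis (real j * t))" for t
    unfolding S_def by (rule summable_LIMSEQ, rule summable_norm_cancel) (simp add: norm_mult d)
  have "(\<integral>\<^sup>+t. ennreal ((cmod (\<Sum>j. d j * cis (real j * t)))\<^sup>2) \<partial>circle_measure)
      = (\<integral>\<^sup>+t. liminf (\<lambda>N. ennreal ((cmod (S N t))\<^sup>2)) \<partial>circle_measure)"
    by (intro nn_integral_cong lim_imp_Liminf[symmetric] tendsto_ennrealI tendsto_intros lim) simp
  also have "\<dots> \<le> liminf (\<lambda>N. \<integral>\<^sup>+t. ennreal ((cmod (S N t))\<^sup>2) \<partial>circle_measure)"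
    by (rule nn_integral_liminf) measurable
  also have "\<dots> \<le> ennreal (\<Sum>j. (cmod (d j))\<^sup>2)"
  proof (rule Liminf_le)
    have "(\<integral>\<^sup>+t. ennreal ((cmod (S N t))\<^sup>2) \<partial>circle_measure) \<le> ennreal (\<Sum>j. (cmod (d j))\<^sup>2)" for N
      by (subst nn_integral_eq_integral[OF i2]) (auto simp: sq intro!: ennreal_leI sum_le_suminf d2)
    then show "eventually (\<lambda>N. (\<integral>\<^sup>+t. ennreal ((cmod (S N t))\<^sup>2) \<partial>circle_measure)
        \<le> ennreal (\<Sum>j. (cmod (d j))\<^sup>2)) sequentially"
      by simp
  qed simp
  finally show ?thesis .
qed

section \<open>Second moments of weighted logarithms\<close>

lemma measurable_cnj[measurable]: "cnj \<in> borel_measurable borel"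
  by (intro borel_measurable_continuous_onI continuous_intros)

text \<open>The squared modulus of the \<open>T\<close>-integral is a double integral over
  \<open>T \<Otimes>\<^sub>M T\<close>, and Fubini moves the expectation inside, where the
  covariance is bounded by \<open>\<kappa>\<close>. The uniform bound \<open>C\<close> provides the
  absolute integrability; \<open>\<psi>\<close> only contributes factors of modulus at most
  \<open>1\<close>.\<close>

lemma second_moment_integral_le:
  fixes G :: "'t \<Rightarrow> 'w \<Rightarrow> real" and \<psi> :: "'t \<Rightarrow> complex" and \<kappa> :: "'t \<Rightarrow> 't \<Rightarrow> ennreal"
  assumes "prob_space M" "finite_measure T"
    and G[measurable]: "(\<lambda>(t, \<omega>). G t \<omega>) \<in> borel_measurable (T \<Otimes>\<^sub>M M)"
    and \<psi>[measurable]: "\<psi> \<in> borel_measurable T" and \<psi>1: "\<And>t. cmod (\<psi> t) \<le> 1"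
    and int: "\<And>s t. integrable M (\<lambda>\<omega>. G s \<omega> * G t \<omega>)"
    and C: "\<And>s t. (\<integral>\<omega>. \<bar>G s \<omega> * G t \<omega>\<bar> \<partial>M) \<le> C"
    and \<kappa>: "\<And>s t. s \<in> space T \<Longrightarrow> t \<in> space T \<Longrightarrow> ennreal \<bar>\<integral>\<omega>. G s \<omega> * G t \<omega> \<partial>M\<bar> \<le> \<kappa> s t"
    and \<kappa>m[measurable]: "(\<lambda>(s, t). \<kappa> s t) \<in> borel_measurable (T \<Otimes>\<^sub>M T)"
  shows "AE \<omega> in M. integrable T (\<lambda>t. G t \<omega>)"
    and "(\<integral>\<^sup>+\<omega>. ennreal ((cmod (\<integral>t. \<psi> t * of_real (G t \<omega>) \<partial>T))\<^sup>2) \<partial>M) \<le> (\<integral>\<^sup>+s. \<integral>\<^sup>+t. \<kappa> s t \<partial>T \<partial>T)"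
proof -
  interpret M: prob_space M by fact
  interpret T: finite_measure T by fact
  interpret TM: pair_sigma_finite T M ..
  interpret TT: pair_sigma_finite T T ..
  interpret TTM: pair_sigma_finite "T \<Otimes>\<^sub>M T" M ..
  have Gm: "G t \<in> borel_measurable M" if "t \<in> space T" for t
    using measurable_Pair2[OF G that] by simp
  have Tfin: "emeasure T (space T) < \<top>" using T.emeasure_finite[of "space T"]
    unfolding infinity_ennreal_def by (rule less_top[THEN iffD1])
  have GM[measurable (raw)]: "(\<lambda>x. G (f x) (g x)) \<in> borel_measurable N"
    if "f \<in> measurable N T" "g \<in> measurable N M" for f g N
    using measurable_compose[OF measurable_Pair[OF that] G] by simp
  have abs1: "(\<integral>\<^sup>+\<omega>. ennreal \<bar>G s \<omega> * G t \<omega>\<bar> \<partial>M) \<le> ennreal C" for s t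
    by (subst nn_integral_eq_integral) (auto intro!: ennreal_leI C integrable_abs int)
  have C0: "C \<ge> 0" using order_trans[OF _ C[of undefined undefined]] by (auto intro!: integral_nonneg_AE)
  have "(\<integral>\<^sup>+\<omega>. \<integral>\<^sup>+t. ennreal (norm (G t \<omega>)) \<partial>T \<partial>M) = (\<integral>\<^sup>+t. \<integral>\<^sup>+\<omega>. ennreal \<bar>G t \<omega>\<bar> \<partial>M \<partial>T)"
    by (subst TM.Fubini') auto
  also have "\<dots> \<le> (\<integral>\<^sup>+t. 1 + ennreal C \<partial>T)"
  proof (rule nn_integral_mono)
    fix t assume t: "t \<in> space T"
    have "(\<integral>\<^sup>+\<omega>. ennreal \<bar>G t \<omega>\<bar> \<partial>M) \<le> (\<integral>\<^sup>+\<omega>. 1 + ennreal \<bar>G t \<omega> * G t \<omega>\<bar> \<partial>M)"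
    proof (rule nn_integral_mono)
      fix \<omega>
      have "\<bar>G t \<omega>\<bar> \<le> 1 + \<bar>G t \<omega> * G t \<omega>\<bar>"
        using abs_mult_le_squares[of 1 "G t \<omega>"] zero_le_power2[of "G t \<omega>"]
        by (simp add: abs_mult power2_eq_square)
      then have "ennreal \<bar>G t \<omega>\<bar> \<le> ennreal (1 + \<bar>G t \<omega> * G t \<omega>\<bar>)" by (rule ennreal_leI)
      then show "ennreal \<bar>G t \<omega>\<bar> \<le> 1 + ennreal \<bar>G t \<omega> * G t \<omega>\<bar>" by simp
    qed
    also have "\<dots> = 1 + (\<integral>\<^sup>+\<omega>. ennreal \<bar>G t \<omega> * G t \<omega>\<bar> \<partial>M)"
      using Gm[OF t] by (subst nn_integral_add) (auto simp: M.emeasure_space_1)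
    also have "\<dots> \<le> 1 + ennreal C" by (intro add_left_mono abs1)
    finally show "(\<integral>\<^sup>+\<omega>. ennreal \<bar>G t \<omega>\<bar> \<partial>M) \<le> 1 + ennreal C" .
  qed
  also have "\<dots> < \<infinity>"
    using Tfin by (simp add: ennreal_mult_less_top)
  finally have fin: "(\<integral>\<^sup>+\<omega>. \<integral>\<^sup>+t. ennreal (norm (G t \<omega>)) \<partial>T \<partial>M) \<noteq> \<infinity>" by simp
  have "AE \<omega> in M. (\<integral>\<^sup>+t. ennreal (norm (G t \<omega>)) \<partial>T) \<noteq> \<infinity>"
    by (rule nn_integral_PInf_AE[OF _ fin]) measurable
  then show AEi: "AE \<omega> in M. integrable T (\<lambda>t. G t \<omega>)"
    using AE_space
  proof eventually_elim
    case (elim \<omega>)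
    then show ?case
      using measurable_Pair1[OF G elim(2)] by (intro integrableI_bounded) (auto simp: less_top)
  qed
  define F where "F p \<omega> = \<psi> (fst p) * cnj (\<psi> (snd p)) * of_real (G (fst p) \<omega> * G (snd p) \<omega>)" for p \<omega>
  have Fm[measurable]: "(\<lambda>(p, \<omega>). F p \<omega>) \<in> borel_measurable ((T \<Otimes>\<^sub>M T) \<Otimes>\<^sub>M M)"
    unfolding F_def by measurable
  have Fle: "norm (F (s, t) \<omega>) \<le> \<bar>G s \<omega> * G t \<omega>\<bar>" for s t \<omega>
  proof -
    have "norm (F (s, t) \<omega>) = (cmod (\<psi> s) * cmod (\<psi> t)) * \<bar>G s \<omega> * G t \<omega>\<bar>"
      by (simp add: F_def norm_mult abs_mult)
    also have "\<dots> \<le> (1 * 1) * \<bar>G s \<omega> * G t \<omega>\<bar>" by (intro mult_right_mono mult_mono \<psi>1) auto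
    finally show ?thesis by simp
  qed
  have iF: "integrable ((T \<Otimes>\<^sub>M T) \<Otimes>\<^sub>M M) (\<lambda>(p, \<omega>). F p \<omega>)"
  proof (rule integrableI_bounded)
    have "(\<integral>\<^sup>+q. ennreal (norm (case q of (p, \<omega>) \<Rightarrow> F p \<omega>)) \<partial>((T \<Otimes>\<^sub>M T) \<Otimes>\<^sub>M M))
       = (\<integral>\<^sup>+p. \<integral>\<^sup>+\<omega>. ennreal (norm (F p \<omega>)) \<partial>M \<partial>(T \<Otimes>\<^sub>M T))"
      by (subst M.nn_integral_fst[symmetric]) auto
    also have "\<dots> \<le> (\<integral>\<^sup>+p. ennreal C \<partial>(T \<Otimes>\<^sub>M T))"
    proof (rule nn_integral_mono)
      fix p
      have "(\<integral>\<^sup>+\<omega>. ennreal (norm (F p \<omega>)) \<partial>M) \<le> (\<integral>\<^sup>+\<omega>. ennreal \<bar>G (fst p) \<omega> * G (snd p) \<omega>\<bar> \<partial>M)"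
        using Fle[of "fst p" "snd p"] by (intro nn_integral_mono ennreal_leI) simp
      also have "\<dots> \<le> ennreal C" by (rule abs1)
      finally show "(\<integral>\<^sup>+\<omega>. ennreal (norm (F p \<omega>)) \<partial>M) \<le> ennreal C" .
    qed
    also have "\<dots> = ennreal C * (emeasure T (space T) * emeasure T (space T))"
      by (simp add: space_pair_measure T.emeasure_pair_measure_Times)
    also have "\<dots> < \<infinity>"
      using Tfin by (simp add: ennreal_mult_less_top)
    finally show "(\<integral>\<^sup>+q. ennreal (norm (case q of (p, \<omega>) \<Rightarrow> F p \<omega>)) \<partial>((T \<Otimes>\<^sub>M T) \<Otimes>\<^sub>M M)) < \<infinity>" .
  qed measurable
  define Y where "Y \<omega> = (cmod (\<integral>t. \<psi> t * of_real (G t \<omega>) \<partial>T))\<^sup>2" for \<omega>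
  have AEF: "AE \<omega> in M. integrable (T \<Otimes>\<^sub>M T) (\<lambda>p. F p \<omega>)"
    using TTM.AE_integrable_snd[OF iF] .
  have YF: "AE \<omega> in M. Re (\<integral>p. F p \<omega> \<partial>(T \<Otimes>\<^sub>M T)) = Y \<omega>"
    using AEF AEi
  proof eventually_elim
    case (elim \<omega>)
    let ?I = "\<integral>t. \<psi> t * of_real (G t \<omega>) \<partial>T"
    have "(\<integral>p. F p \<omega> \<partial>(T \<Otimes>\<^sub>M T)) = (\<integral>s. \<integral>t. F (s, t) \<omega> \<partial>T \<partial>T)"
      using TT.integral_fst'[OF elim(1)] by simp
    also have "\<dots> = (\<integral>s. (\<psi> s * of_real (G s \<omega>)) * cnj ?I \<partial>T)"
    proof (rule Bochner_Integration.integral_cong)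
      fix s
      have "(\<integral>t. F (s, t) \<omega> \<partial>T) = (\<integral>t. (\<psi> s * of_real (G s \<omega>)) * cnj (\<psi> t * of_real (G t \<omega>)) \<partial>T)"
        by (intro Bochner_Integration.integral_cong) (auto simp: F_def mult_ac)
      also have "\<dots> = (\<psi> s * of_real (G s \<omega>)) * (\<integral>t. cnj (\<psi> t * of_real (G t \<omega>)) \<partial>T)"
        by (rule integral_mult_right_zero)
      also have "(\<integral>t. cnj (\<psi> t * of_real (G t \<omega>)) \<partial>T) = cnj ?I"
        by (rule Bochner_Integration.integral_cnj)
      finally show "(\<integral>t. F (s, t) \<omega> \<partial>T) = (\<psi> s * of_real (G s \<omega>)) * cnj ?I" .
    qed simp
    also have "\<dots> = ?I * cnj ?I" by (rule integral_mult_left_zero)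
    also have "\<dots> = of_real (Y \<omega>)" by (simp only: Y_def complex_norm_square)
    finally show ?case by simp
  qed
  have iRe: "integrable M (\<lambda>\<omega>. Re (\<integral>p. F p \<omega> \<partial>(T \<Otimes>\<^sub>M T)))"
    by (rule integrable_Re[OF TTM.integrable_snd[OF iF]])
  have "(\<integral>\<^sup>+\<omega>. ennreal (Y \<omega>) \<partial>M) = (\<integral>\<^sup>+\<omega>. ennreal (Re (\<integral>p. F p \<omega> \<partial>(T \<Otimes>\<^sub>M T))) \<partial>M)"
    using YF by (intro nn_integral_cong_AE) (auto elim!: eventually_mono)
  also have "\<dots> = ennreal (\<integral>\<omega>. Re (\<integral>p. F p \<omega> \<partial>(T \<Otimes>\<^sub>M T)) \<partial>M)"
    using YF by (intro nn_integral_eq_integral[OF iRe]) (auto elim!: eventually_mono simp: Y_def)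
  also have "(\<integral>\<omega>. Re (\<integral>p. F p \<omega> \<partial>(T \<Otimes>\<^sub>M T)) \<partial>M) = Re (\<integral>\<omega>. \<integral>p. F p \<omega> \<partial>(T \<Otimes>\<^sub>M T) \<partial>M)"
    by (rule integral_Re[OF TTM.integrable_snd[OF iF]])
  also have "(\<integral>\<omega>. \<integral>p. F p \<omega> \<partial>(T \<Otimes>\<^sub>M T) \<partial>M) = (\<integral>p. \<integral>\<omega>. F p \<omega> \<partial>M \<partial>(T \<Otimes>\<^sub>M T))"
    by (rule TTM.Fubini_integral[OF iF])
  also have "ennreal (Re (\<integral>p. \<integral>\<omega>. F p \<omega> \<partial>M \<partial>(T \<Otimes>\<^sub>M T))) \<le> ennreal (norm (\<integral>p. \<integral>\<omega>. F p \<omega> \<partial>M \<partial>(T \<Otimes>\<^sub>M T)))"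
    by (intro ennreal_leI complex_Re_le_cmod)
  also have "\<dots> \<le> (\<integral>\<^sup>+p. ennreal (norm (\<integral>\<omega>. F p \<omega> \<partial>M)) \<partial>(T \<Otimes>\<^sub>M T))"
    by (rule integral_norm_bound_ennreal) (rule TTM.integrable_fst[OF iF])
  also have "\<dots> \<le> (\<integral>\<^sup>+p. (case p of (s, t) \<Rightarrow> \<kappa> s t) \<partial>(T \<Otimes>\<^sub>M T))"
  proof (rule nn_integral_mono)
    fix p assume "p \<in> space (T \<Otimes>\<^sub>M T)"
    then obtain s t where p: "p = (s, t)" "s \<in> space T" "t \<in> space T" by (auto simp: space_pair_measure)
    have "(\<integral>\<omega>. F p \<omega> \<partial>M) = \<psi> s * cnj (\<psi> t) * of_real (\<integral>\<omega>. G s \<omega> * G t \<omega> \<partial>M)"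
      by (simp add: p F_def del: of_real_mult)
    also have "norm \<dots> \<le> 1 * 1 * \<bar>\<integral>\<omega>. G s \<omega> * G t \<omega> \<partial>M\<bar>"
      unfolding norm_mult norm_of_real complex_mod_cnj by (intro mult_right_mono mult_mono \<psi>1) auto
    finally have "ennreal (norm (\<integral>\<omega>. F p \<omega> \<partial>M)) \<le> ennreal \<bar>\<integral>\<omega>. G s \<omega> * G t \<omega> \<partial>M\<bar>"
      by (intro ennreal_leI) simp
    also have "\<dots> \<le> \<kappa> s t" by (rule \<kappa>[OF p(2,3)])
    finally show "ennreal (norm (\<integral>\<omega>. F p \<omega> \<partial>M)) \<le> (case p of (s, t) \<Rightarrow> \<kappa> s t)" by (simp add: p)
  qed
  also have "\<dots> = (\<integral>\<^sup>+s. \<integral>\<^sup>+t. \<kappa> s t \<partial>T \<partial>T)"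
    by (subst T.nn_integral_fst[symmetric]) auto
  finally show "(\<integral>\<^sup>+\<omega>. ennreal ((cmod (\<integral>t. \<psi> t * of_real (G t \<omega>) \<partial>T))\<^sup>2) \<partial>M) \<le> (\<integral>\<^sup>+s. \<integral>\<^sup>+t. \<kappa> s t \<partial>T \<partial>T)"
    by (simp add: Y_def)
qed

text \<open>A positive measure is wanted for Fubini, so only \<open>\<bar>w r\<bar>\<close> enters;
  the sign of the weight is moved into the phase \<open>\<psi>\<close>.\<close>

definition weight_measure :: "(real \<Rightarrow> real) \<Rightarrow> real measure" where
  "weight_measure w = density lborel (\<lambda>r. ennreal \<bar>w r\<bar>)"

lemma sets_weight_measure[simp, measurable_cong]: "sets (weight_measure w) = sets borel"
  by (simp add: weight_measure_def)

lemma space_weight_measure[simp]: "space (weight_measure w) = UNIV"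
  by (simp add: weight_measure_def)

lemma finite_measure_weight_measure:
  assumes "integrable lborel w"
  shows "finite_measure (weight_measure w)"
proof
  have "emeasure (weight_measure w) (space (weight_measure w)) = (\<integral>\<^sup>+r. ennreal (norm (w r)) \<partial>lborel)"
    using assms by (simp add: weight_measure_def emeasure_density)
  also have "\<dots> < \<infinity>" using assms by (simp add: integrable_iff_bounded)
  finally show "emeasure (weight_measure w) (space (weight_measure w)) \<noteq> \<infinity>" by simp
qed

definition weight_energy :: "real \<Rightarrow> (real \<Rightarrow> real) \<Rightarrow> ennreal" where
  "weight_energy \<alpha> w =
    (\<integral>\<^sup>+r. \<integral>\<^sup>+s. ennreal \<bar>w r\<bar> * ennreal \<bar>w s\<bar> * gef_overlap \<alpha> r s \<partial>lborel \<partial>lborel)"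

text \<open>There is no Jacobian factor \<open>r\<close>: the radial density is
  \<open>\<bar>w r\<bar>\<close> itself.\<close>

definition polar_measure :: "(real \<Rightarrow> real) \<Rightarrow> (real \<times> real) measure" where
  "polar_measure w = weight_measure w \<Otimes>\<^sub>M circle_measure"

definition polar :: "real \<times> real \<Rightarrow> complex" where
  "polar p = of_real (fst p) * cis (snd p)"

lemma measurable_polar[measurable]: "polar \<in> borel_measurable (borel \<Otimes>\<^sub>M borel)"
  unfolding polar_def by measurable

context gef
begin

text \<open>The covariance kernel: the expectation of the series at \<open>w\<close> times its
  conjugate at \<open>z\<close>.\<close>

definition gef_kernel :: "complex \<Rightarrow> complex \<Rightarrow> complex" where
  "gef_kernel z w = (\<Sum>j. of_real (gef_coeff \<alpha> j) * w ^ j * cnj (of_real (gef_coeff \<alpha> j) * z ^ j))"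

text \<open>Dividing by the standard deviation makes the argument a standard Gaussian at every
  point, so the same constant centres the logarithm everywhere.\<close>

definition gef_log :: "complex \<Rightarrow> 'w \<Rightarrow> real" where
  "gef_log z \<omega> = cgauss_log (GEF \<alpha> \<xi> \<omega> z / of_real (sqrt (gef_norm \<alpha> ((cmod z)\<^sup>2))))"

lemma measurable_gef_log[measurable]:
  "(\<lambda>(z, \<omega>). gef_log z \<omega>) \<in> borel_measurable (borel \<Otimes>\<^sub>M M)"
proof -
  have [measurable]: "(\<lambda>(z, \<omega>). GEF \<alpha> \<xi> \<omega> z) \<in> borel_measurable (borel \<Otimes>\<^sub>M M)"
    unfolding GEF_def by measurable
  show ?thesis unfolding gef_log_def by measurable
qed

lemma gef_coeff_norm_sq: "(cmod (of_real (gef_coeff \<alpha> j) * z ^ j))\<^sup>2 = gef_weight \<alpha> j ((cmod z)\<^sup>2)"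
  using gef_coeff_sq[of \<alpha> j]
  by (simp add: norm_mult norm_power power_mult_distrib gef_weight_def power_mult[symmetric]
    mult.commute)

lemma gef_kernel_norm_term:
  "cmod (of_real (gef_coeff \<alpha> j) * w ^ j * cnj (of_real (gef_coeff \<alpha> j) * z ^ j))
      = gef_weight \<alpha> j (cmod w * cmod z)"
proof -
  have "cmod (of_real (gef_coeff \<alpha> j) * w ^ j * cnj (of_real (gef_coeff \<alpha> j) * z ^ j))
      = (gef_coeff \<alpha> j)\<^sup>2 * (cmod w * cmod z) ^ j"
    by (simp add: norm_mult norm_power power_mult_distrib power2_eq_square abs_mult[symmetric])
  then show ?thesis by (simp add: gef_coeff_sq gef_weight_def)
qed

lemma AE_GEF_sums:
  "AE \<omega> in M. \<forall>z. (\<lambda>j. (of_real (gef_coeff \<alpha> j) * z ^ j) * \<xi> j \<omega>) sums GEF \<alpha> \<xi> \<omega> z"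
  using AE_summable_norm
proof eventually_elim
  case (elim \<omega>)
  show ?case
  proof
    fix z
    have "summable (\<lambda>j. cmod ((of_real (gef_coeff \<alpha> j) * z ^ j) * \<xi> j \<omega>))"
      using elim[rule_format, of "cmod z"] gef_coeff_pos[of \<alpha>]
      by (simp add: norm_mult norm_power less_imp_le)
    then show "(\<lambda>j. (of_real (gef_coeff \<alpha> j) * z ^ j) * \<xi> j \<omega>) sums GEF \<alpha> \<xi> \<omega> z"
      unfolding GEF_eq by (rule summable_sums[OF summable_norm_cancel])
  qed
qed

text \<open>In the triangular form of \<open>series_pair_law\<close>, the normalised values at
  \<open>z\<close> and \<open>w\<close> are \<open>x\<close> and \<open>\<theta> * x + s * y\<close>
  with independent standard \<open>x\<close>, \<open>y\<close>. Here
  \<open>(cmod \<theta>)\<^sup>2\<close> is the squared kernel divided by the two variances, so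
  \<open>cgauss_log_covariance\<close> applies.\<close>

lemma gef_log_covariance:
  obtains C where "C \<ge> 0"
    "\<And>z w. integrable M (\<lambda>\<omega>. gef_log z \<omega> * gef_log w \<omega>)"
    "\<And>z w. (\<integral>\<omega>. \<bar>gef_log z \<omega> * gef_log w \<omega>\<bar> \<partial>M) \<le> C"
    "\<And>z w. \<bar>\<integral>\<omega>. gef_log z \<omega> * gef_log w \<omega> \<partial>M\<bar>
       \<le> C * ((cmod (gef_kernel z w))\<^sup>2 / (gef_norm \<alpha> ((cmod z)\<^sup>2) * gef_norm \<alpha> ((cmod w)\<^sup>2)))"
proof -
  let ?l = cgauss_log and ?P = "cgauss \<Otimes>\<^sub>M cgauss"
  let ?h = "\<lambda>\<theta> s p. ?l (fst p) * ?l (\<theta> * fst p + of_real s * snd p)"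
  obtain C where C: "C \<ge> 0" and C': "\<And>\<theta> s. s \<ge> 0 \<Longrightarrow> (cmod \<theta>)\<^sup>2 + s\<^sup>2 = 1 \<Longrightarrow>
       integrable (?P) (?h \<theta> s) \<and>
       (\<integral>p. \<bar>?h \<theta> s p\<bar> \<partial>(?P)) \<le> C \<and>
       \<bar>\<integral>p. ?h \<theta> s p \<partial>(?P)\<bar> \<le> C * (cmod \<theta>)\<^sup>2"
    using cgauss_log_covariance by blast
  have main: "integrable M (\<lambda>\<omega>. gef_log z \<omega> * gef_log w \<omega>) \<and> (\<integral>\<omega>. \<bar>gef_log z \<omega> * gef_log w \<omega>\<bar> \<partial>M) \<le> C
     \<and> \<bar>\<integral>\<omega>. gef_log z \<omega> * gef_log w \<omega> \<partial>M\<bar> \<le> C *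
       ((cmod (gef_kernel z w))\<^sup>2 / (gef_norm \<alpha> ((cmod z)\<^sup>2) * gef_norm \<alpha> ((cmod w)\<^sup>2)))" for z w
  proof -
    define Z where "Z = gef_norm \<alpha> ((cmod z)\<^sup>2)"
    define W where "W = gef_norm \<alpha> ((cmod w)\<^sup>2)"
    have ZW: "Z > 0" "W > 0" unfolding Z_def W_def by (intro gef_norm_pos alpha; simp)+
    let ?u = "\<lambda>j. of_real (gef_coeff \<alpha> j) * z ^ j" and ?v = "\<lambda>j. of_real (gef_coeff \<alpha> j) * w ^ j"
    let ?f = "\<lambda>\<omega>. (GEF \<alpha> \<xi> \<omega> z, GEF \<alpha> \<xi> \<omega> w)"
    let ?D = "distr M (borel \<Otimes>\<^sub>M borel) ?f"
      and ?Q = "\<lambda>a b c. distr ?P (borel \<Otimes>\<^sub>M borel) (\<lambda>(x, y). (of_real a * x, b * x + of_real c * y))"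
    have gm[measurable]: "(\<lambda>\<omega>. GEF \<alpha> \<xi> \<omega> z) \<in> borel_measurable M" for z
      unfolding GEF_def by measurable
    obtain a b c where abc: "a > 0" "c \<ge> 0" "a\<^sup>2 = Z" "a * b = gef_kernel z w" "(cmod b)\<^sup>2 + c\<^sup>2 = W"
       and law: "?D
       = ?Q a b c"
    proof -
      have "\<exists>a b c. a > 0 \<and> c \<ge> 0 \<and> a\<^sup>2 = (\<Sum>j. (cmod (?u j))\<^sup>2) \<and> a * b = (\<Sum>j. ?v j * cnj (?u j)) \<and>
         (cmod b)\<^sup>2 + c\<^sup>2 = (\<Sum>j. (cmod (?v j))\<^sup>2) \<and>
         ?D
           = ?Q a b c"
      proof (rule series_pair_law)
        show "summable (\<lambda>j. (cmod (?u j))\<^sup>2)" "summable (\<lambda>j. (cmod (?v j))\<^sup>2)"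
          unfolding gef_coeff_norm_sq by (rule summable_gef_weight[OF alpha])+
        show "summable (\<lambda>j. ?v j * cnj (?u j))"
          by (rule summable_norm_cancel)
            (unfold gef_kernel_norm_term, rule summable_gef_weight[OF alpha])
        show "AE \<omega> in M. (\<lambda>j. ?u j * \<xi> j \<omega>) sums GEF \<alpha> \<xi> \<omega> z"
          using AE_GEF_sums by eventually_elim blast
        show "AE \<omega> in M. (\<lambda>j. ?v j * \<xi> j \<omega>) sums GEF \<alpha> \<xi> \<omega> w"
          using AE_GEF_sums by eventually_elim blast
      qed (auto intro: gm)
      then show thesis unfolding gef_coeff_norm_sq
        using that by (auto simp: Z_def W_def gef_norm_def gef_kernel_def)
    qed
    have sa: "sqrt Z = a" using abc by (simp flip: abc(3))
    define \<theta> where "\<theta> = b / of_real (sqrt W)"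
    define s where "s = c / sqrt W"
    have s: "s \<ge> 0" using abc ZW by (simp add: s_def)
    have 1: "(cmod \<theta>)\<^sup>2 + s\<^sup>2 = 1"
      using abc(5) ZW by (simp add: \<theta>_def s_def norm_divide power_divide flip: add_divide_distrib)
    have "cmod (gef_kernel z w) = a * cmod b" using abc(1) by (simp add: abc(4)[symmetric] norm_mult)
    then have th: "(cmod \<theta>)\<^sup>2 = (cmod (gef_kernel z w))\<^sup>2 / (Z * W)"
      using ZW(2) abc(1)
      by (simp add: \<theta>_def norm_divide power_divide power_mult_distrib abc(3)[symmetric])
    define H where "H p = ?l (fst p / of_real (sqrt Z)) * ?l (snd p / of_real (sqrt W))" for p
    have Hm[measurable]: "H \<in> borel_measurable (borel \<Otimes>\<^sub>M borel)" unfolding H_def by measurable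
    have HM: "gef_log z \<omega> * gef_log w \<omega> = H (?f \<omega>)" for \<omega>
      by (simp add: H_def gef_log_def Z_def W_def)
    have HG: "H (case p of (x, y) \<Rightarrow> (of_real a * x, b * x + of_real c * y))
        = ?h \<theta> s p" for p
      using abc(1) ZW by (simp add: split_beta' H_def sa \<theta>_def s_def add_divide_distrib)
    have i: "integrable M (\<lambda>\<omega>. gef_log z \<omega> * gef_log w \<omega>)"
    proof -
      have "integrable (?Q a b c) H"
        using C'[OF s 1] by (subst integrable_distr_eq) (auto simp: HG)
      then show ?thesis unfolding law[symmetric] HM by (subst (asm) integrable_distr_eq) auto
    qed
    have e: "(\<integral>\<omega>. h (H (?f \<omega>)) \<partial>M)
        = (\<integral>p. h (?h \<theta> s p) \<partial>(?P))"
      if [measurable]: "h \<in> borel_measurable borel" for h :: "real \<Rightarrow> real"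
    proof -
      have "(\<integral>\<omega>. h (H (?f \<omega>)) \<partial>M)
          = (\<integral>p. h (H p) \<partial>?D)"
        by (subst integral_distr) auto
      also have "\<dots> = (\<integral>p. h (?h \<theta> s p) \<partial>(?P))"
        unfolding law by (subst integral_distr) (auto simp: HG)
      finally show ?thesis .
    qed
    show ?thesis
      using i C'[OF s 1] e[of abs] e[of "\<lambda>x. x"]
      by (simp add: HM th Z_def W_def)
  qed
  show ?thesis by (rule that[OF C]) (use main in blast)+
qed

text \<open>On a circle the kernel is a Fourier series with coefficients of modulus
  \<open>gef_weight \<alpha> j (r * s)\<close>. Their squares factor into the weights at
  \<open>r\<^sup>2\<close> and \<open>s\<^sup>2\<close>, so after normalisation Bessel's inequality
  yields the overlap.\<close>

lemma gef_kernel_circle: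
  assumes r: "r \<ge> 0" "s \<ge> 0"
  shows "(\<integral>\<^sup>+t. ennreal ((cmod (gef_kernel (of_real s * cis t') (of_real r * cis t)))\<^sup>2
      / (gef_norm \<alpha> (s\<^sup>2) * gef_norm \<alpha> (r\<^sup>2))) \<partial>circle_measure)
     \<le> gef_overlap \<alpha> r s"
proof -
  define d where "d j = of_real (gef_weight \<alpha> j (r * s)) * cis (- (real j * t'))" for j
  define N where "N = gef_norm \<alpha> (s\<^sup>2) * gef_norm \<alpha> (r\<^sup>2)"
  have N: "N > 0" unfolding N_def by (intro mult_pos_pos gef_norm_pos alpha) auto
  have nd: "cmod (d j) = gef_weight \<alpha> j (r * s)" for j
    using r gef_weight_nonneg[of "r * s" \<alpha> j] by (simp add: d_def norm_mult)
  have sq: "(cmod (d j))\<^sup>2 = N * (gef_prob \<alpha> j r * gef_prob \<alpha> j s)" for j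
  proof -
    have "(gef_weight \<alpha> j (r * s))\<^sup>2 = gef_weight \<alpha> j (r\<^sup>2) * gef_weight \<alpha> j (s\<^sup>2)"
      by (simp add: gef_weight_def power_mult_distrib power2_eq_square)
    moreover have "gef_norm \<alpha> (r\<^sup>2) \<noteq> 0" "gef_norm \<alpha> (s\<^sup>2) \<noteq> 0" using N by (auto simp: N_def)
    ultimately show ?thesis unfolding nd by (simp add: gef_prob_def N_def)
  qed
  have smp: "summable (\<lambda>j. gef_prob \<alpha> j r * gef_prob \<alpha> j s)"
  proof (rule summable_comparison_test'[OF sums_summable[OF gef_prob_sums[OF alpha, of r]], of 0])
    fix j show "norm (gef_prob \<alpha> j r * gef_prob \<alpha> j s) \<le> gef_prob \<alpha> j r"
      using gef_prob_nonneg[OF alpha] gef_prob_le_1[OF alpha] by (simp add: mult_right_le_one_le)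
  qed
  have k: "gef_kernel (of_real s * cis t') (of_real r * cis t) = (\<Sum>j. d j * cis (real j * t))" for t
    unfolding gef_kernel_def
  proof (rule suminf_cong)
    fix j
    have "of_real (gef_coeff \<alpha> j) * (of_real r * cis t) ^ j
        * cnj (of_real (gef_coeff \<alpha> j) * (of_real s * cis t') ^ j)
        = of_real ((gef_coeff \<alpha> j)\<^sup>2 * (r * s) ^ j) * cis (- (real j * t')) * cis (real j * t)"
      by (simp add: power_mult_distrib Complex.DeMoivre cis_cnj power2_eq_square)
    then show "of_real (gef_coeff \<alpha> j) * (of_real r * cis t) ^ j
        * cnj (of_real (gef_coeff \<alpha> j) * (of_real s * cis t') ^ j) = d j * cis (real j * t)"
      by (simp add: d_def gef_weight_def gef_coeff_sq)
  qed
  have [measurable]: "(\<lambda>t. \<Sum>j. d j * cis (real j * t)) \<in> borel_measurable borel" by measurable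
  have "(\<integral>\<^sup>+t. ennreal ((cmod (gef_kernel (of_real s * cis t') (of_real r * cis t)))\<^sup>2
      / N) \<partial>circle_measure)
      = (\<integral>\<^sup>+t. ennreal (1 / N) * ennreal ((cmod (\<Sum>j. d j * cis (real j * t)))\<^sup>2) \<partial>circle_measure)"
    unfolding k using N by (intro nn_integral_cong) (simp flip: ennreal_mult)
  also have "\<dots> = ennreal (1 / N) * (\<integral>\<^sup>+t. ennreal ((cmod (\<Sum>j. d j * cis (real j * t)))\<^sup>2) \<partial>circle_measure)"
    by (rule nn_integral_cmult) measurable
  also have "\<dots> \<le> ennreal (1 / N) * ennreal (\<Sum>j. (cmod (d j))\<^sup>2)"
  proof (intro mult_left_mono circle_bessel)
    show "summable (\<lambda>j. cmod (d j))" unfolding nd by (rule summable_gef_weight[OF alpha])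
    show "summable (\<lambda>j. (cmod (d j))\<^sup>2)" unfolding sq by (intro summable_mult smp)
  qed simp
  also have "\<dots> = ennreal (1 / N * (N * (\<Sum>j. gef_prob \<alpha> j r * gef_prob \<alpha> j s)))"
    unfolding sq suminf_mult[OF smp] using N
    by (subst ennreal_mult[symmetric])
      (auto intro!: mult_nonneg_nonneg suminf_nonneg smp gef_prob_nonneg[OF alpha])
  also have "\<dots> = gef_overlap \<alpha> r s"
    unfolding gef_overlap_def[OF alpha] using N smp gef_prob_nonneg[OF alpha]
    by (subst suminf_ennreal2) auto
  finally show ?thesis by (simp add: N_def)
qed

text \<open>The constant is fixed before the weight and the phase, as a sequence of weights will be
  used. The weight must vanish at negative radii because \<open>gef_kernel_circle\<close> concerns
  nonnegative ones.\<close>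

lemma weighted_second_moment:
  obtains C where "C \<ge> 0"
    "\<And>w \<psi>. integrable lborel w \<Longrightarrow> (\<And>r. r < 0 \<Longrightarrow> w r = 0) \<Longrightarrow>
      \<psi> \<in> borel_measurable (borel \<Otimes>\<^sub>M borel) \<Longrightarrow> (\<And>p. cmod (\<psi> p) \<le> 1) \<Longrightarrow>
      (AE \<omega> in M. integrable (polar_measure w) (\<lambda>p. gef_log (polar p) \<omega>)) \<and>
      (\<integral>\<^sup>+\<omega>. ennreal ((cmod (\<integral>p. \<psi> p * of_real (gef_log (polar p) \<omega>) \<partial>polar_measure w))\<^sup>2) \<partial>M)
        \<le> ennreal C * weight_energy \<alpha> w"
proof -
  obtain C where C: "C \<ge> 0"
    "\<And>z w. integrable M (\<lambda>\<omega>. gef_log z \<omega> * gef_log w \<omega>)"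
    "\<And>z w. (\<integral>\<omega>. \<bar>gef_log z \<omega> * gef_log w \<omega>\<bar> \<partial>M) \<le> C"
    "\<And>z w. \<bar>\<integral>\<omega>. gef_log z \<omega> * gef_log w \<omega> \<partial>M\<bar>
       \<le> C * ((cmod (gef_kernel z w))\<^sup>2 / (gef_norm \<alpha> ((cmod z)\<^sup>2) * gef_norm \<alpha> ((cmod w)\<^sup>2)))"
    using gef_log_covariance by blast
  show ?thesis
  proof (rule that[OF C(1)])
    fix w :: "real \<Rightarrow> real" and \<psi> :: "real \<times> real \<Rightarrow> complex"
    assume w: "integrable lborel w" and w0: "\<And>r. r < 0 \<Longrightarrow> w r = 0"
      and \<psi>[measurable]: "\<psi> \<in> borel_measurable (borel \<Otimes>\<^sub>M borel)" and \<psi>1: "\<And>p. cmod (\<psi> p) \<le> 1"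
    have [measurable]: "w \<in> borel_measurable borel" using w by simp
    let ?\<nu> = "weight_measure w"
    let ?T = "?\<nu> \<Otimes>\<^sub>M circle_measure"
    interpret \<nu>: finite_measure ?\<nu> by (rule finite_measure_weight_measure[OF w])
    interpret T: pair_sigma_finite ?\<nu> circle_measure ..
    define \<kappa> where "\<kappa> p q = ennreal C * ennreal ((cmod (gef_kernel (polar p) (polar q)))\<^sup>2
        / (gef_norm \<alpha> ((cmod (polar p))\<^sup>2) * gef_norm \<alpha> ((cmod (polar q))\<^sup>2)))" for p q
    have [measurable]: "(\<lambda>(z, w). gef_kernel z w) \<in> borel_measurable (borel \<Otimes>\<^sub>M borel)"
      unfolding gef_kernel_def by measurable
    have \<kappa>m: "(\<lambda>(p, q). \<kappa> p q) \<in> borel_measurable (?T \<Otimes>\<^sub>M ?T)" unfolding \<kappa>_def by measurable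
    have fT: "finite_measure ?T"
    proof
      show "emeasure ?T (space ?T) \<noteq> \<infinity>"
        using \<nu>.emeasure_finite[of UNIV] circle_measure.emeasure_space_1
          circle_measure.emeasure_pair_measure_Times[of UNIV ?\<nu> UNIV]
        by (simp add: space_pair_measure)
    qed
    note sm = second_moment_integral_le
      [where M=M and T="?T" and G="\<lambda>p. gef_log (polar p)" and \<psi>=\<psi> and \<kappa>=\<kappa> and C=C]
    have a: "prob_space M" by unfold_locales
    have b: "(\<lambda>(p, \<omega>). gef_log (polar p) \<omega>) \<in> borel_measurable (?T \<Otimes>\<^sub>M M)" by measurable
    have c: "\<psi> \<in> borel_measurable ?T" by measurable
    have d: "ennreal \<bar>\<integral>\<omega>. gef_log (polar p) \<omega> * gef_log (polar q) \<omega> \<partial>M\<bar> \<le> \<kappa> p q" for p q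
      unfolding \<kappa>_def ennreal_mult'[OF C(1), symmetric] by (rule ennreal_leI[OF C(4)])
    have Km: "(\<lambda>p. \<integral>\<^sup>+q. \<kappa> p q \<partial>?T) \<in> borel_measurable ?T"
      by (rule sigma_finite_measure.borel_measurable_nn_integral[OF finite_measure.axioms(1)[OF fT] \<kappa>m])
    have 1: "AE \<omega> in M. integrable ?T (\<lambda>p. gef_log (polar p) \<omega>)"
      by (rule sm(1)[OF a fT b c \<psi>1 C(2) C(3) d \<kappa>m])
    have 2: "(\<integral>\<^sup>+\<omega>. ennreal ((cmod (\<integral>p. \<psi> p * of_real (gef_log (polar p) \<omega>) \<partial>?T))\<^sup>2) \<partial>M)
        \<le> (\<integral>\<^sup>+p. \<integral>\<^sup>+q. \<kappa> p q \<partial>?T \<partial>?T)"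
      by (rule sm(2)[OF a fT b c \<psi>1 C(2) C(3) d \<kappa>m])
    have inner: "(\<integral>\<^sup>+q. \<kappa> p q \<partial>?T) \<le> ennreal C * (\<integral>\<^sup>+r. ennreal \<bar>w r\<bar> * gef_overlap \<alpha> r (fst p) \<partial>lborel)"
      if p: "fst p \<ge> 0" for p
    proof -
      have [measurable]: "\<kappa> p \<in> borel_measurable ?T" unfolding \<kappa>_def by measurable
      have [measurable]: "(\<lambda>r. gef_overlap \<alpha> r (fst p)) \<in> borel_measurable borel"
        by (intro measurable_gef_overlap[OF alpha]) auto
      have "(\<integral>\<^sup>+q. \<kappa> p q \<partial>?T) = (\<integral>\<^sup>+r. \<integral>\<^sup>+t. \<kappa> p (r, t) \<partial>circle_measure \<partial>?\<nu>)"
        by (subst circle_measure.nn_integral_fst[symmetric]) auto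
      also have "\<dots> = (\<integral>\<^sup>+r. ennreal \<bar>w r\<bar> * (\<integral>\<^sup>+t. \<kappa> p (r, t) \<partial>circle_measure) \<partial>lborel)"
        unfolding weight_measure_def
        by (subst nn_integral_density) (auto intro!: circle_measure.borel_measurable_nn_integral)
      also have "\<dots> \<le> (\<integral>\<^sup>+r. ennreal C * (ennreal \<bar>w r\<bar> * gef_overlap \<alpha> r (fst p)) \<partial>lborel)"
      proof (rule nn_integral_mono)
        fix r
        show "ennreal \<bar>w r\<bar> * (\<integral>\<^sup>+t. \<kappa> p (r, t) \<partial>circle_measure)
            \<le> ennreal C * (ennreal \<bar>w r\<bar> * gef_overlap \<alpha> r (fst p))"
        proof (cases "r \<ge> 0")
          case True
          have "(\<integral>\<^sup>+t. \<kappa> p (r, t) \<partial>circle_measure)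
              = ennreal C *
                (\<integral>\<^sup>+t. ennreal ((cmod (gef_kernel (of_real (fst p) * cis (snd p)) (of_real r * cis t)))\<^sup>2 /
                  (gef_norm \<alpha> ((fst p)\<^sup>2) * gef_norm \<alpha> (r\<^sup>2))) \<partial>circle_measure)"
            unfolding \<kappa>_def by (subst nn_integral_cmult) (auto simp: polar_def split_beta' norm_mult)
          also have "\<dots> \<le> ennreal C * gef_overlap \<alpha> r (fst p)"
            by (intro mult_left_mono gef_kernel_circle True p) simp
          finally have "ennreal \<bar>w r\<bar> * (\<integral>\<^sup>+t. \<kappa> p (r, t) \<partial>circle_measure)
              \<le> ennreal \<bar>w r\<bar> * (ennreal C * gef_overlap \<alpha> r (fst p))"
            by (rule mult_left_mono) simp
          then show ?thesis by (simp only: mult_ac)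
        qed (simp add: w0)
      qed
      also have "\<dots> = ennreal C * (\<integral>\<^sup>+r. ennreal \<bar>w r\<bar> * gef_overlap \<alpha> r (fst p) \<partial>lborel)"
        by (rule nn_integral_cmult) measurable
      finally show ?thesis .
    qed
    have [measurable]: "(\<lambda>(s, r). gef_overlap \<alpha> r s) \<in> borel_measurable (borel \<Otimes>\<^sub>M borel)"
      unfolding split_beta' by (intro measurable_gef_overlap[OF alpha]) auto
    define h where "h s = (\<integral>\<^sup>+r. ennreal \<bar>w r\<bar> * gef_overlap \<alpha> r s \<partial>lborel)" for s
    have [measurable]: "h \<in> borel_measurable borel" unfolding h_def by measurable
    have "(\<integral>\<^sup>+p. \<integral>\<^sup>+q. \<kappa> p q \<partial>?T \<partial>?T) = (\<integral>\<^sup>+s. \<integral>\<^sup>+t. (\<integral>\<^sup>+q. \<kappa> (s, t) q \<partial>?T) \<partial>circle_measure \<partial>?\<nu>)"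
      by (rule circle_measure.nn_integral_fst[symmetric, OF Km])
    also have "\<dots> = (\<integral>\<^sup>+s. ennreal \<bar>w s\<bar> * (\<integral>\<^sup>+t. (\<integral>\<^sup>+q. \<kappa> (s, t) q \<partial>?T) \<partial>circle_measure) \<partial>lborel)"
    proof -
      have "(\<lambda>(s, t). \<integral>\<^sup>+q. \<kappa> (s, t) q \<partial>?T) \<in> borel_measurable (borel \<Otimes>\<^sub>M circle_measure)"
        using Km by (simp add: split_beta' cong: measurable_cong_sets sets_pair_measure_cong)
      from circle_measure.borel_measurable_nn_integral[OF this]
      show ?thesis
        by (subst (1) weight_measure_def, subst nn_integral_density) auto
    qed
    also have "\<dots> \<le> (\<integral>\<^sup>+s. ennreal \<bar>w s\<bar> * (\<integral>\<^sup>+t. ennreal C * h s \<partial>circle_measure) \<partial>lborel)"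
    proof (rule nn_integral_mono)
      fix s
      show "ennreal \<bar>w s\<bar> * (\<integral>\<^sup>+t. (\<integral>\<^sup>+q. \<kappa> (s, t) q \<partial>?T) \<partial>circle_measure)
          \<le> ennreal \<bar>w s\<bar> * (\<integral>\<^sup>+t. ennreal C * h s \<partial>circle_measure)"
      proof (cases "s \<ge> 0")
        case True
        then show ?thesis unfolding h_def
          by (intro mult_left_mono nn_integral_mono) (use inner[of "(s, _)"] in auto)
      qed (simp add: w0)
    qed
    also have "\<dots> = (\<integral>\<^sup>+s. ennreal C * (ennreal \<bar>w s\<bar> * h s) \<partial>lborel)"
      using circle_measure.emeasure_space_1 by (simp add: mult_ac)
    also have "\<dots> = ennreal C * (\<integral>\<^sup>+s. ennreal \<bar>w s\<bar> * h s \<partial>lborel)"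
      by (rule nn_integral_cmult) measurable
    also have "(\<integral>\<^sup>+s. ennreal \<bar>w s\<bar> * h s \<partial>lborel) = weight_energy \<alpha> w"
      unfolding h_def weight_energy_def
      by (subst nn_integral_cmult[symmetric])
         (auto simp: mult.assoc gef_overlap_commute[OF alpha]
           intro!: nn_integral_cong measurable_gef_overlap[OF alpha])
    finally show "(AE \<omega> in M. integrable (polar_measure w) (\<lambda>p. gef_log (polar p) \<omega>)) \<and>
      (\<integral>\<^sup>+\<omega>. ennreal ((cmod (\<integral>p. \<psi> p * of_real (gef_log (polar p) \<omega>) \<partial>polar_measure w))\<^sup>2) \<partial>M)
        \<le> ennreal C * weight_energy \<alpha> w"
      using 1 2 unfolding polar_measure_def by (blast intro: order_trans)
  qed
qed

end

section \<open>Simplicity of the zeros\<close>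

lemma AE_cgauss_countable: "countable A \<Longrightarrow> AE x in cgauss. x \<notin> A"
proof -
  assume A: "countable A"
  have "AE x in lborel. x \<notin> A"
    by (rule AE_not_in) (use A in \<open>auto intro: countable_imp_null_set_lborel\<close>)
  then show ?thesis unfolding cgauss_def by (subst AE_density) (auto elim: eventually_mono)
qed

context gef
begin

text \<open>Given all coefficients but \<open>\<xi> 0\<close>, a double zero forces \<open>- \<xi> 0\<close> to be a critical value of the remaining
  series, and there are only countably many of those.\<close>
definition tail_coeff :: "(nat \<Rightarrow> complex) \<Rightarrow> nat \<Rightarrow> complex" where
  "tail_coeff s j = (if j = 0 then 0 else of_real (gef_coeff \<alpha> j) * s j)"

definition tail_fun :: "(nat \<Rightarrow> complex) \<Rightarrow> complex \<Rightarrow> complex" where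
  "tail_fun s z = (\<Sum>j. tail_coeff s j * z ^ j)"

definition tail_deriv :: "(nat \<Rightarrow> complex) \<Rightarrow> complex \<Rightarrow> complex" where
  "tail_deriv s z = (\<Sum>j. diffs (tail_coeff s) j * z ^ j)"

text \<open>The restriction makes this a point of the product space over \<open>{1..}\<close>, as in
  \<open>nn_integral_indep_xi\<close>. Its value at \<open>0\<close> is \<open>undefined\<close>,
  which \<open>tail_coeff\<close> replaces by \<open>0\<close>.\<close>

definition tail_seq :: "'w \<Rightarrow> nat \<Rightarrow> complex" where
  "tail_seq \<omega> = (\<lambda>i\<in>{1..}. \<xi> i \<omega>)"

text \<open>The condition on \<open>s 1\<close> makes the derivative nonzero at the origin. Hence it
  does not vanish identically, and each disc contains only finitely many critical points.\<close>

definition regular_tail :: "(nat \<Rightarrow> complex) \<Rightarrow> bool" where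
  "regular_tail s \<longleftrightarrow> (\<forall>z. summable (\<lambda>j. tail_coeff s j * z ^ j)) \<and> s 1 \<noteq> 0"

lemma tail_fun_has_derivative:
  assumes "regular_tail s"
  shows "(tail_fun s has_field_derivative tail_deriv s z) (at z)"
  unfolding tail_fun_def[abs_def] tail_deriv_def
  by (rule termdiffs_strong_converges_everywhere) (use assms in \<open>simp add: regular_tail_def\<close>)

lemma tail_deriv_holomorphic:
  assumes "regular_tail s"
  shows "tail_deriv s holomorphic_on UNIV"
proof -
  have "(tail_deriv s has_field_derivative (\<Sum>j. diffs (diffs (tail_coeff s)) j * z ^ j)) (at z)" for z
    unfolding tail_deriv_def[abs_def]
    by (rule termdiffs_strong_converges_everywhere, rule termdiff_converges_all)
       (use assms in \<open>simp add: regular_tail_def\<close>)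
  then show ?thesis
    by (auto simp: holomorphic_on_def field_differentiable_def intro: has_field_derivative_at_within)
qed

lemma tail_deriv_0: "tail_deriv s 0 = of_real (gef_coeff \<alpha> 1) * s 1"
  by (simp add: tail_deriv_def diffs_def tail_coeff_def)

lemma finite_critical_points:
  assumes s: "regular_tail s"
  shows "finite {z \<in> cball 0 R. tail_deriv s z = 0}"
proof (cases "tail_deriv s constant_on UNIV")
  case True
  then obtain c where c: "\<And>z. tail_deriv s z = c" by (auto simp: constant_on_def)
  have "tail_deriv s 0 \<noteq> 0"
    using s gef_coeff_pos[of \<alpha> 1] by (simp add: tail_deriv_0 regular_tail_def)
  then have "{z \<in> cball 0 R. tail_deriv s z = 0} = {}" using c by auto
  then show ?thesis by (simp only: finite.emptyI)
next
  case False
  show ?thesis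
    by (rule holomorphic_compact_finite_zeros[OF tail_deriv_holomorphic[OF s]]) (use False in auto)
qed

lemma measurable_tail_coeff[measurable]:
  "(\<lambda>p. tail_coeff (fst p) j) \<in> borel_measurable (PiM {1..} (\<lambda>_. borel) \<Otimes>\<^sub>M N)"
proof (cases "j = 0")
  case False
  then have "(\<lambda>p. fst p j) \<in> borel_measurable (PiM {1..} (\<lambda>_. borel) \<Otimes>\<^sub>M N)"
    by (intro measurable_compose[OF measurable_fst measurable_component_singleton]) auto
  then show ?thesis using False by (simp add: tail_coeff_def)
qed (simp add: tail_coeff_def)

lemma measurable_tail_fun[measurable]:
  "(\<lambda>p. tail_fun (fst p) z) \<in> borel_measurable (PiM {1..} (\<lambda>_. borel) \<Otimes>\<^sub>M N)"
  "(\<lambda>p. tail_deriv (fst p) z) \<in> borel_measurable (PiM {1..} (\<lambda>_. borel) \<Otimes>\<^sub>M N)"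
  unfolding tail_fun_def tail_deriv_def diffs_def by measurable

text \<open>The existential over a dense set approximates the existence of a common zero of \<open>x + tail_fun s\<close>
  and its derivative by a measurable condition.\<close>
definition near_double_zero :: "complex set \<Rightarrow> real \<Rightarrow> (nat \<Rightarrow> complex) \<times> complex \<Rightarrow> bool" where
  "near_double_zero Q R p \<longleftrightarrow> (\<forall>n::nat. \<exists>q\<in>Q \<inter> ball 0 R.
     cmod (snd p + tail_fun (fst p) q) < 1 / real (Suc n)
     \<and> cmod (tail_deriv (fst p) q) < 1 / real (Suc n))"

text \<open>Approximate double zeros accumulate in the closed disc by compactness, and by continuity
  a limit point is a critical point with value \<open>- x\<close>.\<close>

lemma near_double_zero_imp:
  assumes s: "regular_tail s" and near: "near_double_zero Q R (s, x)"
  shows "x \<in> (\<lambda>z. - tail_fun s z) ` {z \<in> cball 0 R. tail_deriv s z = 0}"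
proof -
  have "\<forall>n. \<exists>q. q \<in> ball 0 R \<and> cmod (x + tail_fun s q) < 1 / real (Suc n)
      \<and> cmod (tail_deriv s q) < 1 / real (Suc n)"
    using near unfolding near_double_zero_def fst_conv snd_conv by blast
  then obtain q where q: "\<And>n. q n \<in> ball 0 R"
    "\<And>n. cmod (x + tail_fun s (q n)) < 1 / real (Suc n)"
    "\<And>n. cmod (tail_deriv s (q n)) < 1 / real (Suc n)"
    by metis
  have "\<forall>n. q n \<in> cball 0 R" using q(1) by (auto intro: less_imp_le)
  then obtain z r where z: "z \<in> cball 0 R" "strict_mono (r :: nat \<Rightarrow> nat)" "(q \<circ> r) \<longlonglongrightarrow> z"
    using compact_cball[of "0::complex" R] unfolding compact_def by blast
  have lim0: "(\<lambda>n. 1 / real (Suc (r n))) \<longlonglongrightarrow> 0"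
    using LIMSEQ_subseq_LIMSEQ[OF lim_1_over_n[THEN LIMSEQ_Suc] z(2)] by (simp add: o_def)
  have c1: "isCont (tail_fun s) z" using tail_fun_has_derivative[OF s] by (rule DERIV_isCont)
  have c2: "isCont (tail_deriv s) z"
    using holomorphic_on_imp_continuous_on[OF tail_deriv_holomorphic[OF s]]
    by (simp add: continuous_on_eq_continuous_at)
  have "(\<lambda>n. x + tail_fun s (q (r n))) \<longlonglongrightarrow> x + tail_fun s z"
    using isCont_tendsto_compose[OF c1 z(3)] by (auto intro!: tendsto_intros simp: o_def)
  moreover have "(\<lambda>n. x + tail_fun s (q (r n))) \<longlonglongrightarrow> 0"
    by (rule tendsto_norm_zero_cancel, rule tendsto_sandwich[OF _ _ tendsto_const lim0])
       (use q(2) in \<open>auto intro!: always_eventually less_imp_le\<close>)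
  ultimately have "x + tail_fun s z = 0" by (rule LIMSEQ_unique)
  moreover have "tail_deriv s z = 0"
  proof -
    have "(\<lambda>n. tail_deriv s (q (r n))) \<longlonglongrightarrow> tail_deriv s z"
      using isCont_tendsto_compose[OF c2 z(3)] by (simp add: o_def)
    moreover have "(\<lambda>n. tail_deriv s (q (r n))) \<longlonglongrightarrow> 0"
      by (rule tendsto_norm_zero_cancel, rule tendsto_sandwich[OF _ _ tendsto_const lim0])
         (use q(3) in \<open>auto intro!: always_eventually less_imp_le\<close>)
    ultimately show ?thesis by (rule LIMSEQ_unique)
  qed
  ultimately show ?thesis using z(1) by (auto simp: image_iff add_eq_0_iff2 intro!: exI[of _ z])
qed

text \<open>Each approximation condition holds on an open neighbourhood of \<open>z\<close>, which
  meets the dense set.\<close>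

lemma double_zero_imp_near:
  assumes s: "regular_tail s" and dense: "\<And>X::complex set. open X \<Longrightarrow> X \<noteq> {} \<Longrightarrow> \<exists>d\<in>Q. d \<in> X"
    and z: "z \<in> ball 0 R" "x + tail_fun s z = 0" "tail_deriv s z = 0"
  shows "near_double_zero Q R (s, x)"
  unfolding near_double_zero_def
proof
  fix n
  define X where "X = ball 0 R \<inter> {q. cmod (x + tail_fun s q) < 1 / real (Suc n)}
    \<inter> {q. cmod (tail_deriv s q) < 1 / real (Suc n)}"
  have c: "continuous_on UNIV (tail_fun s)" "continuous_on UNIV (tail_deriv s)"
    using DERIV_isCont[OF tail_fun_has_derivative[OF s]]
      holomorphic_on_imp_continuous_on[OF tail_deriv_holomorphic[OF s]]
    by (auto simp: continuous_on_eq_continuous_at)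
  have "open X" unfolding X_def
    by (intro open_Int open_ball open_Collect_less continuous_intros c)
  moreover have "z \<in> X" using z by (simp add: X_def)
  ultimately obtain d where "d \<in> Q" "d \<in> X" using dense by blast
  then show "\<exists>q\<in>Q \<inter> ball 0 R. cmod (snd (s, x) + tail_fun (fst (s, x)) q) < 1 / real (Suc n)
      \<and> cmod (tail_deriv (fst (s, x)) q) < 1 / real (Suc n)"
    by (auto simp: X_def)
qed

lemma AE_regular_tail: "AE \<omega> in M. regular_tail (tail_seq \<omega>)"
proof -
  have "AE \<omega> in M. \<xi> 1 \<omega> \<noteq> 0"
  proof -
    have "AE x in distr M borel (\<xi> 1). x \<noteq> 0"
      unfolding distr_xi using AE_cgauss_countable[of "{0}"] by simp
    then show ?thesis by (subst (asm) AE_distr_iff) auto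
  qed
  then show ?thesis using AE_summable_norm
  proof eventually_elim
    case (elim \<omega>)
    have "summable (\<lambda>j. tail_coeff (tail_seq \<omega>) j * z ^ j)" for z
    proof (rule summable_comparison_test'[OF elim(2)[rule_format, of "cmod z"], of 0])
      fix j
      show "norm (tail_coeff (tail_seq \<omega>) j * z ^ j) \<le> gef_coeff \<alpha> j * cmod z ^ j * cmod (\<xi> j \<omega>)"
        using gef_coeff_pos[of \<alpha> j] by (simp add: tail_coeff_def tail_seq_def norm_mult norm_power)
    qed
    then show ?case using elim(1) by (simp add: regular_tail_def tail_seq_def)
  qed
qed

lemma GEF_eq_tail:
  assumes "regular_tail (tail_seq \<omega>)"
  shows "GEF \<alpha> \<xi> \<omega> z = \<xi> 0 \<omega> + tail_fun (tail_seq \<omega>) z"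
proof -
  have sm: "summable (\<lambda>j. tail_coeff (tail_seq \<omega>) j * z ^ j)" using assms by (simp add: regular_tail_def)
  have eq: "tail_coeff (tail_seq \<omega>) (Suc j) * z ^ Suc j
      = (of_real (gef_coeff \<alpha> (Suc j)) * z ^ Suc j) * \<xi> (Suc j) \<omega>" for j
    by (simp add: tail_coeff_def tail_seq_def mult_ac)
  have "summable (\<lambda>j. (of_real (gef_coeff \<alpha> (Suc j)) * z ^ Suc j) * \<xi> (Suc j) \<omega>)"
    using summable_ignore_initial_segment[OF sm, of 1] by (simp only: eq Suc_eq_plus1[symmetric])
  then have sm': "summable (\<lambda>j. (of_real (gef_coeff \<alpha> j) * z ^ j) * \<xi> j \<omega>)"
    by (subst (asm) summable_Suc_iff)
  have "tail_fun (tail_seq \<omega>) z = (\<Sum>j. tail_coeff (tail_seq \<omega>) (Suc j) * z ^ Suc j)"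
    using suminf_split_head[OF sm] by (simp add: tail_fun_def tail_coeff_def)
  also have "\<dots> = GEF \<alpha> \<xi> \<omega> z - \<xi> 0 \<omega>"
    using suminf_split_head[OF sm'] by (simp only: eq) (simp add: GEF_eq)
  finally show ?thesis by simp
qed

lemma AE_simple_zeros:
  "AE \<omega> in M. GEF \<alpha> \<xi> \<omega> holomorphic_on UNIV \<and> (\<forall>z. GEF \<alpha> \<xi> \<omega> z = 0 \<longrightarrow> deriv (GEF \<alpha> \<xi> \<omega>) z \<noteq> 0)"
proof -
  obtain Q :: "complex set" where Q: "countable Q" "\<And>X. open X \<Longrightarrow> X \<noteq> {} \<Longrightarrow> \<exists>d\<in>Q. d \<in> X"
    by (rule countable_dense_setE[where 'a=complex]) blast
  let ?S = "PiM {1..} (\<lambda>_. borel :: complex measure)"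
  let ?N = "\<lambda>m. {p. near_double_zero Q (real m) p}"
  \<comment> \<open>With the tail frozen, the bad values of \<open>\<xi> 0\<close> for the disc of
    radius \<open>m\<close> lie in a finite set, which is null for \<open>cgauss\<close>;
    independence then integrates out the tail. Integer radii exhaust the plane.\<close>
  have null: "AE \<omega> in M. \<not> near_double_zero Q (real m) (tail_seq \<omega>, \<xi> 0 \<omega>)" for m :: nat
  proof -
    have cq: "countable (Q \<inter> ball 0 (real m))" using Q(1) by auto
    have pm: "Measurable.pred (?S \<Otimes>\<^sub>M borel) (near_double_zero Q (real m))"
      unfolding near_double_zero_def[abs_def]
      by (intro pred_intros_countable(1) measurable_pred_countable(2)[OF cq] pred_intros_logic
        borel_measurable_pred_less) measurable
    then have Fm[measurable]: "(\<lambda>p. indicator (?N m) p :: ennreal) \<in> borel_measurable (?S \<Otimes>\<^sub>M borel)"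
      by measurable
    have tm[measurable]: "tail_seq \<in> measurable M ?S" unfolding tail_seq_def[abs_def] by measurable
    have "(\<integral>\<^sup>+\<omega>. indicator (?N m) (tail_seq \<omega>, \<xi> 0 \<omega>) \<partial>M)
        = (\<integral>\<^sup>+\<omega>. \<integral>\<^sup>+t. indicator (?N m) (tail_seq \<omega>, t) \<partial>cgauss \<partial>M)"
      unfolding tail_seq_def by (rule nn_integral_indep_xi(1)[OF _ Fm]) simp
    also have "\<dots> = (\<integral>\<^sup>+\<omega>. 0 \<partial>M)"
    proof (rule nn_integral_cong_AE)
      show "AE \<omega> in M. (\<integral>\<^sup>+t. indicator (?N m) (tail_seq \<omega>, t) \<partial>cgauss) = (0::ennreal)"
        using AE_regular_tail
      proof eventually_elim
        case (elim \<omega>)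
        have "AE t in cgauss.
            t \<notin> (\<lambda>z. - tail_fun (tail_seq \<omega>) z) ` {z \<in> cball 0 (real m). tail_deriv (tail_seq \<omega>) z = 0}"
          by (intro AE_cgauss_countable countable_finite finite_imageI finite_critical_points elim)
        then have "AE t in cgauss. indicator (?N m) (tail_seq \<omega>, t) = (0::ennreal)"
          by eventually_elim (use near_double_zero_imp[OF elim] in \<open>auto simp: indicator_def\<close>)
        then have "(\<integral>\<^sup>+t. indicator (?N m) (tail_seq \<omega>, t) \<partial>cgauss) = (\<integral>\<^sup>+t. 0 \<partial>cgauss)"
          by (rule nn_integral_cong_AE)
        then show ?case by simp
      qed
    qed
    finally have "(\<integral>\<^sup>+\<omega>. indicator (?N m) (tail_seq \<omega>, \<xi> 0 \<omega>) \<partial>M) = 0" by simp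
    then have "AE \<omega> in M. indicator (?N m) (tail_seq \<omega>, \<xi> 0 \<omega>) = (0::ennreal)"
      by (subst (asm) nn_integral_0_iff_AE) measurable
    then show ?thesis by eventually_elim (auto simp: indicator_def split: if_splits)
  qed
  then have "AE \<omega> in M. \<forall>m::nat. \<not> near_double_zero Q (real m) (tail_seq \<omega>, \<xi> 0 \<omega>)"
    by (simp add: AE_all_countable)
  then show ?thesis using AE_regular_tail
  proof eventually_elim
    case (elim \<omega>)
    have eq: "GEF \<alpha> \<xi> \<omega> = (\<lambda>z. \<xi> 0 \<omega> + tail_fun (tail_seq \<omega>) z)"
      using GEF_eq_tail[OF elim(2)] by auto
    have d: "(GEF \<alpha> \<xi> \<omega> has_field_derivative tail_deriv (tail_seq \<omega>) z) (at z)" for z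
      unfolding eq using tail_fun_has_derivative[OF elim(2), of z] by (auto intro!: derivative_eq_intros)
    have "deriv (GEF \<alpha> \<xi> \<omega>) z \<noteq> 0" if z: "GEF \<alpha> \<xi> \<omega> z = 0" for z
    proof
      assume "deriv (GEF \<alpha> \<xi> \<omega>) z = 0"
      then have 0: "tail_deriv (tail_seq \<omega>) z = 0" using DERIV_imp_deriv[OF d] by simp
      obtain m :: nat where m: "cmod z < real m" using reals_Archimedean2 by blast
      have "near_double_zero Q (real m) (tail_seq \<omega>, \<xi> 0 \<omega>)"
        by (rule double_zero_imp_near[OF elim(2) Q(2), of z]) (use m z 0 in \<open>auto simp: eq\<close>)
      then show False using elim(1) by blast
    qed
    moreover have "GEF \<alpha> \<xi> \<omega> holomorphic_on UNIV"
      using d by (auto simp: holomorphic_on_def field_differentiable_def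
        intro: has_field_derivative_at_within)
    ultimately show ?case by blast
  qed
qed

end

section \<open>Linear statistics of the zeros\<close>

text \<open>Simplicity excludes the zero function, so a constant \<open>f\<close> has no zeros at
  all.\<close>

lemma finite_simple_zeros:
  assumes f: "f holomorphic_on UNIV" and simple: "\<And>z. f z = 0 \<Longrightarrow> deriv f z \<noteq> 0"
  shows "finite {z \<in> cball 0 R. f z = 0}"
proof (cases "f constant_on UNIV")
  case True
  then obtain c where c: "f = (\<lambda>_. c)" by (auto simp: constant_on_def)
  have "c \<noteq> 0"
  proof
    assume "c = 0"
    then show False using simple[of 0] by (simp add: c)
  qed
  then show ?thesis by (simp add: c)
next
  case False
  show ?thesis
    by (rule holomorphic_compact_finite_zeros[OF f]) (use False in auto)
qed

lemma integrable_weight_mult: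
  fixes w h :: "real \<Rightarrow> real"
  assumes w: "integrable lborel w" and supp: "\<And>r. r \<notin> {R0..R1} \<Longrightarrow> w r = 0"
    and h: "continuous_on {R0..R1} h"
  shows "integrable lborel (\<lambda>r. w r * h r)"
proof -
  have [measurable]: "w \<in> borel_measurable borel" using w by simp
  obtain B where "\<forall>x\<in>h ` {R0..R1}. norm x \<le> B"
    using compact_imp_bounded[OF compact_continuous_image[OF h compact_Icc]] unfolding bounded_iff
    by blast
  then have B: "\<And>r. r \<in> {R0..R1} \<Longrightarrow> \<bar>h r\<bar> \<le> B" by simp
  have "(\<lambda>r. w r * h r) = (\<lambda>r. w r * (indicator {R0..R1} r *\<^sub>R h r))"
    using supp by (auto simp: indicator_def fun_eq_iff)
  moreover have "(\<lambda>r. indicator {R0..R1} r *\<^sub>R h r) \<in> borel_measurable borel"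
    by (rule borel_measurable_continuous_on_indicator[OF _ h]) simp
  ultimately have m: "(\<lambda>r. w r * h r) \<in> borel_measurable lborel" by simp
  show ?thesis
  proof (rule Bochner_Integration.integrable_bound[OF _ m])
    show "integrable lborel (\<lambda>r. B * w r)" using w by simp
    show "AE r in lborel. norm (w r * h r) \<le> norm (B * w r)"
    proof (intro AE_I2)
      fix r
      show "norm (w r * h r) \<le> norm (B * w r)"
      proof (cases "r \<in> {R0..R1}")
        case True
        then have "\<bar>w r\<bar> * \<bar>h r\<bar> \<le> \<bar>w r\<bar> * \<bar>B\<bar>" using B[OF True] by (intro mult_left_mono) auto
        then show ?thesis by (simp add: abs_mult mult.commute)
      qed (simp add: supp)
    qed
  qed
qed

text \<open>The first moment condition annihilates both the zero-free part of the function and the zeros beyond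
  \<open>R1\<close>; the second normalises the test function on the disc of radius \<open>R0\<close>.\<close>
definition admissible_weight :: "nat \<Rightarrow> real \<Rightarrow> real \<Rightarrow> (real \<Rightarrow> real) \<Rightarrow> bool" where
  "admissible_weight k R0 R1 w \<longleftrightarrow>
    0 < R0 \<and> R0 \<le> R1 \<and> integrable lborel w \<and> (\<forall>r. r \<notin> {R0..R1} \<longrightarrow> w r = 0) \<and>
    (\<integral>r. w r * r ^ k \<partial>lborel) = 0 \<and> (\<integral>r. w r * log_kernel k r 0 \<partial>lborel) = 1"

text \<open>The average of the Jensen coefficient of \<open>ln (cmod (z - a))\<close> over the
  radii, as a function of the zero \<open>a\<close>.\<close>

definition test_fun :: "nat \<Rightarrow> (real \<Rightarrow> real) \<Rightarrow> complex \<Rightarrow> complex" where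
  "test_fun k w a = a ^ k * of_real (\<integral>r. w r * log_kernel k r (cmod a) \<partial>lborel)"

lemma continuous_log_kernel: "0 < R0 \<Longrightarrow> continuous_on {R0..R1} (\<lambda>r. log_kernel k r \<rho>)"
proof -
  assume "0 < R0"
  then have "max r \<rho> \<noteq> 0" if "r \<in> {R0..R1}" for r using that by (auto simp: max_def)
  then show ?thesis unfolding log_kernel_def
    by (cases "k = 0") (auto intro!: continuous_intros)
qed

context gef
begin

text \<open>\<open>circle_coeff_ln_holomorphic\<close> is integrated against \<open>w\<close>; radii
  that meet a zero form a null set. The constants that normalise and centre \<open>gef_log\<close>
  are radial, so they have no frequency \<open>k > 0\<close> and survive only for
  \<open>k = 0\<close>.\<close>

lemma linear_statistic_eq:
  fixes w :: "real \<Rightarrow> real" and k :: nat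
  assumes hol: "GEF \<alpha> \<xi> \<omega> holomorphic_on UNIV"
    and simple: "\<And>z. GEF \<alpha> \<xi> \<omega> z = 0 \<Longrightarrow> deriv (GEF \<alpha> \<xi> \<omega>) z \<noteq> 0"
    and adm: "admissible_weight k R0 R1 w"
    and int: "integrable (polar_measure w) (\<lambda>p. gef_log (polar p) \<omega>)"
  shows "(\<integral>p. (of_real (sgn (w (fst p))) * cis (real k * snd p))
      * of_real (gef_log (polar p) \<omega>) \<partial>polar_measure w)
     = (\<Sum>a\<in>{a \<in> cball 0 R1. GEF \<alpha> \<xi> \<omega> a = 0}. test_fun k w a)
       - of_real (if k = 0 then \<integral>r. w r * (ln (sqrt (gef_norm \<alpha> (r\<^sup>2))) + cgauss_log_mean) \<partial>lborel
         else 0)"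
proof -
  have R: "0 < R0" "R0 \<le> R1" and w: "integrable lborel w" and supp: "\<And>r. r \<notin> {R0..R1} \<Longrightarrow> w r = 0"
    and w0: "(\<integral>r. w r * r ^ k \<partial>lborel) = 0"
    using adm by (auto simp: admissible_weight_def)
  let ?f = "GEF \<alpha> \<xi> \<omega>"
  let ?B = "{a \<in> cball 0 R1. ?f a = 0}"
  let ?\<nu> = "weight_measure w"
  let ?T = "polar_measure w"
  have wm[measurable]: "w \<in> borel_measurable borel" using w by simp
  interpret \<nu>: finite_measure ?\<nu> by (rule finite_measure_weight_measure[OF w])
  interpret T: pair_sigma_finite ?\<nu> circle_measure ..
  \<comment> \<open>The radius \<open>R1 + 1\<close> leaves room around the circle of radius
    \<open>R1\<close>. The additional zeros beyond \<open>R1\<close> are removed at the end, where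
    their test function vanishes.\<close>
  define A where "A = {z \<in> ball 0 (R1 + 1). ?f z = 0}"
  have finA: "finite A"
    by (rule finite_subset[OF _ finite_simple_zeros[OF hol simple, of "R1 + 1"]]) (auto simp: A_def)
  obtain C :: complex where C: "\<And>r. 0 < r \<Longrightarrow> r < R1 + 1 \<Longrightarrow> r \<notin> cmod ` A \<Longrightarrow>
     circle_coeff k (\<lambda>z. ln (cmod (?f z))) r (C * r ^ k + (\<Sum>a\<in>A. a ^ k * log_kernel k r (cmod a)))"
  proof (rule circle_coeff_ln_holomorphic[of ?f "R1 + 1" A])
    show "?f holomorphic_on ball 0 (R1 + 1)" using hol by (rule holomorphic_on_subset) simp
  qed (use finA simple in \<open>auto simp: A_def\<close>)
  define e where "e r = ln (sqrt (gef_norm \<alpha> (r\<^sup>2))) + cgauss_log_mean" for r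
  define I where "I r = (\<integral>t. cis (real k * t) * of_real (gef_log (of_real r * cis t) \<omega>) \<partial>circle_measure)"
    for r
  have I: "I r = C * r ^ k + (\<Sum>a\<in>A. a ^ k * log_kernel k r (cmod a))
      - of_real (if k = 0 then e r else 0)"
    if r: "r \<in> {R0..R1}" "r \<notin> cmod ` A" for r
  proof -
    have r0: "0 < r" "r < R1 + 1" using r R by auto
    have gn: "gef_norm \<alpha> (r\<^sup>2) > 0" by (rule gef_norm_pos[OF alpha]) simp
    have "circle_coeff k (\<lambda>z. - e r) r (- of_real (if k = 0 then e r else 0))"
      using circle_coeff_const(1)[of "- e r" r] circle_coeff_const(2)[of k r "- e r"] r0 by auto
    from circle_coeff_add[OF C[OF r0 r(2)] this]
    have "circle_coeff k (\<lambda>z. gef_log z \<omega>) r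
        (C * r ^ k + (\<Sum>a\<in>A. a ^ k * log_kernel k r (cmod a)) + - of_real (if k = 0 then e r else 0))"
    proof (rule circle_coeff_cong[OF _ r0(1)])
      fix z :: complex assume z: "cmod z = r"
      have "?f z \<noteq> 0" using z r r0 by (auto simp: A_def)
      then show "ln (cmod (?f z)) + - e r = gef_log z \<omega>"
        using gn by (simp add: gef_log_def cgauss_log_def e_def z norm_divide ln_div)
    qed
    then show ?thesis by (simp add: I_def circle_coeff_def has_bochner_integral_iff mult.commute)
  qed
  define \<psi> where "\<psi> p = of_real (sgn (w (fst p))) * cis (real k * snd p)" for p
  have \<psi>m[measurable]: "\<psi> \<in> borel_measurable (borel \<Otimes>\<^sub>M borel)" unfolding \<psi>_def by measurable
  note T_def = polar_measure_def
  have ic: "integrable (?\<nu> \<Otimes>\<^sub>M circle_measure) (\<lambda>p. \<psi> p * of_real (gef_log (polar p) \<omega>))"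
    unfolding T_def[symmetric]
  proof (rule Bochner_Integration.integrable_bound[OF int])
    show "(\<lambda>p. \<psi> p * of_real (gef_log (polar p) \<omega>)) \<in> borel_measurable ?T"
      using borel_measurable_integrable[OF int] unfolding T_def by measurable
    show "AE p in ?T. norm (\<psi> p * of_real (gef_log (polar p) \<omega>)) \<le> norm (gef_log (polar p) \<omega>)"
      by (intro AE_I2) (auto simp: \<psi>_def norm_mult sgn_real_def)
  qed
  have Im: "(\<lambda>r. of_real (sgn (w r)) * I r) \<in> borel_measurable borel"
    using borel_measurable_integrable[OF T.integrable_fst'[OF ic]]
    by (simp add: \<psi>_def I_def polar_def mult.assoc cong: measurable_cong_sets)
  let ?g = "\<lambda>r. of_real (w r * r ^ k) * C + (\<Sum>a\<in>A. a ^ k * of_real (w r * log_kernel k r (cmod a)))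
      - complex_of_real (if k = 0 then w r * e r else 0)"
  have "(\<integral>p. \<psi> p * of_real (gef_log (polar p) \<omega>) \<partial>?T)
     = (\<integral>r. \<integral>t. \<psi> (r, t) * of_real (gef_log (of_real r * cis t) \<omega>) \<partial>circle_measure \<partial>?\<nu>)"
    using T.integral_fst'[OF ic] by (simp add: polar_measure_def polar_def)
  also have "\<dots> = (\<integral>r. of_real (sgn (w r)) * I r \<partial>?\<nu>)"
    by (simp add: \<psi>_def I_def mult.assoc)
  also have "\<dots> = (\<integral>r. \<bar>w r\<bar> *\<^sub>R (of_real (sgn (w r)) * I r) \<partial>lborel)"
    using Im unfolding weight_measure_def by (subst integral_density) auto
  also have "\<dots> = (\<integral>r. ?g r \<partial>lborel)"
  proof (rule integral_cong_AE)
    have "AE r in lborel. r \<notin> cmod ` A"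
      by (rule AE_not_in) (use finA in \<open>auto intro!: finite_imp_null_set_lborel\<close>)
    then show "AE r in lborel. \<bar>w r\<bar> *\<^sub>R (of_real (sgn (w r)) * I r) = ?g r"
    proof eventually_elim
      case (elim r)
      show ?case
      proof (cases "r \<in> {R0..R1}")
        case True
        have eq: "\<bar>w r\<bar> *\<^sub>R (of_real (sgn (w r)) * I r) = of_real (w r) * I r"
          by (simp add: scaleR_conv_of_real sgn_real_def flip: mult.assoc of_real_mult)
        show ?thesis unfolding eq unfolding I[OF True elim]
          by (cases "k = 0") (simp_all add: algebra_simps sum_distrib_left)
      qed (simp add: supp)
    qed
    show "(\<lambda>r. \<bar>w r\<bar> *\<^sub>R (of_real (sgn (w r)) * I r)) \<in> borel_measurable lborel"
      using Im by measurable
    have [measurable]: "e \<in> borel_measurable borel" unfolding e_def by measurable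
    have [measurable]: "(\<lambda>r. log_kernel k r \<rho>) \<in> borel_measurable borel" for \<rho>
      unfolding log_kernel_def by measurable
    show "(\<lambda>r. ?g r) \<in> borel_measurable lborel"
      by measurable
  qed
  also have "\<dots> = of_real (\<integral>r. w r * r ^ k \<partial>lborel) * C + (\<Sum>a\<in>A. test_fun k w a)
      - of_real (if k = 0 then \<integral>r. w r * e r \<partial>lborel else 0)"
  proof -
    have i1: "integrable lborel (\<lambda>r. w r * r ^ k)"
      by (rule integrable_weight_mult[OF w supp]) (auto intro!: continuous_intros)
    have i2: "integrable lborel (\<lambda>r. w r * log_kernel k r \<rho>)" for \<rho>
      by (rule integrable_weight_mult[OF w supp continuous_log_kernel[OF R(1)]])
    have ce: "continuous_on {R0..R1} e"
    proof -
      have "continuous_on UNIV (gef_norm \<alpha>)"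
        using DERIV_isCont[OF gef_norm_deriv(1)[OF alpha]] by (simp add: continuous_on_eq_continuous_at)
      then have "continuous_on {R0..R1} (\<lambda>r. gef_norm \<alpha> (r\<^sup>2))"
        by (rule continuous_on_compose2) (auto intro!: continuous_intros)
      then show ?thesis unfolding e_def
        using gef_norm_pos[OF alpha] by (intro continuous_intros) (auto simp: less_imp_neq[THEN not_sym])
    qed
    have i3: "integrable lborel (\<lambda>r. w r * e r)"
      by (rule integrable_weight_mult[OF w supp ce])
    have j1: "integrable lborel (\<lambda>r. of_real (w r * r ^ k) * C)" using i1 by (simp del: of_real_mult)
    have j2: "integrable lborel (\<lambda>r. \<Sum>a\<in>A. a ^ k * complex_of_real (w r * log_kernel k r (cmod a)))"
      using i2 by (intro Bochner_Integration.integrable_sum integrable_mult_right)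
        (simp del: of_real_mult)
    have j3: "integrable lborel (\<lambda>r. complex_of_real (if k = 0 then w r * e r else 0))"
      using i3 by (cases "k = 0") (simp_all del: of_real_mult)
    have "(\<integral>r. ?g r \<partial>lborel)
       = (\<integral>r. of_real (w r * r ^ k) * C \<partial>lborel) +
         (\<integral>r. (\<Sum>a\<in>A. a ^ k * complex_of_real (w r * log_kernel k r (cmod a))) \<partial>lborel) -
           (\<integral>r. complex_of_real (if k = 0 then w r * e r else 0) \<partial>lborel)"
      using j1 j2 j3
      by (simp only: Bochner_Integration.integral_diff Bochner_Integration.integral_add
        Bochner_Integration.integrable_add)
    also have "(\<integral>r. of_real (w r * r ^ k) * C \<partial>lborel) = of_real (\<integral>r. w r * r ^ k \<partial>lborel) * C"
      by (simp del: of_real_mult)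
    also have "(\<integral>r. (\<Sum>a\<in>A. a ^ k * complex_of_real (w r * log_kernel k r (cmod a))) \<partial>lborel)
        = (\<Sum>a\<in>A. test_fun k w a)"
      unfolding test_fun_def using i2
      by (subst Bochner_Integration.integral_sum)
        (auto simp del: of_real_mult intro!: integrable_mult_right)
    also have "(\<integral>r. complex_of_real (if k = 0 then w r * e r else 0) \<partial>lborel)
        = of_real (if k = 0 then \<integral>r. w r * e r \<partial>lborel else 0)"
      by (cases "k = 0") (simp_all del: of_real_mult)
    finally show ?thesis .
  qed
  also have "(\<Sum>a\<in>A. test_fun k w a) = (\<Sum>a\<in>?B. test_fun k w a)"
  proof (rule sum.mono_neutral_right[OF finA])
    show "?B \<subseteq> A" by (auto simp: A_def)
    show "\<forall>a\<in>A - ?B. test_fun k w a = 0"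
    proof
      fix a assume "a \<in> A - ?B"
      then have a: "cmod a > R1" by (auto simp: A_def)
      define c where "c = (if k = 0 then ln (cmod a) else - (1 / cmod a ^ (2 * k)) / (2 * real k))"
      have weq: "w r * log_kernel k r (cmod a) = w r * r ^ k * c" for r
      proof (cases "r \<in> {R0..R1}")
        case True
        then have "max r (cmod a) = cmod a" using a by auto
        then show ?thesis by (simp add: log_kernel_def c_def)
      qed (simp add: supp)
      have "(\<integral>r. w r * log_kernel k r (cmod a) \<partial>lborel) = (\<integral>r. w r * r ^ k * c \<partial>lborel)"
        by (simp only: weq)
      then show "test_fun k w a = 0" by (simp add: test_fun_def w0)
    qed
  qed
  finally show ?thesis by (simp add: w0 \<psi>_def e_def)
qed

end

text \<open>On the support of the weight \<open>r \<ge> R0 \<ge> cmod a\<close>, so the kernel does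
  not see \<open>cmod a\<close> and the second moment condition gives the factor
  \<open>1\<close>.\<close>

lemma test_fun_inner:
  assumes adm: "admissible_weight k R0 R1 w" and a: "cmod a \<le> R0"
  shows "test_fun k w a = a ^ k"
proof -
  have R: "0 < R0" and supp: "\<And>r. r \<notin> {R0..R1} \<Longrightarrow> w r = 0"
    and w1: "(\<integral>r. w r * log_kernel k r 0 \<partial>lborel) = 1"
    using adm by (auto simp: admissible_weight_def)
  have weq: "w r * log_kernel k r (cmod a) = w r * log_kernel k r 0" for r
  proof (cases "r \<in> {R0..R1}")
    case True
    then have "max r (cmod a) = max r 0" using a R by auto
    then show ?thesis by (simp add: log_kernel_def)
  qed (simp add: supp)
  show ?thesis unfolding test_fun_def weq w1 by simp
qed

lemma measurable_test_fun[measurable]: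
  assumes [measurable]: "w \<in> borel_measurable borel"
  shows "test_fun k w \<in> borel_measurable borel"
  unfolding test_fun_def log_kernel_def by measurable

section \<open>Measurability of linear statistics\<close>

lemma space_config_space: "space (config_space A) = loc_fin_configs A"
  by (simp add: config_space_def space_measure_of_conv)

lemma sets_config_space: "sets (config_space A) = sigma_sets (loc_fin_configs A)
     {{X \<in> loc_fin_configs A. card (X \<inter> B) = n} | B n. B \<in> sets borel \<and> bounded B}"
  unfolding config_space_def by (rule sets_measure_of) auto

lemma measurable_card_config:
  assumes "B \<in> sets borel" "bounded B"
  shows "(\<lambda>X. card (X \<inter> B)) \<in> measurable (config_space A) (count_space UNIV)"
proof -
  have "(\<lambda>X. card (X \<inter> B)) -` {n} \<inter> space (config_space A) \<in> sets (config_space A)" for n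
  proof -
    have "(\<lambda>X. card (X \<inter> B)) -` {n} \<inter> space (config_space A) = {X \<in> loc_fin_configs A. card (X \<inter> B) = n}"
      by (auto simp: space_config_space)
    then show ?thesis unfolding sets_config_space using assms by (intro sigma_sets.Basic) auto
  qed
  then show ?thesis by (simp add: measurable_count_space_eq2_countable)
qed

text \<open>Only counting maps are measurable by construction. For a function with finite range the
  sum is a linear combination of counts on its level sets in the disc; in general, approximate
  pointwise, the sums being finite.\<close>

lemma measurable_config_sum:
  fixes \<phi> :: "complex \<Rightarrow> complex"
  assumes \<phi>: "\<phi> \<in> borel_measurable borel"
  shows "(\<lambda>X. \<Sum>a\<in>X \<inter> cball 0 R. \<phi> a) \<in> borel_measurable (config_space A)"
proof -
  obtain F where F: "\<And>i. simple_function borel (F i)" "\<And>x. (\<lambda>i. F i x) \<longlonglongrightarrow> \<phi> x"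
    using borel_measurable_implies_sequence_metric[OF \<phi>, of 0] by (auto simp: space_borel)
  have fin: "finite (X \<inter> cball 0 R)" if "X \<in> loc_fin_configs A" for X
    using that by (simp add: loc_fin_configs_def)
  show ?thesis
  proof (rule borel_measurable_LIMSEQ_metric)
    fix X assume "X \<in> space (config_space A)"
    show "(\<lambda>i. \<Sum>a\<in>X \<inter> cball 0 R. F i a) \<longlonglongrightarrow> (\<Sum>a\<in>X \<inter> cball 0 R. \<phi> a)"
      by (intro tendsto_sum F)
  next
    fix i
    have fr: "finite (range (F i))" using F(1)[of i] by (simp add: simple_function_def)
    have m: "F i -` {y} \<in> sets borel" for y
      using F(1)[of i]
      by (auto simp: simple_function_def intro:
        measurable_sets[OF borel_measurable_simple_function[OF F(1)], of "{y}", simplified])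
    have "(\<Sum>a\<in>X \<inter> cball 0 R. F i a) = (\<Sum>y\<in>range (F i). of_nat (card (X \<inter> (cball 0 R \<inter> F i -` {y}))) * y)"
      if "X \<in> space (config_space A)" for X
    proof -
      have "(\<Sum>a\<in>X \<inter> cball 0 R. F i a) = (\<Sum>y\<in>range (F i). \<Sum>a\<in>{a \<in> X \<inter> cball 0 R. F i a = y}. F i a)"
        by (rule sum.group[symmetric]) (use fin that fr in \<open>auto simp: space_config_space\<close>)
      also have "\<dots> = (\<Sum>y\<in>range (F i). of_nat (card (X \<inter> (cball 0 R \<inter> F i -` {y}))) * y)"
      proof (rule sum.cong[OF refl])
        fix y
        have "(\<Sum>a\<in>{a \<in> X \<inter> cball 0 R. F i a = y}. F i a) = (\<Sum>a\<in>X \<inter> (cball 0 R \<inter> F i -` {y}). y)"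
          by (rule sum.cong) auto
        then show "(\<Sum>a\<in>{a \<in> X \<inter> cball 0 R. F i a = y}. F i a)
            = of_nat (card (X \<inter> (cball 0 R \<inter> F i -` {y}))) * y"
          by simp
      qed
      finally show ?thesis .
    qed
    moreover have "(\<lambda>X. \<Sum>y\<in>range (F i). of_nat (card (X \<inter> (cball 0 R \<inter> F i -` {y}))) * y)
        \<in> borel_measurable (config_space A)"
    proof (intro borel_measurable_sum borel_measurable_times borel_measurable_const)
      fix y
      have "cball 0 R \<inter> F i -` {y} \<in> sets borel" using m by (intro sets.Int) auto
      then have "(\<lambda>X. card (X \<inter> (cball 0 R \<inter> F i -` {y})))
          \<in> measurable (config_space A) (count_space UNIV)"
        by (rule measurable_card_config) (auto intro: bounded_subset[OF bounded_cball])
      then show "(\<lambda>X. of_nat (card (X \<inter> (cball 0 R \<inter> F i -` {y}))) :: complex)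
          \<in> borel_measurable (config_space A)"
        by (rule measurable_compose) simp
    qed
    ultimately show "(\<lambda>X. \<Sum>a\<in>X \<inter> cball 0 R. F i a) \<in> borel_measurable (config_space A)"
      by (subst measurable_cong) auto
  qed
qed

section \<open>Weights of small energy\<close>

text \<open>In the variable \<open>ln r\<close> the weight is \<open>- 1 / l\<^sup>2\<close> on an interval of length \<open>l\<close> and \<open>1 / l\<^sup>2\<close> on the next
  one, so its total variation is \<open>2 / l\<close>; overlaps are at most \<open>1\<close>.\<close>
lemma weight_exists_0:
  fixes R0 \<epsilon> \<alpha> :: real
  assumes alpha: "\<alpha> > 0" and R0: "R0 > 0" and eps: "\<epsilon> > 0"
  shows "\<exists>w R1. admissible_weight 0 R0 R1 w \<and> weight_energy \<alpha> w \<le> ennreal \<epsilon>"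
proof -
  \<comment> \<open>With \<open>l = 2 / \<delta>\<close> the total variation \<open>2 / l\<close> is
    \<open>\<delta>\<close>, and the energy is at most \<open>\<delta>\<^sup>2\<close>. The minimum
    with \<open>1\<close> makes this at most \<open>\<epsilon>\<close>.\<close>
  define \<delta> where "\<delta> = min 1 \<epsilon>"
  define l where "l = 2 / \<delta>"
  have \<delta>: "0 < \<delta>" "\<delta> \<le> 1" "\<delta> \<le> \<epsilon>" using eps by (auto simp: \<delta>_def)
  have l: "l > 0" using \<delta> by (simp add: l_def)
  define b c where "b = R0 * exp l" and "c = R0 * exp (2 * l)"
  have abc: "0 < b" "R0 \<le> b" "b \<le> c" using R0 l by (auto simp: b_def c_def)
  have ln: "ln b = ln R0 + l" "ln c = ln R0 + 2 * l" using R0 by (simp_all add: b_def c_def ln_mult)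
  define w where "w r = 1 / l\<^sup>2 * (1 / r * indicator {b..c} r - 1 / r * indicator {R0..b} r)"
    for r :: real
  have J: "has_bochner_integral lborel (\<lambda>r. 1 / r * indicator {x..y} r) (ln y - ln x)" if "0 < x" "x \<le> y"
    for x y :: real
    by (rule has_bochner_integral_FTC_Icc_real)
      (use that in \<open>auto intro!: derivative_eq_intros continuous_intros\<close>)
  have L: "has_bochner_integral lborel (\<lambda>r. (ln r / r) * indicator {x..y} r) ((ln y)\<^sup>2 / 2 - (ln x)\<^sup>2 / 2)"
    if "0 < x" "x \<le> y" for x y :: real
    by (rule has_bochner_integral_FTC_Icc_real)
      (use that in \<open>auto intro!: derivative_eq_intros continuous_intros\<close>)
  have hw: "has_bochner_integral lborel w (1 / l\<^sup>2 * ((ln c - ln b) - (ln b - ln R0)))"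
    unfolding w_def
    by (intro has_bochner_integral_mult_right has_bochner_integral_diff J) (use abc R0 in auto)
  have w0: "(\<integral>r. w r * r ^ 0 \<partial>lborel) = 0"
    using has_bochner_integral_integral_eq[OF hw] by (simp add: ln)
  have supp: "w r = 0" if "r \<notin> {R0..c}" for r using that abc by (auto simp: w_def indicator_def)
  have "has_bochner_integral lborel (\<lambda>r. 1 / l\<^sup>2
      * ((ln r / r) * indicator {b..c} r - (ln r / r) * indicator {R0..b} r))
     (1 / l\<^sup>2 * (((ln c)\<^sup>2 / 2 - (ln b)\<^sup>2 / 2) - ((ln b)\<^sup>2 / 2 - (ln R0)\<^sup>2 / 2)))"
    by (intro has_bochner_integral_mult_right has_bochner_integral_diff L) (use abc R0 in auto)
  moreover have "1 / l\<^sup>2 * ((ln r / r) * indicator {b..c} r - (ln r / r) * indicator {R0..b} r)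
      = w r * log_kernel 0 r 0" for r
  proof (cases "r \<in> {R0..c}")
    case True
    then have "max r 0 = r" using R0 by auto
    then show ?thesis by (simp add: w_def log_kernel_def algebra_simps)
  qed (use abc in \<open>auto simp: w_def indicator_def\<close>)
  moreover have "1 / l\<^sup>2 * (((ln c)\<^sup>2 / 2 - (ln b)\<^sup>2 / 2) - ((ln b)\<^sup>2 / 2 - (ln R0)\<^sup>2 / 2)) = 1"
    using l by (simp add: ln power2_eq_square field_simps)
  ultimately have "has_bochner_integral lborel (\<lambda>r. w r * log_kernel 0 r 0) 1"
    by (simp only:)
  then have w1: "(\<integral>r. w r * log_kernel 0 r 0 \<partial>lborel) = 1"
    by (rule has_bochner_integral_integral_eq)
  have [measurable]: "w \<in> borel_measurable borel" unfolding w_def by measurable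
  have n: "(\<integral>\<^sup>+r. ennreal \<bar>w r\<bar> \<partial>lborel) \<le> ennreal \<delta>"
  proof -
    let ?v = "\<lambda>r. 1 / l\<^sup>2 * (1 / r * indicator {b..c} r + 1 / r * indicator {R0..b} r)"
    have "has_bochner_integral lborel ?v (1 / l\<^sup>2 * ((ln c - ln b) + (ln b - ln R0)))"
      by (intro has_bochner_integral_mult_right has_bochner_integral_add J) (use abc R0 in auto)
    moreover have "1 / l\<^sup>2 * ((ln c - ln b) + (ln b - ln R0)) = \<delta>"
      using l \<delta> by (simp add: ln l_def power2_eq_square)
    ultimately have h: "has_bochner_integral lborel ?v \<delta>" by simp
    have nn: "0 \<le> ?v r" for r
      using abc R0 by (auto simp: indicator_def)
    have "\<bar>w r\<bar> \<le> ?v r" for r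
      unfolding w_def abs_mult using abc R0 by (intro mult_mono) (auto simp: indicator_def)
    then have "(\<integral>\<^sup>+r. ennreal \<bar>w r\<bar> \<partial>lborel) \<le> (\<integral>\<^sup>+r. ennreal (?v r) \<partial>lborel)"
      by (intro nn_integral_mono ennreal_leI)
    also have "\<dots> = ennreal (\<integral>r. ?v r \<partial>lborel)"
      by (rule nn_integral_eq_integral) (use h nn in \<open>auto simp only: has_bochner_integral_iff AE_I2\<close>)
    also have "\<dots> = ennreal \<delta>"
      by (simp only: has_bochner_integral_integral_eq[OF h])
    finally show ?thesis .
  qed
  have "weight_energy \<alpha> w
      \<le> (\<integral>\<^sup>+r. \<integral>\<^sup>+s. ennreal \<bar>w r\<bar> * ennreal \<bar>w s\<bar> * 1 \<partial>lborel \<partial>lborel)"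
    unfolding weight_energy_def by (intro nn_integral_mono mult_left_mono gef_overlap_le_1 alpha) auto
  also have "\<dots> = (\<integral>\<^sup>+r. ennreal \<bar>w r\<bar> \<partial>lborel) * (\<integral>\<^sup>+s. ennreal \<bar>w s\<bar> \<partial>lborel)"
    by (simp add: nn_integral_cmult nn_integral_multc)
  also have "\<dots> \<le> ennreal \<delta> * ennreal \<delta>" by (intro mult_mono n) auto
  also have "\<dots> \<le> ennreal \<epsilon>"
    using \<delta> mult_mono[of \<delta> 1 \<delta> \<epsilon>] by (simp flip: ennreal_mult add: ennreal_leI)
  finally show ?thesis using R0 abc w0 w1 supp hw
    by (intro exI[of _ w] exI[of _ c]) (auto simp: admissible_weight_def has_bochner_integral_iff)
qed

text \<open>The weight is \<open>- c r ^ (k - 1)\<close> on \<open>[R0, b]\<close>, balanced by a multiple of \<open>r ^ (k - 1)\<close> on \<open>[b, d]\<close> to meet the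
  first moment condition. Since \<open>c\<close> is about \<open>2 k / l\<close> and the energy of \<open>r ^ (k - 1)\<close> grows only linearly in
  \<open>l\<close>, the total energy is of order \<open>1 / l\<close>.\<close>
lemma weight_exists_pos:
  fixes R0 \<epsilon> \<alpha> :: real
  assumes alpha: "\<alpha> > 0" and R0: "R0 > 0" and eps: "\<epsilon> > 0" and k: "k \<ge> 1" "real k * \<alpha> \<le> 1"
  shows "\<exists>w R1. admissible_weight k R0 R1 w \<and> weight_energy \<alpha> w \<le> ennreal \<epsilon>"
proof -
  define K :: real where "K = fact (k - 1) powr \<alpha> / 2"
  have K: "K > 0" by (simp add: K_def)
  have k0: "real k > 0" using k by simp
  \<comment> \<open>The energy will be bounded by
    \<open>32 * (real k)\<^sup>2 * K / (l - 1)\<close>. The summand \<open>3\<close> gives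
    \<open>l + 1 \<le> 2 * (l - 1)\<close>, which is used to reach that form.\<close>
  define l where "l = 3 + 32 * (real k)\<^sup>2 * K / \<epsilon>"
  have l3: "l \<ge> 3" using K eps by (simp add: l_def)
  define b d where "b = R0 * exp l" and "d = R0 * exp (l + 1)"
  have abd: "0 < b" "R0 \<le> b" "b < d" using R0 l3 by (auto simp: b_def d_def)
  have ln: "ln b = ln R0 + l" "ln d = ln R0 + (l + 1)" using R0 by (simp_all add: b_def d_def ln_mult)
  \<comment> \<open>The solution of the first moment condition. As \<open>d = exp 1 * b\<close>, one
    unit of logarithmic length already outweighs all of \<open>[R0, b]\<close>, so
    \<open>\<beta> \<le> 1\<close>.\<close>
  define \<beta> where "\<beta> = (b ^ (2 * k) - R0 ^ (2 * k)) / (d ^ (2 * k) - b ^ (2 * k))"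
  have pos: "d ^ (2 * k) - b ^ (2 * k) > 0" using abd k by (simp add: power_strict_mono)
  have \<beta>0: "\<beta> \<ge> 0" unfolding \<beta>_def using pos abd R0
    by (intro divide_nonneg_pos) (auto intro!: power_mono)
  have \<beta>1: "\<beta> \<le> 1"
  proof -
    have "exp (1::real) \<ge> 2" using exp_ge_add_one_self[of 1] by simp
    then have "(2::real) ^ 1 \<le> exp 1 ^ (2 * k)"
      using k power_mono[of 2 "exp (1::real)" "2 * k"] power_increasing[of 1 "2 * k" "2::real"]
      by linarith
    then have "2 * b ^ (2 * k) \<le> exp 1 ^ (2 * k) * b ^ (2 * k)" using abd by (intro mult_right_mono) auto
    also have "\<dots> = d ^ (2 * k)" by (simp add: d_def b_def exp_add power_mult_distrib)
    finally have "b ^ (2 * k) - R0 ^ (2 * k) \<le> d ^ (2 * k) - b ^ (2 * k)"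
      using zero_le_power[of R0 "2 * k"] R0 by linarith
    then show ?thesis using pos by (simp add: \<beta>_def)
  qed
  \<comment> \<open>The solution of the second condition: against \<open>log_kernel k r 0\<close>
    the weight integrates to \<open>c / (2 * real k) * (l - \<beta>)\<close>.\<close>
  define c where "c = 2 * real k / (l - \<beta>)"
  have c0: "c \<ge> 0" using l3 \<beta>1 by (simp add: c_def)
  have c1: "c \<le> 2 * real k / (l - 1)" unfolding c_def using l3 \<beta>1 by (intro divide_left_mono) auto
  define w where "w r = c * (\<beta> * (r ^ (k - 1) * indicator {b..d} r) - r ^ (k - 1) * indicator {R0..b} r)"
    for r :: real
  have kk: "r ^ (k - 1) * r ^ k = r ^ (2 * k - 1)" for r :: real using k
    by (simp add: mult_2 flip: power_add)
  have P: "has_bochner_integral lborel (\<lambda>r. r ^ (2 * k - 1) * indicator {x..y} r)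
      (y ^ (2 * k) / (2 * real k) - x ^ (2 * k) / (2 * real k))" if "x \<le> y" for x y :: real
    by (rule has_bochner_integral_FTC_Icc_real)
      (use that k in \<open>auto intro!: derivative_eq_intros continuous_intros\<close>)
  have J: "has_bochner_integral lborel (\<lambda>r. 1 / r * indicator {x..y} r) (ln y - ln x)" if "0 < x" "x \<le> y"
    for x y :: real
    by (rule has_bochner_integral_FTC_Icc_real)
      (use that in \<open>auto intro!: derivative_eq_intros continuous_intros\<close>)
  have Q: "has_bochner_integral lborel (\<lambda>r. r ^ (k - 1) * indicator {x..y} r)
      (y ^ k / real k - x ^ k / real k)" if "x \<le> y" for x y :: real
    by (rule has_bochner_integral_FTC_Icc_real)
      (use that k in \<open>auto intro!: derivative_eq_intros continuous_intros\<close>)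
  have "has_bochner_integral lborel w (c * (\<beta> * (d ^ k / real k - b ^ k / real k)
      - (b ^ k / real k - R0 ^ k / real k)))"
    unfolding w_def
    by (intro has_bochner_integral_mult_right has_bochner_integral_diff Q) (use abd in auto)
  then have iw: "integrable lborel w" by (simp only: has_bochner_integral_iff)
  have supp: "w r = 0" if "r \<notin> {R0..d}" for r using that abd by (auto simp: w_def indicator_def)
  have "has_bochner_integral lborel (\<lambda>r. c * (\<beta> * (r ^ (2 * k - 1) * indicator {b..d} r)
      - r ^ (2 * k - 1) * indicator {R0..b} r))
     (c * (\<beta> * (d ^ (2 * k) / (2 * real k) - b ^ (2 * k) / (2 * real k)) -
       (b ^ (2 * k) / (2 * real k) - R0 ^ (2 * k) / (2 * real k))))"
    by (intro has_bochner_integral_mult_right has_bochner_integral_diff P) (use abd in auto)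
  moreover have "c * (\<beta> * (r ^ (2 * k - 1) * indicator {b..d} r) - r ^ (2 * k - 1) * indicator {R0..b} r)
      = w r * r ^ k" for r
    unfolding kk[symmetric] w_def by (simp add: algebra_simps)
  moreover have "\<beta> * (d ^ (2 * k) / (2 * real k) - b ^ (2 * k) / (2 * real k))
      = b ^ (2 * k) / (2 * real k) - R0 ^ (2 * k) / (2 * real k)"
  proof -
    have "\<beta> * (d ^ (2 * k) - b ^ (2 * k)) = b ^ (2 * k) - R0 ^ (2 * k)" using pos by (simp add: \<beta>_def)
    then show ?thesis by (simp flip: diff_divide_distrib)
  qed
  ultimately have w0: "(\<integral>r. w r * r ^ k \<partial>lborel) = 0"
    by (simp add: has_bochner_integral_integral_eq)
  have "has_bochner_integral lborel (\<lambda>r. - c / (2 * real k)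
      * (\<beta> * (1 / r * indicator {b..d} r) - 1 / r * indicator {R0..b} r))
     (- c / (2 * real k) * (\<beta> * (ln d - ln b) - (ln b - ln R0)))"
    by (intro has_bochner_integral_mult_right has_bochner_integral_diff J) (use abd R0 in auto)
  moreover have "- c / (2 * real k) * (\<beta> * (1 / r * indicator {b..d} r) - 1 / r * indicator {R0..b} r)
      = w r * log_kernel k r 0" for r
  proof (cases "r \<in> {R0..d}")
    case True
    then have r: "r > 0" "max r 0 = r" using R0 by auto
    have *: "r ^ (k - 1) * (r ^ k / r ^ (2 * k)) = 1 / r"
    proof -
      have "r ^ (2 * k - 1) * r = r ^ (2 * k)" using k by (intro power_minus_mult) auto
      then have "r ^ (2 * k) = r ^ (k - 1) * r ^ k * r" by (simp only: kk)
      then show ?thesis using r by simp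
    qed
    have "r ^ (k - 1) * log_kernel k r 0 = - (r ^ (k - 1) * (r ^ k / r ^ (2 * k))) / (2 * real k)"
      using k r by (simp add: log_kernel_def)
    then have "r ^ (k - 1) * log_kernel k r 0 = - (1 / r) / (2 * real k)" by (simp only: *)
    then have e: "r ^ (k - 1) * (log_kernel k r 0 * x) = - (1 / r) / (2 * real k) * x" for x
      by (simp add: mult.assoc[symmetric])
    have alg: "c * (\<beta> * (- x / y * i) - - x / y * j) = - c / y * (\<beta> * (x * i) - x * j)"
      for x y i j :: real
      by (simp add: divide_inverse algebra_simps)
    have "w r * log_kernel k r 0 = c * (\<beta> * (r ^ (k - 1) * (log_kernel k r 0 * indicator {b..d} r))
        - r ^ (k - 1) * (log_kernel k r 0 * indicator {R0..b} r))"
      by (simp add: w_def algebra_simps)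
    also have "\<dots> = - c / (2 * real k) * (\<beta> * (1 / r * indicator {b..d} r) - 1 / r * indicator {R0..b} r)"
      unfolding e by (rule alg)
    finally show ?thesis by simp
  qed (use abd in \<open>auto simp: w_def indicator_def\<close>)
  moreover have "- c / (2 * real k) * (\<beta> * (ln d - ln b) - (ln b - ln R0)) = 1"
    using l3 \<beta>1 k0 by (simp add: ln c_def field_simps)
  ultimately have "has_bochner_integral lborel (\<lambda>r. w r * log_kernel k r 0) 1"
    by (simp only:)
  then have w1: "(\<integral>r. w r * log_kernel k r 0 \<partial>lborel) = 1"
    by (rule has_bochner_integral_integral_eq)
  have wle: "\<bar>w r\<bar> \<le> (2 * c) * r ^ (k - 1)" if "r \<in> {R0..d}" for r
  proof -
    have r: "r ^ (k - 1) \<ge> 0" using that R0 by simp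
    have "\<bar>\<beta> * (r ^ (k - 1) * indicator {b..d} r) - r ^ (k - 1) * indicator {R0..b} r\<bar>
        \<le> \<bar>\<beta> * (r ^ (k - 1) * indicator {b..d} r)\<bar> + \<bar>r ^ (k - 1) * indicator {R0..b} r\<bar>"
      by (rule abs_triangle_ineq4)
    also have "\<dots> \<le> 1 * (r ^ (k - 1) * 1) + r ^ (k - 1) * 1"
      unfolding abs_mult using r \<beta>0 \<beta>1 by (intro add_mono mult_mono) (auto simp: indicator_def)
    finally have "\<bar>w r\<bar> \<le> c * (1 * (r ^ (k - 1) * 1) + r ^ (k - 1) * 1)"
      unfolding w_def abs_mult using c0 by (intro mult_mono) auto
    then show ?thesis by simp
  qed
  let ?o = "\<lambda>r s :: real. ennreal (r ^ (k - 1) * s ^ (k - 1)) * gef_overlap \<alpha> r s * indicator {R0..d} r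
      * indicator {R0..d} s :: ennreal"
  have "weight_energy \<alpha> w
     \<le> (\<integral>\<^sup>+r. \<integral>\<^sup>+s. ennreal ((2 * c)\<^sup>2) * (?o r s) \<partial>lborel \<partial>lborel)"
    unfolding weight_energy_def
  proof (intro nn_integral_mono)
    fix r s :: real
    show "ennreal \<bar>w r\<bar> * ennreal \<bar>w s\<bar> * gef_overlap \<alpha> r s
       \<le> ennreal ((2 * c)\<^sup>2) * (?o r s)"
    proof (cases "r \<in> {R0..d} \<and> s \<in> {R0..d}")
      case True
      have "\<bar>w r\<bar> * \<bar>w s\<bar> \<le> ((2 * c) * r ^ (k - 1)) * ((2 * c) * s ^ (k - 1))"
        using True R0 c0 by (intro mult_mono wle) auto
      also have "\<dots> = (2 * c)\<^sup>2 * (r ^ (k - 1) * s ^ (k - 1))" by (simp add: power2_eq_square)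
      finally have "ennreal \<bar>w r\<bar> * ennreal \<bar>w s\<bar>
          \<le> ennreal ((2 * c)\<^sup>2) * ennreal (r ^ (k - 1) * s ^ (k - 1))"
        using True R0 by (subst (1 2) ennreal_mult[symmetric]) (auto intro!: ennreal_leI)
      then have "ennreal \<bar>w r\<bar> * ennreal \<bar>w s\<bar> * gef_overlap \<alpha> r s
          \<le> ennreal ((2 * c)\<^sup>2) * ennreal (r ^ (k - 1) * s ^ (k - 1)) * gef_overlap \<alpha> r s"
        by (rule mult_right_mono) simp
      then show ?thesis using True by (simp add: mult.assoc)
    next
      case False
      then have "w r = 0 \<or> w s = 0" using supp by auto
      then show ?thesis by (elim disjE) simp_all
    qed
  qed
  also have "\<dots> = ennreal ((2 * c)\<^sup>2) * (\<integral>\<^sup>+r. \<integral>\<^sup>+s. ?o r s \<partial>lborel \<partial>lborel)"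
  proof -
    have m: "(\<lambda>(r, s). ?o r s) \<in> borel_measurable (lborel \<Otimes>\<^sub>M lborel)"
    proof -
      have [measurable]: "(\<lambda>p. gef_overlap \<alpha> (fst p) (snd p)) \<in> borel_measurable (lborel \<Otimes>\<^sub>M lborel)"
        by (rule measurable_gef_overlap[OF alpha]) auto
      show ?thesis unfolding split_beta' by measurable
    qed
    have "(\<integral>\<^sup>+s. ennreal ((2 * c)\<^sup>2) * (?o r s) \<partial>lborel)
        = ennreal ((2 * c)\<^sup>2) * (\<integral>\<^sup>+s. ?o r s \<partial>lborel)" for r
      by (rule nn_integral_cmult) (use measurable_Pair2[OF m, of r] in simp)
    then show ?thesis
      using lborel.borel_measurable_nn_integral[OF m] by (simp add: nn_integral_cmult)
  qed
  also have "\<dots> \<le> ennreal ((2 * c)\<^sup>2) * ennreal (K * ln (d / R0))"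
    using nn_integral_gef_overlap[OF alpha R0 _ k, of d] abd by (intro mult_left_mono) (auto simp: K_def)
  also have "ln (d / R0) = l + 1" using R0 by (simp add: d_def)
  also have "ennreal ((2 * c)\<^sup>2) * ennreal (K * (l + 1)) = ennreal ((2 * c)\<^sup>2 * (K * (l + 1)))"
    using K l3 by (simp add: ennreal_mult)
  also have "\<dots> \<le> ennreal \<epsilon>"
  proof (rule ennreal_leI)
    have "(2 * c)\<^sup>2 * (K * (l + 1)) \<le> (2 * (2 * real k / (l - 1)))\<^sup>2 * (K * (2 * (l - 1)))"
      using c0 c1 K l3 by (intro mult_mono power_mono) auto
    also have "\<dots> = 32 * (real k)\<^sup>2 * K / (l - 1)"
    proof -
      have "(2 * (2 * real k / x))\<^sup>2 * (K * (2 * x)) = 32 * (real k)\<^sup>2 * K / x" if "x > 0" for x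
        using that by (simp add: power2_eq_square field_simps)
      from this[of "l - 1"] show ?thesis using l3 by simp
    qed
    also have "\<dots> \<le> \<epsilon>"
    proof -
      have "32 * (real k)\<^sup>2 * K / \<epsilon> \<le> l - 1" by (simp add: l_def)
      then show ?thesis using l3 eps by (simp add: field_simps)
    qed
    finally show "(2 * c)\<^sup>2 * (K * (l + 1)) \<le> \<epsilon>" .
  qed
  finally show ?thesis using R0 abd w0 w1 supp iw
    by (intro exI[of _ w] exI[of _ d]) (auto simp: admissible_weight_def)
qed

section \<open>Rigidity\<close>

context gef
begin

text \<open>For each weight the moment over \<open>D\<close> equals \<open>e n\<close> minus the
  contribution of the zeros outside \<open>D\<close> plus the centred statistic \<open>U n\<close>.
  Only the last term is not a function of the outer configuration, and it tends to
  \<open>0\<close>.\<close>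

lemma moment_rigidity:
  fixes D :: "complex set" and k :: nat
  assumes D: "bounded D" and k: "real k * \<alpha> \<le> 1"
  shows "\<exists>S. S \<in> measurable (config_space (- D)) borel \<and>
           (AE \<omega> in M. (\<Sum>z \<in> GEF_zeros \<alpha> \<xi> \<omega> \<inter> D. z ^ k) = S (GEF_zeros \<alpha> \<xi> \<omega> \<inter> - D))"
proof -
  obtain R0 where R0: "R0 > 0" "D \<subseteq> cball 0 R0"
    using D unfolding bounded_pos by (auto simp: subset_iff)
  \<comment> \<open>The energies are chosen summable, with a new outer radius for each
    \<open>n\<close>; the inner radius \<open>R0\<close> stays fixed, since the test functions must
    all be \<open>z ^ k\<close> on \<open>D\<close>.\<close>
  have "\<exists>w R1. admissible_weight k R0 R1 w \<and> weight_energy \<alpha> w \<le> ennreal ((1 / 2) ^ n)" for n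
    using weight_exists_0[OF alpha R0(1)] weight_exists_pos[OF alpha R0(1)] k by (cases "k = 0") auto
  then obtain w R1 where adm: "\<And>n. admissible_weight k R0 (R1 n) (w n)"
    and V: "\<And>n. weight_energy \<alpha> (w n) \<le> ennreal ((1 / 2) ^ n)" by metis
  have R1: "R0 \<le> R1 n" and w: "integrable lborel (w n)" and supp: "\<And>r. r \<notin> {R0..R1 n} \<Longrightarrow> w n r = 0" for n
    using adm[of n] by (auto simp: admissible_weight_def)
  have wm[measurable]: "w n \<in> borel_measurable borel" for n using w[of n] by simp
  define \<psi> where "\<psi> n p = complex_of_real (sgn (w n (fst p))) * cis (real k * snd p)" for n
    and p :: "real \<times> real"
  have \<psi>m[measurable]: "\<psi> n \<in> borel_measurable (borel \<Otimes>\<^sub>M borel)" for n unfolding \<psi>_def by measurable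
  have \<psi>1: "cmod (\<psi> n p) \<le> 1" for n p by (simp add: \<psi>_def norm_mult sgn_real_def)
  define T where "T n = polar_measure (w n)" for n
  define U where "U n \<omega> = (\<integral>p. \<psi> n p * of_real (gef_log (polar p) \<omega>) \<partial>T n)" for n \<omega>
  define e where "e n = complex_of_real (if k = 0
      then \<integral>r. w n r * (ln (sqrt (gef_norm \<alpha> (r\<^sup>2))) + cgauss_log_mean) \<partial>lborel else 0)" for n
  \<comment> \<open>\<open>lim\<close> is total, so \<open>S\<close> is measurable on the whole
    configuration space, whatever its value where the sequence diverges.\<close>
  define S where "S X = lim (\<lambda>n. e n - (\<Sum>a\<in>X \<inter> cball 0 (R1 n). test_fun k (w n) a))" for X
  have Sm: "S \<in> measurable (config_space (- D)) borel"
    unfolding S_def[abs_def]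
    by (intro borel_measurable_lim_metric borel_measurable_diff borel_measurable_const
      measurable_config_sum measurable_test_fun wm)
  obtain C where C: "C \<ge> 0"
    "\<And>w \<psi>. integrable lborel w \<Longrightarrow> (\<And>r. r < 0 \<Longrightarrow> w r = 0) \<Longrightarrow>
      \<psi> \<in> borel_measurable (borel \<Otimes>\<^sub>M borel) \<Longrightarrow> (\<And>p. cmod (\<psi> p) \<le> 1) \<Longrightarrow>
      (AE \<omega> in M. integrable (polar_measure w) (\<lambda>p. gef_log (polar p) \<omega>)) \<and>
      (\<integral>\<^sup>+\<omega>. ennreal ((cmod (\<integral>p. \<psi> p * of_real (gef_log (polar p) \<omega>) \<partial>polar_measure w))\<^sup>2) \<partial>M)
        \<le> ennreal C * weight_energy \<alpha> w"
    using weighted_second_moment by blast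
  have neg: "w n r = 0" if "r < 0" for n r using supp[of r n] that R0 by auto
  have AEint: "AE \<omega> in M. integrable (T n) (\<lambda>p. gef_log (polar p) \<omega>)" for n
    unfolding T_def using C(2)[OF w neg \<psi>m \<psi>1] by blast
  have Ub: "(\<integral>\<^sup>+\<omega>. ennreal ((cmod (U n \<omega>))\<^sup>2) \<partial>M) \<le> ennreal (C * (1 / 2) ^ n)" for n
  proof -
    have "(\<integral>\<^sup>+\<omega>. ennreal ((cmod (U n \<omega>))\<^sup>2) \<partial>M) \<le> ennreal C * weight_energy \<alpha> (w n)"
      unfolding U_def T_def using C(2)[OF w neg \<psi>m \<psi>1] by blast
    also have "\<dots> \<le> ennreal C * ennreal ((1 / 2) ^ n)" by (intro mult_left_mono V) simp
    also have "\<dots> = ennreal (C * (1 / 2) ^ n)" using C(1) by (simp add: ennreal_mult)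
    finally show ?thesis .
  qed
  have Um[measurable]: "U n \<in> borel_measurable M" for n
  proof -
    interpret \<nu>: finite_measure "weight_measure (w n)" by (rule finite_measure_weight_measure[OF w])
    interpret TT: pair_sigma_finite "weight_measure (w n)" circle_measure ..
    have sf: "sigma_finite_measure (T n)" unfolding T_def polar_measure_def
      by (rule TT.sigma_finite_measure_axioms)
    have [measurable]: "(\<lambda>q. gef_log (polar (snd q)) (fst q)) \<in> borel_measurable (M \<Otimes>\<^sub>M T n)"
    proof -
      have "(\<lambda>q. (polar (snd q), fst q)) \<in> measurable (M \<Otimes>\<^sub>M T n) (borel \<Otimes>\<^sub>M M)"
        unfolding T_def polar_measure_def by measurable
      from measurable_compose[OF this measurable_gef_log] show ?thesis by simp
    qed
    have "(\<lambda>(\<omega>, p). \<psi> n p * of_real (gef_log (polar p) \<omega>)) \<in> borel_measurable (M \<Otimes>\<^sub>M T n)"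
      unfolding split_beta' by (rule borel_measurable_times) (unfold T_def polar_measure_def, measurable)
    then show ?thesis unfolding U_def[abs_def]
      by (rule sigma_finite_measure.borel_measurable_lebesgue_integral[OF sf])
  qed
  have "(\<integral>\<^sup>+\<omega>. (\<Sum>n. ennreal ((cmod (U n \<omega>))\<^sup>2)) \<partial>M) = (\<Sum>n. \<integral>\<^sup>+\<omega>. ennreal ((cmod (U n \<omega>))\<^sup>2) \<partial>M)"
    by (rule nn_integral_suminf) measurable
  also have "\<dots> \<le> (\<Sum>n. ennreal (C * (1 / 2) ^ n))"
    by (intro suminf_le Ub) auto
  also have "\<dots> = ennreal (\<Sum>n. C * (1 / 2) ^ n)"
    using C(1) by (intro suminf_ennreal2 summable_mult summable_geometric) auto
  also have "\<dots> < \<infinity>" by simp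
  finally have "AE \<omega> in M. (\<Sum>n. ennreal ((cmod (U n \<omega>))\<^sup>2)) \<noteq> \<infinity>"
    by (intro nn_integral_PInf_AE) auto
  then have AEU: "AE \<omega> in M. (\<lambda>n. U n \<omega>) \<longlonglongrightarrow> 0"
  proof eventually_elim
    case (elim \<omega>)
    then have "summable (\<lambda>n. (cmod (U n \<omega>))\<^sup>2)"
      by (intro summable_suminf_not_top) auto
    then have "(\<lambda>n. sqrt ((cmod (U n \<omega>))\<^sup>2)) \<longlonglongrightarrow> sqrt 0"
      by (intro tendsto_real_sqrt summable_LIMSEQ_zero)
    then show ?case by (simp add: tendsto_norm_zero_iff)
  qed
  have "AE \<omega> in M. \<forall>n. integrable (T n) (\<lambda>p. gef_log (polar p) \<omega>)"
    using AEint by (simp add: AE_all_countable)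
  then have "AE \<omega> in M. (\<Sum>z \<in> GEF_zeros \<alpha> \<xi> \<omega> \<inter> D. z ^ k) = S (GEF_zeros \<alpha> \<xi> \<omega> \<inter> - D)"
    using AEU AE_simple_zeros
  proof eventually_elim
    case (elim \<omega>)
    let ?Z = "GEF_zeros \<alpha> \<xi> \<omega>" and ?B = "\<lambda>n. {a \<in> cball 0 (R1 n). GEF \<alpha> \<xi> \<omega> a = 0}"
    let ?s = "\<Sum>z \<in> ?Z \<inter> D. z ^ k" and ?t = "\<lambda>n. \<Sum>a\<in>(?Z \<inter> - D) \<inter> cball 0 (R1 n). test_fun k (w n) a"
    have hol: "GEF \<alpha> \<xi> \<omega> holomorphic_on UNIV" and simple: "\<And>z. GEF \<alpha> \<xi> \<omega> z = 0 \<Longrightarrow> deriv (GEF \<alpha> \<xi> \<omega>) z \<noteq> 0"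
      using elim(3) by auto
    have Ueq: "U n \<omega> = ?s + ?t n - e n" for n
    proof -
      have fin: "finite (?B n)" by (rule finite_simple_zeros[OF hol simple])
      \<comment> \<open>The zeros in the disc of radius \<open>R0\<close> but outside
        \<open>D\<close> belong to the outer configuration, so they are grouped with those in the
        annulus.\<close>
      have split: "?B n = (?Z \<inter> D) \<union> ((?Z \<inter> - D) \<inter> cball 0 (R1 n))"
        using R0(2) R1[of n] by (auto simp: GEF_zeros_def subset_iff intro: order_trans)
      have "U n \<omega> = (\<Sum>a\<in>?B n. test_fun k (w n) a) - e n"
        unfolding U_def T_def \<psi>_def e_def
        by (rule linear_statistic_eq[OF hol simple adm]) (use elim(1) in \<open>auto simp: T_def\<close>)
      also have "(\<Sum>a\<in>?B n. test_fun k (w n) a)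
          = (\<Sum>a \<in> ?Z \<inter> D. test_fun k (w n) a) + ?t n"
        using fin unfolding split by (intro sum.union_disjoint) auto
      also have "(\<Sum>a \<in> ?Z \<inter> D. test_fun k (w n) a) = ?s"
        by (intro sum.cong refl test_fun_inner[OF adm]) (use R0(2) in auto)
      finally show ?thesis .
    qed
    have "(\<lambda>n. ?s - U n \<omega>) \<longlonglongrightarrow> ?s - 0"
      by (intro tendsto_intros elim(2))
    then have "(\<lambda>n. e n - ?t n) \<longlonglongrightarrow> ?s"
      by (simp add: Ueq)
    then show ?case unfolding S_def by (rule limI[symmetric])
  qed
  with Sm show ?thesis by blast
qed

end

theorem theorem3p1:
  fixes M :: "'w measure" and \<xi> :: "nat \<Rightarrow> 'w \<Rightarrow> complex"
    and \<alpha> :: real and D :: "complex set" and k :: nat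
  assumes "prob_space M"
    and "prob_space.indep_vars M (\<lambda>_. borel) \<xi> UNIV"
    and "\<And>j. distributed M lborel (\<xi> j) std_complex_gaussian_density"
    and "\<alpha> > 0"
    and "open D" and "bounded D"
    and "int k \<le> \<lfloor>1 / \<alpha>\<rfloor>"
  shows "\<exists>S :: complex set \<Rightarrow> complex. S \<in> measurable (config_space (- D)) borel \<and>
           (AE \<omega> in M. (\<Sum>z \<in> GEF_zeros \<alpha> \<xi> \<omega> \<inter> D. z ^ k)
                        = S (GEF_zeros \<alpha> \<xi> \<omega> \<inter> - D))"
proof -
  interpret prob_space M by fact
  interpret gef M \<xi> \<alpha> by unfold_locales fact+
  have "real k \<le> 1 / \<alpha>" using assms(7) by (simp add: le_floor_iff)
  then have "real k * \<alpha> \<le> 1" using assms(4) by (simp add: field_simps)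
  from moment_rigidity[OF assms(6) this] show ?thesis .
qed

end
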